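(* Let $\{S_n\}_{n\ge0}$ be the SRRW-RVM with zero mean, unit variance innovation sequence $\{\xi_n\}$, memory sequence $\{\mu_n\}$ and recollection probability $p$. If $p=p_c$ and $\{\mu_n\}$ satisfies Assumption A (see context, with parameters $\gamma,\alpha$) with $\alpha+\gamma+1>0$, then $$\left(\frac{S_{\lfloor nt\rfloor}}{\sqrt{n\log n}}:t\ge0\right)\to\left(\sqrt t\,N:t\ge0\right)\quad\text{weakly in }D([0,\infty)),$$ where $N$ is a centered Gaussian random variable with variance $\dfrac{(2\gamma+1)^2(\gamma+1)}{\alpha+\gamma+1}$.
   Context: Model (SRRW-RVM). Fix $p\in[0,1]$ (recollection probability) and $\gamma>-1$. Let $\{\mu_n\}_{n\ge1}$ (memory sequence) be a sequence of positive reals, regularly varying of index $\gamma$: $\mu_{\lfloor\lambda n\rfloor}/\mu_n\to\lambda^\gamma$ for every $\lambda>0$. Put $\nu_n=\sum_{k=1}^n\mu_k$. Let $\{\xi_n\}_{n\ge1}$ (innovation sequence) be i.i.d. real random variables with mean $0$; $\{\alpha_n\}_{n\ge2}$ i.i.d. Bernoulli($p$); $\{\beta_n\}_{n\ge2}$ independent with $\mathbb{P}(\beta_n=k)=\mu_k/\nu_{n-1}$ for $1\le k\le n-1$; the three sequences are independent of each other. Set $X_1=\xi_1$ and, for $n\ge1$, $X_{n+1}=\alpha_{n+1}X_{\beta_{n+1}}+(1-\alpha_{n+1})\xi_{n+1}$. The walk is $S_0=0$, $S_n=\sum_{k=1}^nX_k$. $p_c=(\gamma+\frac12)/(\gamma+1)$.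 $D([0,\infty))$ is the space of r.c.l.l. functions on $[0,\infty)$ with the Skorohod topology. Assumption A. $\mu_n=\mu(n)$ for a function $\mu:[1,\infty)\to(0,\infty)$ that is eventually monotone and regularly varying of index $\gamma$, and $\mu(x)=x^\gamma\ell(x)$, where: (i) for some $B>1$, $\ell(x)=f(\log x)$ for $x>e^B$, where, for some $\alpha\in\mathbb{R}$, $f:(B,\infty)\to(0,\infty)$ is regularly varying of index $\alpha$ of the form $f(x)=x^\alpha\exp\left(\int_{\log B}^{\log x}\zeta(s)\,ds\right)$, with $\zeta$ integrable on $(\log B,x)$ for all finite $x$ and $\zeta(x)\to0$ as $x\to\infty$; (ii) $\zeta$ is of one of three types: (a) $\zeta\equiv0$; (b) $\zeta$ is nonincreasing (hence positive), regularly varying of index $-\rho$ with $\rho\in(0,1]$, $\int_{\log B}^\infty\zeta(x)\,dx=\infty$, and $\zeta$ is eventually differentiable with monotone derivative; (c) $\zeta=-\widetilde\zeta$ with $\widetilde\zeta$ satisfying the conditions in (b). *)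

theory Defs
  imports "HOL-Probability.Probability"
begin

section \<open>Regular variation\<close>

definition regularly_varying_seq :: "(nat \<Rightarrow> real) \<Rightarrow> real \<Rightarrow> bool" where
  "regularly_varying_seq u \<gamma> \<longleftrightarrow>
     (\<forall>c>0. (\<lambda>n. u (nat \<lfloor>c * real n\<rfloor>) / u n) \<longlonglongrightarrow> c powr \<gamma>)"

text \<open>Only the behaviour near infinity matters, so a function on a half-line is represented by an
  arbitrary extension to all reals. Measurability is not demanded: it is automatic near infinity
  wherever the notion is used below.\<close>

definition regularly_varying :: "(real \<Rightarrow> real) \<Rightarrow> real \<Rightarrow> bool" where
  "regularly_varying f \<gamma> \<longleftrightarrow>
     (\<forall>\<^sub>F x in at_top. 0 < f x) \<and>
     (\<forall>c>0. ((\<lambda>x. f (c * x) / f x) \<longlongrightarrow> c powr \<gamma>) at_top)"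

section \<open>The step-reinforced random walk with regularly varying memory\<close>

text \<open>One realisation of the steps, as a function of the realised innovations \<open>\<xi>\<close>, recollection
  indicators \<open>\<alpha>\<close> and recalled times \<open>\<beta>\<close>. The inner case distinction makes the recursion well-founded
  for arbitrary \<open>\<beta>\<close>; in the model \<open>\<beta> n\<close> lies in \<open>{1..n-1}\<close> almost surely. Index 0 is a dummy.\<close>

function srrw_step :: "(nat \<Rightarrow> real) \<Rightarrow> (nat \<Rightarrow> bool) \<Rightarrow> (nat \<Rightarrow> nat) \<Rightarrow> nat \<Rightarrow> real" where
  "srrw_step \<xi> \<alpha> \<beta> n =
     (if n \<le> 1 then \<xi> 1
      else of_bool (\<alpha> n) * (if 1 \<le> \<beta> n \<and> \<beta> n < n then srrw_step \<xi> \<alpha> \<beta> (\<beta> n) else 0)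
           + (1 - of_bool (\<alpha> n)) * \<xi> n)"
  by pat_completeness auto
termination
  by (relation "Wellfounded.measure (\<lambda>(\<xi>, \<alpha>, \<beta>, n). n)") auto

declare srrw_step.simps [simp del]

definition srrw ::
  "(nat \<Rightarrow> 'a \<Rightarrow> real) \<Rightarrow> (nat \<Rightarrow> 'a \<Rightarrow> bool) \<Rightarrow> (nat \<Rightarrow> 'a \<Rightarrow> nat) \<Rightarrow> nat \<Rightarrow> 'a \<Rightarrow> real" where
  "srrw \<xi> \<alpha> \<beta> n \<omega> = (\<Sum>k=1..n. srrw_step (\<lambda>i. \<xi> i \<omega>) (\<lambda>i. \<alpha> i \<omega>) (\<lambda>i. \<beta> i \<omega>) k)"

text \<open>In the last assumption the three sequences \<open>(\<xi> n)\<close>, \<open>n \<ge> 1\<close>, and \<open>(\<alpha> n)\<close>, \<open>(\<beta> n)\<close>,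
  \<open>n \<ge> 2\<close>, are viewed as three random elements of the space of real sequences, so that
  their mutual independence is an instance of \<open>indep_vars\<close>.\<close>

locale srrw_rvm = prob_space M for M :: "'a measure" +
  fixes p \<gamma> :: real
    and \<mu> :: "nat \<Rightarrow> real"
    and \<xi> :: "nat \<Rightarrow> 'a \<Rightarrow> real"
    and \<alpha> :: "nat \<Rightarrow> 'a \<Rightarrow> bool"
    and \<beta> :: "nat \<Rightarrow> 'a \<Rightarrow> nat"
  assumes p_range: "0 \<le> p" "p \<le> 1"
    and gamma_gt: "-1 < \<gamma>"
    and memory_pos: "\<And>n. 1 \<le> n \<Longrightarrow> 0 < \<mu> n"
    and memory_rv: "regularly_varying_seq \<mu> \<gamma>"
    and innov_indep: "indep_vars (\<lambda>_. borel) \<xi> {1..}"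
    and innov_ident: "\<And>n. 1 \<le> n \<Longrightarrow> distr M borel (\<xi> n) = distr M borel (\<xi> 1)"
    and innov_integrable: "integrable M (\<xi> 1)"
    and innov_mean: "expectation (\<xi> 1) = 0"
    and recoll_indep: "indep_vars (\<lambda>_. count_space UNIV) \<alpha> {2..}"
    and recoll_law: "\<And>n. 2 \<le> n \<Longrightarrow> distr M (count_space UNIV) (\<alpha> n) = measure_pmf (bernoulli_pmf p)"
    and recall_indep: "indep_vars (\<lambda>_. count_space UNIV) \<beta> {2..}"
    and recall_law: "\<And>n k. 2 \<le> n \<Longrightarrow> 1 \<le> k \<Longrightarrow> k \<le> n - 1 \<Longrightarrow>
          prob {\<omega> \<in> space M. \<beta> n \<omega> = k} = \<mu> k / (\<Sum>j=1..n-1. \<mu> j)"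
    and sequences_indep: "indep_vars (\<lambda>_. \<Pi>\<^sub>M k\<in>UNIV. borel)
          (\<lambda>i \<omega> k. if i = 0 then \<xi> (k + 1) \<omega>
                   else if i = 1 then of_bool (\<alpha> (k + 2) \<omega>)
                   else real (\<beta> (k + 2) \<omega>)) {0, 1, 2 :: nat}"

definition critical_prob :: "real \<Rightarrow> real" where
  "critical_prob \<gamma> = (\<gamma> + 1 / 2) / (\<gamma> + 1)"

section \<open>The assumption on the memory sequence\<close>

definition eventually_monotone :: "(real \<Rightarrow> real) \<Rightarrow> bool" where
  "eventually_monotone f \<longleftrightarrow> (\<exists>c. mono_on {c..} f \<or> antimono_on {c..} f)"

definition slowly_decaying :: "real \<Rightarrow> (real \<Rightarrow> real) \<Rightarrow> bool" where
  "slowly_decaying b \<zeta> \<longleftrightarrow>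
     antimono_on {b<..} \<zeta> \<and> (\<forall>s>b. 0 < \<zeta> s) \<and>
     (\<exists>\<rho>. 0 < \<rho> \<and> \<rho> \<le> 1 \<and> regularly_varying \<zeta> (- \<rho>)) \<and>
     (\<integral>\<^sup>+ s\<in>{b<..}. ennreal (\<zeta> s) \<partial>lborel) = \<infinity> \<and>
     (\<exists>c. (\<forall>s>c. \<zeta> differentiable at s)) \<and> eventually_monotone (deriv \<zeta>)"

definition memory_assumption :: "(nat \<Rightarrow> real) \<Rightarrow> real \<Rightarrow> real \<Rightarrow> bool" where
  "memory_assumption \<mu> \<gamma> a \<longleftrightarrow>
     (\<exists>m \<l> f \<zeta> :: real \<Rightarrow> real. \<exists>B>1.
        (\<forall>n\<ge>1. \<mu> n = m (real n)) \<and>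
        (\<forall>x\<ge>1. 0 < m x) \<and>
        eventually_monotone m \<and>
        regularly_varying m \<gamma> \<and>
        (\<forall>x\<ge>1. m x = x powr \<gamma> * \<l> x) \<and>
        (\<forall>x>exp B. \<l> x = f (ln x)) \<and>
        regularly_varying f a \<and>
        (\<forall>x>B. f x = x powr a * exp (\<integral>s\<in>{ln B<..<ln x}. \<zeta> s \<partial>lborel)) \<and>
        (\<forall>x>ln B. set_integrable lborel {ln B<..<x} \<zeta>) \<and>
        (\<zeta> \<longlongrightarrow> 0) at_top \<and>
        ((\<forall>s>ln B. \<zeta> s = 0) \<or>
         slowly_decaying (ln B) \<zeta> \<or>
         slowly_decaying (ln B) (\<lambda>s. - \<zeta> s)))"

section \<open>The Skorohod space on the half-line\<close>

text \<open>As usual for function spaces over a proper subset of a type, elements are extensional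
  (equal to \<open>undefined\<close> on negative arguments).\<close>

definition skorohod_space :: "(real \<Rightarrow> real) set" where
  "skorohod_space = {x \<in> extensional {0..}.
     (\<forall>t\<ge>0. (x \<longlongrightarrow> x t) (at_right t)) \<and>
     (\<forall>t>0. \<exists>l. (x \<longlongrightarrow> l) (at_left t))}"

text \<open>Increasing bijections of the half-line; continuity is automatic.\<close>

definition time_change :: "(real \<Rightarrow> real) \<Rightarrow> bool" where
  "time_change \<tau> \<longleftrightarrow> strict_mono_on {0..} \<tau> \<and> bij_betw \<tau> {0..} {0..}"

definition skorohod_conv :: "(nat \<Rightarrow> real \<Rightarrow> real) \<Rightarrow> (real \<Rightarrow> real) \<Rightarrow> bool" where
  "skorohod_conv x y \<longleftrightarrow> (\<exists>\<tau>. (\<forall>n. time_change (\<tau> n)) \<and>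
     uniform_limit {0..} \<tau> (\<lambda>t. t) sequentially \<and>
     (\<forall>T. uniform_limit {0..T} (\<lambda>n t. x n (\<tau> n t)) y sequentially))"

text \<open>The Skorohod (J1) topology is metrizable and is characterised by its convergent sequences,
  which are the ones above (Billingsley, Convergence of Probability Measures, 2nd ed., Theorem 16.1;
  Jacod and Shiryaev, Limit Theorems for Stochastic Processes, Theorem VI.1.14). Hence its open
  sets are exactly the sequentially open ones.\<close>

definition skorohod_topology :: "(real \<Rightarrow> real) topology" where
  "skorohod_topology = topology (\<lambda>U. U \<subseteq> skorohod_space \<and>
     (\<forall>x y. y \<in> U \<longrightarrow> (\<forall>n. x n \<in> skorohod_space) \<longrightarrow> skorohod_conv x y \<longrightarrow>
        (\<forall>\<^sub>F n in sequentially. x n \<in> U)))"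

lemma openin_skorohod_topology:
  "openin skorohod_topology U \<longleftrightarrow> U \<subseteq> skorohod_space \<and>
     (\<forall>x y. y \<in> U \<longrightarrow> (\<forall>n. x n \<in> skorohod_space) \<longrightarrow> skorohod_conv x y \<longrightarrow>
        (\<forall>\<^sub>F n in sequentially. x n \<in> U))"
proof -
  have "istopology (\<lambda>U. U \<subseteq> skorohod_space \<and>
     (\<forall>x y. y \<in> U \<longrightarrow> (\<forall>n. x n \<in> skorohod_space) \<longrightarrow> skorohod_conv x y \<longrightarrow>
        (\<forall>\<^sub>F n in sequentially. x n \<in> U)))" (is "istopology ?P")
    unfolding istopology_def
  proof (intro conjI allI impI)
    fix U V assume U: "?P U" and V: "?P V"
    then show "U \<inter> V \<subseteq> skorohod_space" by blast
    fix x y assume "y \<in> U \<inter> V" "\<forall>n. x n \<in> skorohod_space" "skorohod_conv x y"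
    with U V have "\<forall>\<^sub>F n in sequentially. x n \<in> U" "\<forall>\<^sub>F n in sequentially. x n \<in> V"
      by blast+
    then show "\<forall>\<^sub>F n in sequentially. x n \<in> U \<inter> V"
      by eventually_elim blast
  next
    fix \<U> assume \<U>: "\<forall>U\<in>\<U>. ?P U"
    then show "\<Union>\<U> \<subseteq> skorohod_space" by blast
    fix x y assume y: "y \<in> \<Union>\<U>" and x: "\<forall>n. x n \<in> skorohod_space" "skorohod_conv x y"
    from y obtain U where U: "U \<in> \<U>" "y \<in> U" by blast
    with \<U> x have "\<forall>\<^sub>F n in sequentially. x n \<in> U" by blast
    then show "\<forall>\<^sub>F n in sequentially. x n \<in> \<Union>\<U>"
      by eventually_elim (use U in blast)
  qed
  then show ?thesis
    unfolding skorohod_topology_def by (simp add: topology_inverse')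
qed

lemma topspace_skorohod_topology [simp]: "topspace skorohod_topology = skorohod_space"
proof (rule antisym)
  show "topspace skorohod_topology \<subseteq> skorohod_space"
    using openin_topspace[of skorohod_topology] by (simp only: openin_skorohod_topology)
  have "openin skorohod_topology skorohod_space"
    by (simp add: openin_skorohod_topology)
  then show "skorohod_space \<subseteq> topspace skorohod_topology"
    by (rule openin_subset)
qed

section \<open>Weak convergence and the limit law\<close>

definition borel_of :: "'c topology \<Rightarrow> 'c measure" where
  "borel_of T = sigma (topspace T) {U. openin T U}"

definition converges_weakly_in ::
  "'c topology \<Rightarrow> 'a measure \<Rightarrow> (nat \<Rightarrow> 'a \<Rightarrow> 'c) \<Rightarrow> 'b measure \<Rightarrow> ('b \<Rightarrow> 'c) \<Rightarrow> bool" where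
  "converges_weakly_in T M Y M' Z \<longleftrightarrow>
     (\<forall>n. Y n \<in> M \<rightarrow>\<^sub>M borel_of T) \<and> Z \<in> M' \<rightarrow>\<^sub>M borel_of T \<and>
     (\<forall>\<Phi>. continuous_map T euclideanreal \<Phi> \<longrightarrow> bounded (\<Phi> ` topspace T) \<longrightarrow>
        (\<lambda>n. \<integral>\<omega>. \<Phi> (Y n \<omega>) \<partial>M) \<longlonglongrightarrow> (\<integral>\<omega>. \<Phi> (Z \<omega>) \<partial>M'))"

text \<open>Variance 0, which occurs below when \<open>\<gamma> = -1/2\<close>, is allowed and means a point mass at 0;
  \<open>normal_density\<close> alone does not cover it.\<close>

definition centered_gaussian :: "real \<Rightarrow> real measure" where
  "centered_gaussian v =
     (if v = 0 then return borel 0 else density lborel (normal_density 0 (sqrt v)))"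

end

theory Submission
  imports Defs "HOL-Real_Asymp.Real_Asymp"
begin

text \<open>A step of the walk repeats the innovation at the root of its genealogical tree, so that the
  memory-weighted sum \<open>Y n = (\<Sum>k\<le>n. \<mu> k * X k)\<close> equals \<open>\<Sum>i\<le>n. D n i * \<xi> i\<close> with the cluster weights \<open>D n i\<close>,
  which are independent of the innovations. Normalised by its amplification factor, \<open>Y\<close> is a
  martingale \<open>MM\<close> whose variance \<open>s\<close> is slowly varying at the critical point. The second
  powers of the cluster weights concentrate, because their variance and their third powers stay bounded
  after normalisation; hence conditioning on the genealogy gives a central limit theorem for
  \<open>MM n / sqrt (s n)\<close> without any moment beyond the second.

  The walk itself is a martingale \<open>R\<close> with bounded second moments of increments, negligible on the scale
  \<open>sqrt (n * ln n)\<close> by Doob's inequality, plus \<open>p\<close> times a sum of the \<open>MM k\<close> with weights \<open>g k\<close> of index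
  \<open>-1/2\<close>. As \<open>MM\<close> varies on the logarithmic time scale, it may be frozen at time \<open>n\<close>, which leaves
  \<open>sqrt t\<close> times a single random variable.\<close>

section \<open>Sequences of a given index\<close>

text \<open>At the critical point first-order terms cancel, and the variance of the limit is decided
  one order later. By definition \<open>(g n)\<^sup>2 = 1 / (n * l n)\<close> with \<open>l\<close>
  slowly varying, and one step adds about \<open>\<kappa>\<^sup>2 * l n / n\<close> to
  \<open>s n\<close>. The growth of \<open>s\<close> thus hinges on how \<open>l\<close> varies on
  the scale \<open>n * ln n\<close>, where the index \<open>a\<close> of the memory shows up: the
  relative increments of \<open>l\<close> are about \<open>(a / \<kappa>) / (n * ln n)\<close>.
  Summation gives \<open>\<kappa>\<^sup>2 * l n * ln n / (1 + a / \<kappa>)\<close>, and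
  \<open>a + \<kappa> > 0\<close> is what makes this diverge. The walk multiplies \<open>s n\<close>
  by the square of \<open>p * G n\<close>, where \<open>G n\<close> is about
  \<open>2 * n * g n\<close>; the factor \<open>l\<close> cancels, and \<open>n * ln n\<close>
  remains with the coefficient \<open>4 * p\<^sup>2 * \<kappa> ^ 3 / (a + \<kappa>)\<close>, which
  \<open>p * \<kappa> = \<gamma> + 1 / 2\<close> turns into the stated variance. The detour through
  clusters answers an obstacle: squares of innovations need not have second moments. Cluster weights
  are bounded functions of the genealogy, and the means of their power sums satisfy linear
  recursions.\<close>

lemma stolz_cesaro:
  fixes A B :: "nat \<Rightarrow> real"
  assumes incr: "\<forall>\<^sub>F n in sequentially. B n < B (Suc n)"
    and top: "filterlim B at_top sequentially"
    and conv: "(\<lambda>n. (A (Suc n) - A n) / (B (Suc n) - B n)) \<longlonglongrightarrow> L"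
  shows "(\<lambda>n. A n / B n) \<longlonglongrightarrow> L"
proof (rule LIMSEQ_I)
  fix e :: real assume e: "0 < e"
  have "\<forall>\<^sub>F n in sequentially. \<bar>(A (Suc n) - A n) / (B (Suc n) - B n) - L\<bar> < e / 2"
    using tendstoD[OF conv, of "e / 2"] e by (simp add: dist_real_def)
  with incr have "\<forall>\<^sub>F n in sequentially.
      \<bar>(A (Suc n) - L * B (Suc n)) - (A n - L * B n)\<bar> \<le> e / 2 * (B (Suc n) - B n)"
  proof eventually_elim
    case (elim n)
    have "(A (Suc n) - L * B (Suc n)) - (A n - L * B n)
        = ((A (Suc n) - A n) / (B (Suc n) - B n) - L) * (B (Suc n) - B n)"
      using elim(1) by (simp add: field_simps)
    also have "\<bar>\<dots>\<bar> \<le> e / 2 * (B (Suc n) - B n)"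
      using elim by (auto simp: abs_mult intro!: mult_mono)
    finally show ?case .
  qed
  then obtain N where N: "\<And>n. n \<ge> N \<Longrightarrow>
      \<bar>(A (Suc n) - L * B (Suc n)) - (A n - L * B n)\<bar> \<le> e / 2 * (B (Suc n) - B n)"
    by (auto simp: eventually_sequentially)
  have bound: "\<bar>(A n - L * B n) - (A N - L * B N)\<bar> \<le> e / 2 * (B n - B N)" if "n \<ge> N" for n
    using that
  proof (induction n rule: dec_induct)
    case (step n)
    have "e / 2 * (B (Suc n) - B N) = e / 2 * (B (Suc n) - B n) + e / 2 * (B n - B N)"
      by (simp add: field_simps)
    then show ?case using N[of n] step by linarith
  qed simp
  \<comment> \<open>\<open>C\<close> collects what the telescoped bound leaves of the starting index
    \<open>N\<close>; it drops below \<open>e / 2 * B n\<close> once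
    \<open>B n > 2 * C / e\<close>.\<close>
  define C where "C = \<bar>A N - L * B N\<bar> + e / 2 * \<bar>B N\<bar>"
  have "\<forall>\<^sub>F n in sequentially. B n > 2 * C / e + 1"
    using top unfolding filterlim_at_top_dense by blast
  with eventually_ge_at_top[of N] have "\<forall>\<^sub>F n in sequentially. norm (A n / B n - L) < e"
  proof eventually_elim
    case (elim n)
    have "C \<ge> 0" using e by (simp add: C_def)
    then have Bpos: "B n > 0" using elim e by (smt (verit) divide_nonneg_pos)
    have "\<bar>A n - L * B n\<bar> \<le> e / 2 * B n + C"
    proof -
      have "e / 2 * (- B N) \<le> e / 2 * \<bar>B N\<bar>" using e by (intro mult_left_mono) auto
      moreover have "e / 2 * (B n - B N) = e / 2 * B n + e / 2 * (- B N)" by (simp add: field_simps)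
      ultimately show ?thesis using bound[OF elim(1)] unfolding C_def by linarith
    qed
    also have "C < e / 2 * B n" using elim(2) e by (simp add: field_simps)
    finally have *: "\<bar>A n - L * B n\<bar> < e * B n" by simp
    have "\<bar>A n / B n - L\<bar> = \<bar>A n - L * B n\<bar> / B n"
      using Bpos by (simp add: field_simps abs_divide)
    also have "\<dots> < e" using * Bpos by (simp add: field_simps)
    finally show ?case by simp
  qed
  then show "\<exists>no. \<forall>n\<ge>no. norm (A n / B n - L) < e"
    by (simp add: eventually_sequentially)
qed

text \<open>A smooth version of regular variation, stable under products, quotients and summation.\<close>

definition has_index :: "(nat \<Rightarrow> real) \<Rightarrow> real \<Rightarrow> bool" where
  "has_index u r \<longleftrightarrow> (\<forall>\<^sub>F n in sequentially. 0 < u n) \<and>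
     (\<lambda>n. real n * (u (Suc n) / u n - 1)) \<longlonglongrightarrow> r"

lemma has_index_pos: "has_index u r \<Longrightarrow> \<forall>\<^sub>F n in sequentially. 0 < u n"
  and has_index_lim: "has_index u r \<Longrightarrow> (\<lambda>n. real n * (u (Suc n) / u n - 1)) \<longlonglongrightarrow> r"
  by (simp_all add: has_index_def)

lemma has_index_ratio:
  assumes "has_index u r" shows "(\<lambda>n. u (Suc n) / u n) \<longlonglongrightarrow> 1"
proof -
  have "(\<lambda>n. 1 + real n * (u (Suc n) / u n - 1) * (1 / real n)) \<longlonglongrightarrow> 1 + r * 0"
    by (intro tendsto_intros has_index_lim[OF assms])
  moreover have "\<forall>\<^sub>F n in sequentially.
      1 + real n * (u (Suc n) / u n - 1) * (1 / real n) = u (Suc n) / u n"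
    using eventually_gt_at_top[of 0] by eventually_elim simp
  ultimately show ?thesis
    using Lim_transform_eventually by fastforce
qed

lemma has_index_cong:
  assumes "has_index u r" "\<forall>\<^sub>F n in sequentially. u n = v n"
  shows "has_index v r"
  unfolding has_index_def
proof
  show "\<forall>\<^sub>F n in sequentially. 0 < v n"
    using has_index_pos[OF assms(1)] assms(2) by eventually_elim simp
  have "\<forall>\<^sub>F n in sequentially. u (Suc n) = v (Suc n)"
    using assms(2) by (subst eventually_sequentially_Suc)
  with assms(2) show "(\<lambda>n. real n * (v (Suc n) / v n - 1)) \<longlonglongrightarrow> r"
    by (intro Lim_transform_eventually[OF has_index_lim[OF assms(1)]])
       (auto elim: eventually_elim2)
qed

lemma has_index_mult:
  assumes "has_index u r" "has_index v s"
  shows "has_index (\<lambda>n. u n * v n) (r + s)"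
  unfolding has_index_def
proof
  show "\<forall>\<^sub>F n in sequentially. 0 < u n * v n"
    using has_index_pos[OF assms(1)] has_index_pos[OF assms(2)] by eventually_elim simp
  have "(\<lambda>n. real n * (u (Suc n) / u n - 1) + (u (Suc n) / u n) * (real n * (v (Suc n) / v n - 1)))
      \<longlonglongrightarrow> r + 1 * s"
    by (intro tendsto_intros has_index_lim[OF assms(1)] has_index_ratio[OF assms(1)] has_index_lim[OF assms(2)])
  then show "(\<lambda>n. real n * (u (Suc n) * v (Suc n) / (u n * v n) - 1)) \<longlonglongrightarrow> r + s"
    by (simp add: algebra_simps)
qed

lemma has_index_inverse:
  assumes "has_index u r" shows "has_index (\<lambda>n. inverse (u n)) (- r)"
  unfolding has_index_def
proof
  show "\<forall>\<^sub>F n in sequentially. 0 < inverse (u n)"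
    using has_index_pos[OF assms] by eventually_elim simp
  have "(\<lambda>n. - (real n * (u (Suc n) / u n - 1)) / (u (Suc n) / u n)) \<longlonglongrightarrow> - r / 1"
    by (intro tendsto_intros has_index_lim[OF assms] has_index_ratio[OF assms]) simp
  moreover have pos: "\<forall>\<^sub>F n in sequentially. 0 < u n" "\<forall>\<^sub>F n in sequentially. 0 < u (Suc n)"
    using has_index_pos[OF assms] by (simp_all add: eventually_sequentially_Suc[of "\<lambda>n. 0 < u n"])
  moreover from pos have "\<forall>\<^sub>F n in sequentially.
      - (real n * (u (Suc n) / u n - 1)) / (u (Suc n) / u n)
      = real n * (inverse (u (Suc n)) / inverse (u n) - 1)"
    by eventually_elim (simp add: field_simps)
  ultimately show "(\<lambda>n. real n * (inverse (u (Suc n)) / inverse (u n) - 1)) \<longlonglongrightarrow> - r"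
    using Lim_transform_eventually by fastforce
qed

lemma has_index_divide:
  assumes "has_index u r" "has_index v s" shows "has_index (\<lambda>n. u n / v n) (r - s)"
  using has_index_mult[OF assms(1) has_index_inverse[OF assms(2)]] by (simp add: divide_inverse)

lemma has_index_power:
  assumes "has_index u r" shows "has_index (\<lambda>n. u n ^ k) (real k * r)"
proof (induction k)
  case 0
  then show ?case by (simp add: has_index_def)
next
  case (Suc k)
  from has_index_mult[OF assms Suc] show ?case by (simp add: algebra_simps)
qed

lemma has_index_cmult:
  assumes "has_index u r" "c > 0" shows "has_index (\<lambda>n. c * u n) r"
  using assms by (auto simp: has_index_def elim: eventually_mono)

lemma has_index_shift:
  assumes "has_index u r" shows "has_index (\<lambda>n. u (Suc n)) r"
  unfolding has_index_def
proof
  show "\<forall>\<^sub>F n in sequentially. 0 < u (Suc n)"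
    using has_index_pos[OF assms] by (subst eventually_sequentially_Suc)
  have "(\<lambda>n. real (Suc n) * (u (Suc (Suc n)) / u (Suc n) - 1)) \<longlonglongrightarrow> r"
    using has_index_lim[OF assms] by (rule LIMSEQ_Suc)
  moreover have "(\<lambda>n. real n / real (Suc n)) \<longlonglongrightarrow> 1" by real_asymp
  ultimately have "(\<lambda>n. real n / real (Suc n) * (real (Suc n) * (u (Suc (Suc n)) / u (Suc n) - 1))) \<longlonglongrightarrow> 1 * r"
    by (intro tendsto_intros)
  then show "(\<lambda>n. real n * (u (Suc (Suc n)) / u (Suc n) - 1)) \<longlonglongrightarrow> r"
    by (simp del: of_nat_Suc)
qed

lemma has_index_powr: "has_index (\<lambda>n. real n powr c) c"
  unfolding has_index_def
proof
  show "\<forall>\<^sub>F n in sequentially. 0 < real n powr c"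
    using eventually_gt_at_top[of 0] by eventually_elim simp
  show "(\<lambda>n. real n * (real (Suc n) powr c / real n powr c - 1)) \<longlonglongrightarrow> c"
    by real_asymp
qed

lemma has_index_id: "has_index real 1"
  by (rule has_index_cong[OF has_index_powr]) (auto intro: eventually_mono[OF eventually_gt_at_top[of 0]])

lemma has_index_ln: "has_index (\<lambda>n. ln (real n)) 0"
proof -
  have "\<forall>\<^sub>F n in sequentially. 0 < ln (real n)" by real_asymp
  moreover have "(\<lambda>n. real n * (ln (real n + 1) - ln (real n)) / ln (real n)) \<longlonglongrightarrow> 0"
    by real_asymp
  then have "(\<lambda>n. real n * (ln (real n + 1) / ln (real n) - 1)) \<longlonglongrightarrow> 0"
  proof (rule Lim_transform_eventually)
    show "\<forall>\<^sub>F n in sequentially. real n * (ln (real n + 1) - ln (real n)) / ln (real n)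
        = real n * (ln (real n + 1) / ln (real n) - 1)"
      using eventually_gt_at_top[of 1] by eventually_elim (simp add: field_simps)
  qed
  ultimately show ?thesis by (simp add: has_index_def add.commute)
qed

lemma has_index_incr:
  assumes "has_index u r" "r > 0" shows "\<forall>\<^sub>F n in sequentially. u n < u (Suc n)"
proof -
  have "\<forall>\<^sub>F n in sequentially. 0 < real n * (u (Suc n) / u n - 1)"
    using order_tendstoD(1)[OF has_index_lim[OF assms(1)] assms(2)] .
  with has_index_pos[OF assms(1)] eventually_gt_at_top[of 0] show ?thesis
    by eventually_elim (auto simp: zero_less_mult_iff field_simps)
qed

lemma eventually_incr_bounded_below:
  fixes v :: "nat \<Rightarrow> real"
  assumes "\<forall>\<^sub>F n in sequentially. v n < v (Suc n)" "\<forall>\<^sub>F n in sequentially. 0 < v n"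
  shows "\<exists>c>0. \<forall>\<^sub>F n in sequentially. c \<le> v n"
proof -
  from eventually_conj[OF assms] obtain N where N: "\<And>n. n \<ge> N \<Longrightarrow> v n < v (Suc n) \<and> 0 < v n"
    by (auto simp: eventually_sequentially)
  have "v N \<le> v n" if "n \<ge> N" for n
    using that by (induction n rule: dec_induct) (use N in \<open>auto intro: less_imp_le order_trans\<close>)
  then show ?thesis using N[of N] by (auto simp: eventually_sequentially)
qed

text \<open>Potter's bound: division by a power of smaller index leaves a sequence of positive
  index, which is eventually increasing and hence bounded away from 0.\<close>

lemma has_index_lower_bound:
  assumes "has_index u r" "c < r"
  shows "\<exists>k>0. \<forall>\<^sub>F n in sequentially. k * real n powr c \<le> u n"
proof -
  have i: "has_index (\<lambda>n. u n / real n powr c) (r - c)"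
    by (rule has_index_divide[OF assms(1) has_index_powr])
  obtain k where k: "k > 0" "\<forall>\<^sub>F n in sequentially. k \<le> u n / real n powr c"
    using eventually_incr_bounded_below[OF has_index_incr[OF i] has_index_pos[OF i]] assms(2) by auto
  from k(2) eventually_gt_at_top[of 0] have "\<forall>\<^sub>F n in sequentially. k * real n powr c \<le> u n"
    by eventually_elim (simp add: pos_le_divide_eq)
  with k show ?thesis by blast
qed

lemma has_index_at_top:
  assumes "has_index u r" "r > 0" shows "filterlim u at_top sequentially"
proof -
  obtain k where k: "k > 0" "\<forall>\<^sub>F n in sequentially. k * real n powr (r / 2) \<le> u n"
    using has_index_lower_bound[OF assms(1), of "r / 2"] assms(2) by auto
  have "filterlim (\<lambda>n. k * real n powr (r / 2)) at_top sequentially"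
    using k(1) assms(2) by real_asymp
  then show ?thesis using k(2) by (rule filterlim_at_top_mono)
qed

lemma has_index_upper_bound:
  assumes "has_index u r" "r < c"
  shows "\<exists>k>0. \<forall>\<^sub>F n in sequentially. u n \<le> k * real n powr c"
proof -
  obtain k where k: "k > 0" "\<forall>\<^sub>F n in sequentially. k * real n powr (- c) \<le> inverse (u n)"
    using has_index_lower_bound[OF has_index_inverse[OF assms(1)], of "- c"] assms(2) by auto
  from k(2) has_index_pos[OF assms(1)] eventually_gt_at_top[of 0]
  have "\<forall>\<^sub>F n in sequentially. u n \<le> inverse k * real n powr c"
  proof eventually_elim
    case (elim n)
    then show ?case using k(1) by (simp add: powr_minus field_simps)
  qed
  with k show ?thesis by (intro exI[of _ "inverse k"]) auto
qed

lemma has_index_summable: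
  assumes "has_index u r" "r < - 1" shows "summable u"
proof -
  obtain k where k: "k > 0" "\<forall>\<^sub>F n in sequentially. u n \<le> k * real n powr ((r - 1) / 2)"
    using has_index_upper_bound[OF assms(1), of "(r - 1) / 2"] assms(2) by auto
  have "summable (\<lambda>n. k * real n powr ((r - 1) / 2))"
    using assms(2) by (intro summable_mult) (simp add: summable_real_powr_iff)
  moreover from k(2) has_index_pos[OF assms(1)]
  have "\<forall>\<^sub>F n in sequentially. norm (u n) \<le> k * real n powr ((r - 1) / 2)"
    by eventually_elim simp
  ultimately show ?thesis by (rule summable_comparison_test_ev[rotated])
qed

text \<open>Discrete Karamata theorem, by Stolz-Cesaro against \<open>n * u n\<close>, whose
  increments are \<open>u n * (r + 1 + o(1))\<close>. The sum \<open>U\<close> is given only by its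
  recursion from 1 on, so that \<open>nu\<close> and \<open>G\<close> are covered alike.\<close>

lemma karamata_sum:
  assumes u: "has_index u r" and r: "r > - 1" and U: "\<And>n. n \<ge> 1 \<Longrightarrow> U (Suc n) = U n + u n"
  shows "(\<lambda>n. U n / (real n * u n)) \<longlonglongrightarrow> 1 / (r + 1)"
proof (rule stolz_cesaro)
  have i: "has_index (\<lambda>n. real n * u n) (1 + r)"
    by (rule has_index_mult[OF has_index_id u])
  show "\<forall>\<^sub>F n in sequentially. real n * u n < real (Suc n) * u (Suc n)"
    using has_index_incr[OF i] r by simp
  show "filterlim (\<lambda>n. real n * u n) at_top sequentially"
    using has_index_at_top[OF i] r by simp
  have "(\<lambda>n. 1 / (real n * (u (Suc n) / u n - 1) + u (Suc n) / u n)) \<longlonglongrightarrow> 1 / (r + 1)"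
    using r by (intro tendsto_intros has_index_lim[OF u] has_index_ratio[OF u]) simp
  then show "(\<lambda>n. (U (Suc n) - U n) / (real (Suc n) * u (Suc n) - real n * u n)) \<longlonglongrightarrow> 1 / (r + 1)"
  proof (rule Lim_transform_eventually)
    show "\<forall>\<^sub>F n in sequentially. 1 / (real n * (u (Suc n) / u n - 1) + u (Suc n) / u n)
        = (U (Suc n) - U n) / (real (Suc n) * u (Suc n) - real n * u n)"
      using has_index_pos[OF u] eventually_ge_at_top[of 1]
    proof eventually_elim
      case (elim n)
      then show ?case using U[of n] by (simp add: divide_simps) (simp add: algebra_simps)
    qed
  qed
qed

lemma has_index_sum:
  assumes u: "has_index u r" and r: "r > - 1" and U: "\<And>n. n \<ge> 1 \<Longrightarrow> U (Suc n) = U n + u n"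
  shows "(\<lambda>n. real n * (u n / U n)) \<longlonglongrightarrow> r + 1" "has_index U (r + 1)"
proof -
  have lim: "(\<lambda>n. U n / (real n * u n)) \<longlonglongrightarrow> 1 / (r + 1)"
    by (rule karamata_sum) fact+
  from tendsto_inverse[OF this] have "(\<lambda>n. inverse (U n / (real n * u n))) \<longlonglongrightarrow> inverse (1 / (r + 1))"
    using r by simp
  then show lim': "(\<lambda>n. real n * (u n / U n)) \<longlonglongrightarrow> r + 1"
    by (simp add: inverse_eq_divide)
  have "\<forall>\<^sub>F n in sequentially. 0 < U n / (real n * u n)"
    using r by (intro order_tendstoD(1)[OF lim]) simp
  with has_index_pos[OF u] eventually_gt_at_top[of 0] have pos: "\<forall>\<^sub>F n in sequentially. 0 < U n"
  proof eventually_elim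
    case (elim n)
    then show ?case by (auto simp: zero_less_divide_iff mult_less_0_iff)
  qed
  show "has_index U (r + 1)"
    unfolding has_index_def
  proof (intro conjI pos)
    show "(\<lambda>n. real n * (U (Suc n) / U n - 1)) \<longlonglongrightarrow> r + 1"
      by (rule Lim_transform_eventually[OF lim'])
         (use pos eventually_ge_at_top[of 1] in eventually_elim, simp add: U field_simps)
  qed
qed


section \<open>The memory sequence at the critical point\<close>

lemma rate_tendsto_1:
  fixes c y :: "nat \<Rightarrow> real"
  assumes "filterlim c at_top sequentially" "(\<lambda>n. c n * (y n - 1)) \<longlonglongrightarrow> L"
  shows "y \<longlonglongrightarrow> 1"
proof -
  have "(\<lambda>n. 1 + c n * (y n - 1) * inverse (c n)) \<longlonglongrightarrow> 1 + L * 0"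
    by (intro tendsto_intros assms(2) tendsto_inverse_0_at_top assms(1))
  moreover have "\<forall>\<^sub>F n in sequentially. 0 < c n"
    using assms(1) unfolding filterlim_at_top_dense by blast
  then have "\<forall>\<^sub>F n in sequentially. 1 + c n * (y n - 1) * inverse (c n) = y n"
    by eventually_elim (simp add: field_simps)
  ultimately show ?thesis using Lim_transform_eventually by fastforce
qed

lemma rate_mult:
  fixes c y z :: "nat \<Rightarrow> real"
  assumes "filterlim c at_top sequentially" "(\<lambda>n. c n * (y n - 1)) \<longlonglongrightarrow> L"
    "(\<lambda>n. c n * (z n - 1)) \<longlonglongrightarrow> K"
  shows "(\<lambda>n. c n * (y n * z n - 1)) \<longlonglongrightarrow> L + K"
proof -
  have "(\<lambda>n. c n * (y n - 1) + y n * (c n * (z n - 1))) \<longlonglongrightarrow> L + 1 * K"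
    by (intro tendsto_intros assms rate_tendsto_1[OF assms(1,2)])
  then show ?thesis by (simp add: algebra_simps)
qed

lemma rate_compose:
  fixes c y :: "nat \<Rightarrow> real"
  assumes "(h has_real_derivative D) (at b)" "h b = 1"
    and "filterlim c at_top sequentially" "(\<lambda>n. c n * (y n - b)) \<longlonglongrightarrow> L"
  shows "(\<lambda>n. c n * (h (y n) - 1)) \<longlonglongrightarrow> D * L"
proof -
  have y: "y \<longlonglongrightarrow> b"
  proof -
    have "(\<lambda>n. y n - b + 1) \<longlonglongrightarrow> 1"
      using assms(4) by (intro rate_tendsto_1[OF assms(3)]) simp
    from tendsto_diff[OF this tendsto_const[of "1 - b"]] show ?thesis by simp
  qed
  \<comment> \<open>The difference quotient of \<open>h\<close>, extended by \<open>D\<close>, is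
    continuous at \<open>b\<close>; it makes \<open>h z - 1\<close> the exact product
    \<open>k z * (z - b)\<close>, also when \<open>y n = b\<close>.\<close>
  define k where "k z = (if z = b then D else (h z - h b) / (z - b))" for z
  have "isCont k b"
    using assms(1) unfolding k_def isCont_def has_field_derivative_iff
    by (auto elim!: Lim_transform_eventually simp: eventually_at_filter)
  then have "(\<lambda>n. k (y n)) \<longlonglongrightarrow> k b" by (rule isCont_tendsto_compose) (rule y)
  then have "(\<lambda>n. k (y n) * (c n * (y n - b))) \<longlonglongrightarrow> k b * L"
    by (intro tendsto_intros assms(4))
  moreover have "k z * (z - b) = h z - 1" for z by (simp add: k_def assms(2))
  then have "k (y n) * (c n * (y n - b)) = c n * (h (y n) - 1)" for n
    by (metis mult.commute mult.left_commute)
  ultimately show ?thesis by (simp only:) (simp add: k_def)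
qed

lemma rate_powr:
  fixes c y :: "nat \<Rightarrow> real"
  assumes "filterlim c at_top sequentially" "(\<lambda>n. c n * (y n - 1)) \<longlonglongrightarrow> L"
  shows "(\<lambda>n. c n * (y n powr d - 1)) \<longlonglongrightarrow> d * L"
proof (rule rate_compose[OF _ _ assms])
  show "((\<lambda>x. x powr d) has_real_derivative d) (at 1)"
    by (auto intro!: derivative_eq_intros)
qed simp

lemma n_ln_n_at_top: "filterlim (\<lambda>n. real n * ln (real n)) at_top sequentially"
  by real_asymp

text \<open>The shift \<open>j\<close> is 1 for the memory sequence, which enters as
  \<open>\<mu> (Suc n)\<close>, and 0 for \<open>w\<close>.\<close>

lemma rate_ln_ratio: "(\<lambda>n. real n * ln (real n) * (ln (real (n + j + 1)) / ln (real (n + j)) - 1)) \<longlonglongrightarrow> 1"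
proof -
  have "(\<lambda>n. real n * (ln (real n + real j + 1) - ln (real n + real j))
      * (ln (real n) / ln (real n + real j))) \<longlonglongrightarrow> 1 * 1"
    by (intro tendsto_intros; real_asymp)
  then have "(\<lambda>n. real n * (ln (real n + real j + 1) - ln (real n + real j))
      * (ln (real n) / ln (real n + real j))) \<longlonglongrightarrow> 1" by simp
  then show ?thesis
  proof (rule Lim_transform_eventually)
    show "\<forall>\<^sub>F n in sequentially. real n * (ln (real n + real j + 1) - ln (real n + real j))
      * (ln (real n) / ln (real n + real j)) = real n * ln (real n) * (ln (real (n + j + 1)) / ln (real (n + j)) - 1)"
      using eventually_gt_at_top[of 1] by eventually_elim (simp add: field_simps)
  qed
qed

text \<open>As \<open>\<zeta> \<longlongrightarrow> 0\<close>, relative increments of the factor \<open>exp (\<integral> \<zeta>)\<close> of the memory function are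
  negligible against \<open>1 / (n * ln n)\<close>.\<close>

lemma memory_assumption_rate:
  assumes "memory_assumption \<mu> \<gamma> a"
  shows "(\<lambda>n. real n * ln (real n) * (\<mu> (Suc (Suc n)) / \<mu> (Suc n) - 1 - \<gamma> / real n)) \<longlonglongrightarrow> a"
proof -
  obtain m \<l> f \<zeta> :: "real \<Rightarrow> real" and B :: real where B: "B > 1"
    and mu: "\<And>n. n \<ge> 1 \<Longrightarrow> \<mu> n = m (real n)"
    and m: "\<And>x. x \<ge> 1 \<Longrightarrow> m x = x powr \<gamma> * \<l> x"
    and l: "\<And>x. x > exp B \<Longrightarrow> \<l> x = f (ln x)"
    and f: "\<And>x. x > B \<Longrightarrow> f x = x powr a * exp (\<integral>s\<in>{ln B<..<ln x}. \<zeta> s \<partial>lborel)"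
    and int: "\<And>x. x > ln B \<Longrightarrow> set_integrable lborel {ln B<..<x} \<zeta>"
    and zeta: "(\<zeta> \<longlongrightarrow> 0) at_top"
    using assms unfolding memory_assumption_def by blast
  \<comment> \<open>\<open>f\<close> is evaluated at \<open>ln x\<close>, so its integral runs up to
    \<open>ln (ln x)\<close>, whose increments from \<open>n\<close> to \<open>n + 1\<close> are of
    order \<open>1 / (n * ln n)\<close>.\<close>
  define J where "J x = (\<integral>s\<in>{ln B<..<ln (ln x)}. \<zeta> s \<partial>lborel)" for x
  have mu_eq: "\<mu> n = real n powr \<gamma> * (ln (real n) powr a * exp (J (real n)))"
    if "real n > exp B" for n
  proof -
    have "real n > 1" using that B by (smt (verit) one_le_exp_iff)
    moreover have "ln (real n) > B" using that by (smt (verit) exp_gt_zero ln_exp ln_less_cancel_iff)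
    ultimately show ?thesis using mu[of n] m[of "real n"] l[of "real n"] f[of "ln (real n)"] that
      by (simp add: J_def)
  qed
  let ?L = "\<lambda>n. ln (ln (real n))"
  have J_rate: "(\<lambda>n. real n * ln (real n) * (J (real (n + 2)) - J (real (n + 1)))) \<longlonglongrightarrow> 0"
  proof (rule LIMSEQ_I)
    fix e :: real assume e: "e > 0"
    \<comment> \<open>The bound \<open>e / 2\<close> is matched with the bound 2 below on the
      rescaled increment of \<open>ln (ln n)\<close>, which tends to 1.\<close>
    have "\<forall>\<^sub>F x in at_top. \<bar>\<zeta> x\<bar> < e / 2"
      using tendstoD[OF zeta, of "e / 2"] e by (simp add: dist_real_def)
    then obtain z where z: "\<And>x. x \<ge> z \<Longrightarrow> \<bar>\<zeta> x\<bar> < e / 2" by (auto simp: eventually_at_top_linorder)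
    have "\<forall>\<^sub>F n in sequentially. ln (ln (real n + 1)) > max z (ln B)" by real_asymp
    moreover have "(\<lambda>n. real n * ln (real n) * (ln (ln (real n + 2)) - ln (ln (real n + 1)))) \<longlonglongrightarrow> 1"
      by real_asymp
    then have "\<forall>\<^sub>F n in sequentially.
        real n * ln (real n) * (ln (ln (real n + 2)) - ln (ln (real n + 1))) < 2"
      by (rule order_tendstoD) simp
    ultimately have "\<forall>\<^sub>F n in sequentially.
        norm (real n * ln (real n) * (J (real (n + 2)) - J (real (n + 1))) - 0) < e"
      using eventually_gt_at_top[of 2]
    proof eventually_elim
      case (elim n)
      define u v where "u = ln (ln (real n + 1))" and "v = ln (ln (real n + 2))"
      have "u < v" unfolding u_def v_def using elim(3) by simp
      have u: "u > z" "u > ln B" using elim(1) by (auto simp: u_def)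
      have iv: "set_integrable lborel {ln B<..<v} \<zeta>" using int u \<open>u < v\<close> by simp
      have "{ln B<..<v} = {ln B<..<u} \<union> {u..<v}" using u \<open>u < v\<close> by auto
      then have "(\<integral>s\<in>{ln B<..<v}. \<zeta> s \<partial>lborel)
          = (\<integral>s\<in>{ln B<..<u}. \<zeta> s \<partial>lborel) + (\<integral>s\<in>{u..<v}. \<zeta> s \<partial>lborel)"
        using iv by (auto intro!: set_integral_Un set_integrable_subset[OF iv])
      then have "J (real (n + 2)) - J (real (n + 1)) = (\<integral>s\<in>{u..<v}. \<zeta> s \<partial>lborel)"
        by (simp add: J_def u_def v_def add.commute)
      also have "\<bar>\<dots>\<bar> \<le> e / 2 * (v - u)"
      proof -
        have iuv: "set_integrable lborel {u..<v} \<zeta>"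
          by (rule set_integrable_subset[OF iv]) (use u in auto)
        have "norm (\<integral>s\<in>{u..<v}. \<zeta> s \<partial>lborel) \<le> (\<integral>s\<in>{u..<v}. norm (\<zeta> s) \<partial>lborel)"
          by (rule set_integral_norm_bound[OF iuv])
        also have "\<dots> \<le> (\<integral>s\<in>{u..<v}. e / 2 \<partial>lborel)"
          using z u \<open>u < v\<close> by (intro set_integral_mono set_integrable_norm iuv)
            (auto simp: set_integrable_def less_imp_le intro!: integrable_divide integrable_mult_left)
        also have "\<dots> = e / 2 * (v - u)"
          using \<open>u < v\<close> by (simp add: set_lebesgue_integral_def)
        finally show ?thesis by simp
      qed
      finally have "\<bar>J (real (n + 2)) - J (real (n + 1))\<bar> \<le> e / 2 * (v - u)" .
      then have "real n * ln (real n) * \<bar>J (real (n + 2)) - J (real (n + 1))\<bar>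
          \<le> real n * ln (real n) * (e / 2 * (v - u))"
        using elim(3) by (intro mult_left_mono) auto
      also have "\<dots> = e / 2 * (real n * ln (real n) * (v - u))" by simp
      also have "\<dots> < e / 2 * 2" using elim(2) e unfolding u_def v_def
        by (intro mult_strict_left_mono) auto
      finally show ?case using elim(3) by (simp add: abs_mult)
    qed
    then show "\<exists>no. \<forall>n\<ge>no. norm (real n * ln (real n) * (J (real (n + 2)) - J (real (n + 1))) - 0) < e"
      by (simp add: eventually_sequentially)
  qed
  let ?c = "\<lambda>n. real n * ln (real n)"
  have e: "(\<lambda>n. ?c n * (exp (J (real (n + 2)) - J (real (n + 1))) - 1)) \<longlonglongrightarrow> 1 * 0"
  proof (rule rate_compose[where h = exp and b = 0, OF _ _ n_ln_n_at_top])
    show "(exp has_real_derivative 1) (at 0)" using DERIV_exp[of 0] by simp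
  qed (use J_rate in simp_all)
  have "(\<lambda>n. ?c n * ((ln (real (n + 1 + 1)) / ln (real (n + 1))) powr a
      * exp (J (real (n + 2)) - J (real (n + 1))) - 1)) \<longlonglongrightarrow> a * 1 + 1 * 0"
    by (rule rate_mult[OF n_ln_n_at_top rate_powr[OF n_ln_n_at_top rate_ln_ratio] e])
  moreover define R where "R n = (ln (real (n + 1 + 1)) / ln (real (n + 1))) powr a
      * exp (J (real (n + 2)) - J (real (n + 1)))" for n
  ultimately have R: "(\<lambda>n. ?c n * (R n - 1)) \<longlonglongrightarrow> a" by simp
  \<comment> \<open>The power of \<open>(n + 2) / (n + 1)\<close> differs from
    \<open>1 + \<gamma> / n\<close> by a term of order \<open>1 / n\<^sup>2\<close>, which is
    negligible at the rate \<open>n * ln n\<close>.\<close>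
  have "(\<lambda>n. ((real n + 2) / (real n + 1)) powr \<gamma> * (?c n * (R n - 1))
      + ?c n * (((real n + 2) / (real n + 1)) powr \<gamma> - 1 - \<gamma> / real n)) \<longlonglongrightarrow> 1 * a + 0"
    by (intro tendsto_add tendsto_mult R; real_asymp)
  then have "(\<lambda>n. ?c n * (((real n + 2) / (real n + 1)) powr \<gamma> * R n - 1 - \<gamma> / real n)) \<longlonglongrightarrow> a"
    by (simp add: algebra_simps)
  moreover have "\<forall>\<^sub>F n in sequentially. real n > exp B" by real_asymp
  then have "\<forall>\<^sub>F n in sequentially. ?c n * (((real n + 2) / (real n + 1)) powr \<gamma> * R n - 1 - \<gamma> / real n)
      = ?c n * (\<mu> (Suc (Suc n)) / \<mu> (Suc n) - 1 - \<gamma> / real n)"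
  proof eventually_elim
    case (elim n)
    have n: "real n > 1" using elim B by (smt (verit) one_le_exp_iff)
    have "\<mu> (Suc (Suc n)) / \<mu> (Suc n) = ((real n + 2) / (real n + 1)) powr \<gamma> * R n"
      using mu_eq[of "Suc n"] mu_eq[of "Suc (Suc n)"] elim n
      by (simp add: R_def powr_divide exp_diff add.commute)
    then show ?case by simp
  qed
  ultimately show ?thesis by (rule Lim_transform_eventually)
qed


text \<open>Increments of \<open>ln v\<close> are \<open>o(1 / n)\<close>, and a multiple of
  \<open>n\<close> of them lie between the indices \<open>n\<close> and \<open>n * t\<close>. Each
  is bounded by the value at the smaller index, so together they are \<open>o(1)\<close>.\<close>

lemma has_index_0_floor:
  assumes v: "has_index v 0" and t: "t > 0"
  shows "(\<lambda>n. v (nat \<lfloor>real n * t\<rfloor>) / v n) \<longlonglongrightarrow> 1"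
proof -
  let ?m = "\<lambda>n. nat \<lfloor>real n * t\<rfloor>"
  have top: "filterlim ?m at_top sequentially" using t by real_asymp
  \<comment> \<open>\<open>C\<close> exceeds the limit of \<open>\<bar>n - m\<bar> / min n m\<close>
    with \<open>m\<close> the integer part of \<open>n * t\<close>, so that increments below
    \<open>e / C\<close> add up to less than \<open>e\<close>.\<close>
  define C where "C = \<bar>1 - t\<bar> / min 1 t + 1"
  have "(\<lambda>n. \<bar>1 - real (?m n) / real n\<bar> / min 1 (real (?m n) / real n)) \<longlonglongrightarrow> \<bar>1 - t\<bar> / min 1 t"
  proof -
    have "(\<lambda>n. real (?m n) / real n) \<longlonglongrightarrow> t" using t by real_asymp
    then show ?thesis using t by (intro tendsto_intros) auto
  qed
  then have C: "\<forall>\<^sub>F n in sequentially. \<bar>1 - real (?m n) / real n\<bar> / min 1 (real (?m n) / real n) < C"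
    by (rule order_tendstoD) (simp add: C_def)
  have "C > 0" using t by (simp add: C_def add_nonneg_pos)
  have lnr: "(\<lambda>n. real n * (1 + ln (v (Suc n) / v n) - 1)) \<longlonglongrightarrow> 1 * 0"
  proof (rule rate_compose[where h = "\<lambda>z. 1 + ln z" and b = 1, OF _ _ filterlim_real_sequentially])
    show "((\<lambda>z. 1 + ln z) has_real_derivative 1) (at 1)"
      by (auto intro!: derivative_eq_intros)
  qed (use has_index_lim[OF v] in simp_all)
  have "(\<lambda>n. ln (v (?m n)) - ln (v n)) \<longlonglongrightarrow> 0"
  proof (rule LIMSEQ_I)
    fix e :: real assume e: "e > 0"
    have "\<forall>\<^sub>F n in sequentially. \<bar>real n * ln (v (Suc n) / v n)\<bar> < e / C"
      using tendstoD[OF lnr, of "e / C"] e \<open>C > 0\<close> by (simp add: dist_real_def)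
    with has_index_pos[OF v] eventually_gt_at_top[of 0]
      have "\<forall>\<^sub>F n in sequentially. n > 0 \<and> v n > 0 \<and> \<bar>real n * ln (v (Suc n) / v n)\<bar> < e / C"
        by eventually_elim simp
    then obtain K where K: "\<And>n. n \<ge> K \<Longrightarrow> n > 0 \<and> v n > 0 \<and> \<bar>real n * ln (v (Suc n) / v n)\<bar> < e / C"
      by (auto simp: eventually_sequentially)
    have step: "\<bar>ln (v n) - ln (v m)\<bar> \<le> e / C * (real n - real m) / real m" if "K \<le> m" "m \<le> n" for m n
      using that(2)
    proof (induction n rule: dec_induct)
      case (step n)
      have n: "n > 0" "v n > 0" "v (Suc n) > 0" "\<bar>real n * ln (v (Suc n) / v n)\<bar> < e / C"
        using K[of n] K[of "Suc n"] step that by auto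
      have "\<bar>ln (v (Suc n)) - ln (v n)\<bar> \<le> e / C / real n"
      proof -
        have "\<bar>ln (v (Suc n)) - ln (v n)\<bar> = \<bar>real n * ln (v (Suc n) / v n)\<bar> / real n"
          using n by (simp add: ln_div abs_mult)
        also have "\<dots> \<le> e / C / real n" using n by (intro divide_right_mono) auto
        finally show ?thesis .
      qed
      also have "\<dots> \<le> e / C / real m"
        using K[OF that(1)] step e \<open>C > 0\<close> by (intro divide_left_mono) auto
      finally have "\<bar>ln (v (Suc n)) - ln (v m)\<bar> \<le> e / C / real m + e / C * (real n - real m) / real m"
        using step.IH by linarith
      also have "\<dots> = e / C * (real (Suc n) - real m) / real m"
        by (simp add: add_divide_distrib [symmetric] algebra_simps diff_divide_distrib)
      finally show ?case .
    qed simp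
    have "\<forall>\<^sub>F n in sequentially. ?m n \<ge> K" using top by (simp add: filterlim_at_top)
    with C eventually_ge_at_top[of K] have "\<forall>\<^sub>F n in sequentially. norm (ln (v (?m n)) - ln (v n) - 0) < e"
    proof eventually_elim
      case (elim n)
      let ?k = "?m n"
      have pos: "n > 0" "?k > 0" using K[of n] K[of ?k] elim by auto
      have "\<bar>ln (v ?k) - ln (v n)\<bar> \<le> e / C * (\<bar>real n - real ?k\<bar> / min (real n) (real ?k))"
      proof (cases "?k \<le> n")
        case True
        then show ?thesis using step[of ?k n] elim by (simp add: min_def abs_minus_commute)
      next
        case False
        then show ?thesis using step[of n ?k] elim by (simp add: min_def)
      qed
      also have "\<bar>real n - real ?k\<bar> / min (real n) (real ?k) = \<bar>1 - real ?k / real n\<bar> / min 1 (real ?k / real n)"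
      proof -
        have "\<bar>1 - real ?k / real n\<bar> = \<bar>real n - real ?k\<bar> / real n"
          using pos by (simp add: field_simps flip: abs_divide) (simp add: abs_divide)
        moreover have "min 1 (real ?k / real n) = min (real n) (real ?k) / real n"
          using pos by (auto simp: min_def field_simps)
        ultimately show ?thesis using pos by simp
      qed
      also have "e / C * \<dots> < e / C * C"
        using elim(1) e \<open>C > 0\<close> by (intro mult_strict_left_mono) auto
      finally show ?case using \<open>C > 0\<close> by simp
    qed
    then show "\<exists>no. \<forall>n\<ge>no. norm (ln (v (?m n)) - ln (v n) - 0) < e"
      by (simp add: eventually_sequentially)
  qed
  then have "(\<lambda>n. exp (ln (v (?m n)) - ln (v n))) \<longlonglongrightarrow> exp 0" by (intro tendsto_intros)
  moreover have "\<forall>\<^sub>F n in sequentially. 0 < v (?m n)"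
    using top has_index_pos[OF v] by (rule eventually_compose_filterlim[rotated])
  with has_index_pos[OF v] have "\<forall>\<^sub>F n in sequentially. exp (ln (v (?m n)) - ln (v n)) = v (?m n) / v n"
    by eventually_elim (simp add: exp_diff)
  ultimately show ?thesis using Lim_transform_eventually by fastforce
qed

text \<open>Division by \<open>n powr r\<close> reduces this to the slowly varying case; the power
  scales explicitly.\<close>

lemma has_index_floor:
  assumes u: "has_index u r" and t: "t > 0"
  shows "(\<lambda>n. u (nat \<lfloor>real n * t\<rfloor>) / u n) \<longlonglongrightarrow> t powr r"
proof -
  let ?m = "\<lambda>n. nat \<lfloor>real n * t\<rfloor>"
  have top: "filterlim ?m at_top sequentially" using t by real_asymp
  have v: "has_index (\<lambda>n. u n / real n powr r) 0"
    using has_index_divide[OF u has_index_powr[of r]] by simp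
  have "(\<lambda>n. real (?m n) / real n) \<longlonglongrightarrow> t" using t by real_asymp
  then have "(\<lambda>n. (real (?m n) / real n) powr r) \<longlonglongrightarrow> t powr r"
    using t by (intro tendsto_intros) auto
  from tendsto_mult[OF has_index_0_floor[OF v t] this]
  have "(\<lambda>n. (u (?m n) / real (?m n) powr r) / (u n / real n powr r) * (real (?m n) / real n) powr r)
      \<longlonglongrightarrow> t powr r" by simp
  moreover have "\<forall>\<^sub>F n in sequentially. 0 < ?m n"
    using top[unfolded filterlim_at_top, rule_format, of 1] by (rule eventually_mono) linarith
  with eventually_gt_at_top[of 0] have "\<forall>\<^sub>F n in sequentially.
      (u (?m n) / real (?m n) powr r) / (u n / real n powr r) * (real (?m n) / real n) powr r = u (?m n) / u n"
  proof eventually_elim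
    case (elim n)
    have "(u k / real k powr r) / (u n / real n powr r) * (real k / real n) powr r = u k / u n"
      if "k > 0" for k
      using that elim by (simp add: powr_divide)
    then show ?case using elim by blast
  qed
  ultimately show ?thesis by (rule Lim_transform_eventually)
qed

text \<open>A discrete Gronwall argument: \<open>y n / A n\<close> grows by at most
  \<open>e n / A (Suc n)\<close> per step. Powers of \<open>amp\<close> will serve as
  \<open>A\<close>.\<close>

lemma relative_growth_bounded:
  fixes y A c e :: "nat \<Rightarrow> real"
  assumes rec: "\<And>n. y (Suc n) \<le> c n * y n + e n"
    and A: "\<And>n. A n > 0" "\<And>n. c n * A n \<le> A (Suc n)"
    and nonneg: "\<And>n. 0 \<le> y n" "\<And>n. 0 \<le> e n"
    and summ: "summable (\<lambda>n. e n / A (Suc n))"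
  shows "\<exists>C\<ge>0. \<forall>n. y n \<le> C * A n"
proof -
  have *: "y n / A n \<le> y 0 / A 0 + (\<Sum>k<n. e k / A (Suc k))" for n
  proof (induction n)
    case (Suc n)
    have "y (Suc n) \<le> c n * A n * (y n / A n) + e n" using rec[of n] A(1)[of n] by simp
    also have "\<dots> \<le> A (Suc n) * (y n / A n) + e n"
      using A nonneg(1)[of n] less_imp_le[OF A(1)] by (intro add_right_mono mult_right_mono) auto
    finally have "y (Suc n) / A (Suc n) \<le> y n / A n + e n / A (Suc n)"
      using A(1)[of "Suc n"] by (simp add: field_simps)
    then show ?case using Suc by simp
  qed simp
  define C where "C = y 0 / A 0 + (\<Sum>k. e k / A (Suc k))"
  have "y n \<le> C * A n" for n
  proof -
    have "(\<Sum>k<n. e k / A (Suc k)) \<le> (\<Sum>k. e k / A (Suc k))"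
      using nonneg(2) less_imp_le[OF A(1)] by (intro sum_le_suminf summ) auto
    with *[of n] have "y n / A n \<le> C" by (simp add: C_def)
    then show ?thesis using A(1)[of n] by (simp add: field_simps)
  qed
  moreover have "C \<ge> 0" using nonneg less_imp_le[OF A(1)] unfolding C_def
    by (intro add_nonneg_nonneg suminf_nonneg summ divide_nonneg_nonneg) auto
  ultimately show ?thesis by blast
qed

text \<open>Of the memory function only the expansion \<open>rate\<close> of the quotients of
  successive memories is kept: \<open>\<gamma>\<close> appears at order \<open>1 / n\<close> and
  \<open>a\<close> at order \<open>1 / (n * ln n)\<close>.\<close>

locale critical_memory =
  fixes \<mu> :: "nat \<Rightarrow> real" and p \<gamma> a :: real
  assumes pos: "\<And>n. 1 \<le> n \<Longrightarrow> 0 < \<mu> n"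
    and gamma: "- 1 < \<gamma>" and p_nonneg: "0 \<le> p"
    and critical: "p = critical_prob \<gamma>"
    and rate: "(\<lambda>n. real n * ln (real n) * (\<mu> (Suc (Suc n)) / \<mu> (Suc n) - 1 - \<gamma> / real n)) \<longlonglongrightarrow> a"
    and index_pos: "a + \<gamma> + 1 > 0"
begin

definition nu :: "nat \<Rightarrow> real" where "nu n = (\<Sum>k=1..n. \<mu> k)"

text \<open>Given the past, \<open>\<mu> (Suc n) * X (Suc n)\<close> has mean
  \<open>p * x n * Y n\<close>. Since \<open>nu 0 = 0\<close>, division by zero gives
  \<open>x 0 = 0\<close>, which is the right start for the recursions of \<open>amp\<close> and
  \<open>q\<close>.\<close>

definition x :: "nat \<Rightarrow> real" where "x n = \<mu> (Suc n) / nu n"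

text \<open>The factor by which the conditional mean of the memory-weighted sum is amplified.\<close>

primrec amp :: "nat \<Rightarrow> real" where
  "amp 0 = 1" |
  "amp (Suc n) = amp n * (1 + p * x n)"

text \<open>With \<open>Y n = (\<Sum>k\<le>n. \<mu> k * X k)\<close>, the numbers \<open>q n\<close> and \<open>s n\<close> below are the second
  moments of \<open>Y n\<close> and of the martingale \<open>Y n / amp n\<close>.\<close>

primrec q :: "nat \<Rightarrow> real" where
  "q 0 = 0" |
  "q (Suc n) = (1 + 2 * p * x n) * q n + (\<mu> (Suc n))\<^sup>2"

definition s :: "nat \<Rightarrow> real" where "s n = q n / (amp n)\<^sup>2"
text \<open>With \<open>Y k = amp k * MM k\<close>, the conditional mean
  \<open>p * Y k / nu k\<close> of a step of the walk is \<open>p * g k * MM k\<close>.\<close>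

definition g :: "nat \<Rightarrow> real" where "g n = amp n / nu n"
definition G :: "nat \<Rightarrow> real" where "G n = (\<Sum>k=1..<n. g k)"

abbreviation \<kappa> :: real where "\<kappa> \<equiv> \<gamma> + 1"

lemma kappa_pos: "\<kappa> > 0" using gamma by simp

lemma p_kappa: "p * \<kappa> = \<gamma> + 1 / 2" "2 * (1 - p) * \<kappa> = 1"
  using critical kappa_pos by (simp_all add: critical_prob_def field_simps)

lemma nu_0 [simp]: "nu 0 = 0" and nu_Suc: "nu (Suc n) = nu n + \<mu> (Suc n)"
  by (simp_all add: nu_def)

lemma nu_pos: "n \<ge> 1 \<Longrightarrow> nu n > 0"
  unfolding nu_def by (intro sum_pos) (auto intro: pos)

lemma nu_nonneg: "nu n \<ge> 0"
  using nu_pos[of n] by (cases n) auto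

lemma x_nonneg: "x n \<ge> 0"
  unfolding x_def by (intro divide_nonneg_nonneg less_imp_le[OF pos] nu_nonneg) simp

lemma amp_pos: "amp n > 0"
  by (induction n) (use x_nonneg p_nonneg in \<open>auto intro!: mult_pos_pos add_pos_nonneg\<close>)

lemma g_pos: "n \<ge> 1 \<Longrightarrow> g n > 0" and g_nonneg: "g n \<ge> 0"
  unfolding g_def using amp_pos nu_pos nu_nonneg less_imp_le[OF amp_pos] by simp_all

lemma q_nonneg: "q n \<ge> 0"
  by (induction n) (use x_nonneg p_nonneg in auto)

lemma p_less_1: "p < 1"
  using p_kappa(2) kappa_pos by (smt (verit) mult_nonpos_nonneg)

lemma x_nu: "x n * nu n = \<mu> (Suc n)" if "n \<ge> 1"
  using nu_pos[OF that] by (simp add: x_def)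

text \<open>The square of \<open>nu\<close> satisfies the recursion of \<open>q\<close> with
  \<open>2 * x n\<close> in place of \<open>2 * p * x n\<close>. The bound makes the increments of
  \<open>s\<close> nonnegative in \<open>s_step\<close>.\<close>

lemma q_le: "q n \<le> (nu n)\<^sup>2"
proof (induction n)
  case (Suc n)
  show ?case
  proof (cases "n = 0")
    case False
    have "(1 + 2 * p * x n) * q n \<le> (1 + 2 * x n) * (nu n)\<^sup>2"
      using Suc x_nonneg[of n] p_nonneg p_less_1 q_nonneg[of n]
      by (intro mult_mono add_left_mono) (auto intro!: mult_right_mono mult_left_le)
    also have "\<dots> = (nu n)\<^sup>2 + 2 * (x n * nu n) * nu n" by (simp add: algebra_simps power2_eq_square)
    finally show ?thesis using x_nu[of n] False by (simp add: nu_Suc power2_sum mult_ac)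
  qed (simp add: nu_def)
qed simp

lemma memory_index: "has_index (\<lambda>n. \<mu> (Suc n)) \<gamma>"
proof -
  have "(\<lambda>n. real n * ln (real n) * (\<mu> (Suc (Suc n)) / \<mu> (Suc n) - 1 - \<gamma> / real n) * (1 / ln (real n)) + \<gamma>)
      \<longlonglongrightarrow> a * 0 + \<gamma>"
    by (intro tendsto_intros rate; real_asymp)
  then have "(\<lambda>n. real n * ln (real n) * (\<mu> (Suc (Suc n)) / \<mu> (Suc n) - 1 - \<gamma> / real n) * (1 / ln (real n)) + \<gamma>)
      \<longlonglongrightarrow> \<gamma>" by simp
  then have "(\<lambda>n. real n * (\<mu> (Suc (Suc n)) / \<mu> (Suc n) - 1)) \<longlonglongrightarrow> \<gamma>"
  proof (rule Lim_transform_eventually)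
    show "\<forall>\<^sub>F n in sequentially. real n * ln (real n) * (\<mu> (Suc (Suc n)) / \<mu> (Suc n) - 1 - \<gamma> / real n)
        * (1 / ln (real n)) + \<gamma> = real n * (\<mu> (Suc (Suc n)) / \<mu> (Suc n) - 1)"
      using eventually_gt_at_top[of 1] by eventually_elim (simp add: field_simps)
  qed
  then show "has_index (\<lambda>n. \<mu> (Suc n)) \<gamma>"
    by (auto simp: has_index_def intro!: pos always_eventually)
qed

lemma n_x_lim: "(\<lambda>n. real n * x n) \<longlonglongrightarrow> \<kappa>" and nu_index: "has_index nu \<kappa>"
  using has_index_sum[OF memory_index gamma, of nu] by (simp_all add: nu_Suc x_def)

lemma x_lim: "x \<longlonglongrightarrow> 0"
proof -
  have "(\<lambda>n. real n * x n * (1 / real n)) \<longlonglongrightarrow> \<kappa> * 0"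
    by (intro tendsto_intros n_x_lim)
  moreover have "\<forall>\<^sub>F n in sequentially. real n * x n * (1 / real n) = x n"
    using eventually_gt_at_top[of 0] by eventually_elim simp
  ultimately show ?thesis using Lim_transform_eventually by fastforce
qed

text \<open>Karamata's theorem to second order. Because \<open>\<kappa> = \<gamma> + 1\<close>, the
  increments of \<open>?A\<close> retain only the correction in \<open>rate\<close>, about
  \<open>a * \<mu> (Suc n) / ln n\<close>, and those of \<open>?B\<close> are about
  \<open>\<mu> (Suc n) / ln n\<close>.\<close>

lemma x_second_order: "(\<lambda>n. ln (real n) * (real n * x n - \<kappa>)) \<longlonglongrightarrow> a"
proof -
  let ?A = "\<lambda>n. real n * \<mu> (Suc n) - \<kappa> * nu n" and ?B = "\<lambda>n. nu n / ln (real n)"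
  have iB: "has_index ?B \<kappa>"
    using has_index_divide[OF nu_index has_index_ln] by simp
  define \<rho> where "\<rho> n = real n * ln (real n) * (\<mu> (Suc (Suc n)) / \<mu> (Suc n) - 1 - \<gamma> / real n)" for n
  have \<rho>: "\<rho> \<longlonglongrightarrow> a" using rate unfolding \<rho>_def .
  \<comment> \<open>Numerator and denominator are the increments of \<open>?A\<close> and
    \<open>?B\<close>, both divided by \<open>\<mu> (Suc n) / ln n\<close>.\<close>
  have "(\<lambda>n. (\<gamma> * (ln (real n) / real n) + \<rho> n * ((real n + 1) / real n)) /
      (ln (real n) / ln (real n + 1) - inverse (real n * x n) * (real n * ln (real n) * (1 / ln (real n) - 1 / ln (real n + 1)))))
      \<longlonglongrightarrow> (\<gamma> * 0 + a * 1) / (1 - inverse \<kappa> * 0)"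
  proof (intro tendsto_intros \<rho> n_x_lim)
    have "(\<lambda>n. real n * (ln (real n + 1) - ln (real n)) / ln (real n + 1)) \<longlonglongrightarrow> 0"
      by real_asymp
    then show "(\<lambda>n. real n * ln (real n) * (1 / ln (real n) - 1 / ln (real n + 1))) \<longlonglongrightarrow> 0"
    proof (rule Lim_transform_eventually)
      show "\<forall>\<^sub>F n in sequentially. real n * (ln (real n + 1) - ln (real n)) / ln (real n + 1)
          = real n * ln (real n) * (1 / ln (real n) - 1 / ln (real n + 1))"
        using eventually_gt_at_top[of 1] by eventually_elim (simp add: field_simps)
    qed
  qed ((real_asymp | use kappa_pos in simp)+)
  then have *: "(\<lambda>n. (\<gamma> * (ln (real n) / real n) + \<rho> n * ((real n + 1) / real n)) /
      (ln (real n) / ln (real n + 1) - inverse (real n * x n) * (real n * ln (real n) * (1 / ln (real n) - 1 / ln (real n + 1)))))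
      \<longlonglongrightarrow> a" by simp
  have "(\<lambda>n. ?A n / ?B n) \<longlonglongrightarrow> a"
  proof (rule stolz_cesaro)
    show "\<forall>\<^sub>F n in sequentially. ?B n < ?B (Suc n)" by (rule has_index_incr[OF iB kappa_pos])
    show "filterlim ?B at_top sequentially" by (rule has_index_at_top[OF iB kappa_pos])
    show "(\<lambda>n. (?A (Suc n) - ?A n) / (?B (Suc n) - ?B n)) \<longlonglongrightarrow> a"
    proof (rule Lim_transform_eventually[OF *])
      show "\<forall>\<^sub>F n in sequentially. (\<gamma> * (ln (real n) / real n) + \<rho> n * ((real n + 1) / real n)) /
      (ln (real n) / ln (real n + 1) - inverse (real n * x n) * (real n * ln (real n) * (1 / ln (real n) - 1 / ln (real n + 1))))
        = (?A (Suc n) - ?A n) / (?B (Suc n) - ?B n)"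
        using eventually_gt_at_top[of 1]
      proof eventually_elim
        case (elim n)
        have m: "\<mu> (Suc n) > 0" and nu: "nu n > 0" and L: "ln (real n) > 0" "ln (real n + 1) > 0"
          using elim pos nu_pos by auto
        have "?A (Suc n) - ?A n = \<mu> (Suc n) / ln (real n) * (\<gamma> * (ln (real n) / real n) + \<rho> n * ((real n + 1) / real n))"
          using elim m L unfolding \<rho>_def nu_Suc by (simp add: divide_simps) (simp add: algebra_simps)
        moreover have "?B (Suc n) - ?B n = \<mu> (Suc n) / ln (real n) * (ln (real n) / ln (real n + 1)
            - inverse (real n * x n) * (real n * ln (real n) * (1 / ln (real n) - 1 / ln (real n + 1))))"
          using elim m L nu unfolding x_def nu_Suc by (simp add: divide_simps add.commute) (simp add: algebra_simps)
        ultimately show ?case using m L by simp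
      qed
    qed
  qed
  then show ?thesis
  proof (rule Lim_transform_eventually)
    show "\<forall>\<^sub>F n in sequentially. ?A n / ?B n = ln (real n) * (real n * x n - \<kappa>)"
      using eventually_gt_at_top[of 0]
    proof eventually_elim
      case (elim n)
      then have "nu n > 0" by (intro nu_pos) simp
      then show ?case by (simp add: x_def field_simps)
    qed
  qed
qed

lemma amp_index: "has_index amp (\<gamma> + 1 / 2)"
  unfolding has_index_def
proof
  show "\<forall>\<^sub>F n in sequentially. 0 < amp n" by (simp add: amp_pos)
  have "(\<lambda>n. p * (real n * x n)) \<longlonglongrightarrow> p * \<kappa>" by (intro tendsto_intros n_x_lim)
  moreover have "real n * (amp (Suc n) / amp n - 1) = p * (real n * x n)" for n
    using amp_pos[of n] by simp
  ultimately show "(\<lambda>n. real n * (amp (Suc n) / amp n - 1)) \<longlonglongrightarrow> \<gamma> + 1 / 2"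
    by (simp only: p_kappa)
qed

text \<open>Here criticality enters: with \<open>x\<close> of index \<open>- 1\<close>, the
  increments of \<open>s\<close>, comparable to \<open>(x n / g n)\<^sup>2\<close>, have the
  borderline index \<open>- 1\<close>.\<close>

lemma g_index: "has_index g (- 1 / 2)"
  using has_index_divide[OF amp_index nu_index] by (simp add: g_def[abs_def])

lemma G_Suc: "n \<ge> 1 \<Longrightarrow> G (Suc n) = G n + g n"
  by (simp add: G_def)

lemma G_index: "has_index G (1 / 2)"
  and G_lim: "(\<lambda>n. G n / (real n * g n)) \<longlonglongrightarrow> 2"
  using has_index_sum(2)[OF g_index _ G_Suc] karamata_sum[OF g_index _ G_Suc] by auto

lemma x_index: "has_index x (- 1)"
proof -
  have "has_index x (\<gamma> - \<kappa>)"
    unfolding x_def[abs_def] by (rule has_index_divide[OF memory_index nu_index])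
  then show ?thesis by simp
qed

section \<open>Logarithmic growth of the variance \<open>s\<close>\<close>

definition l :: "nat \<Rightarrow> real" where "l n = 1 / (real n * (g n)\<^sup>2)"
text \<open>\<open>l\<close> is slowly varying and \<open>w\<close> carries the growth of \<open>s\<close>, see \<open>s_w_lim\<close> below; the index \<open>a\<close>
  of the memory function only enters through \<open>w_rate\<close>.\<close>

definition w :: "nat \<Rightarrow> real" where "w n = l n * ln (real n)"

lemma l_pos: "n \<ge> 1 \<Longrightarrow> l n > 0"
  using g_pos[of n] by (simp add: l_def)

text \<open>From \<open>g (Suc n) = g n * (1 + p * x n) / (1 + x n)\<close> the relative increment
  of \<open>l\<close> is \<open>2 * (1 - p) * x n - 1 / n\<close> up to order
  \<open>1 / n\<^sup>2\<close>. By \<open>2 * (1 - p) * \<kappa> = 1\<close> the leading parts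
  cancel, and \<open>x_second_order\<close> leaves \<open>a / (\<kappa> * n * ln n)\<close>; the
  factor \<open>ln n\<close> of \<open>w\<close> adds 1 to the rate.\<close>

lemma w_rate: "(\<lambda>n. real n * ln (real n) * (w (Suc n) / w n - 1)) \<longlonglongrightarrow> 1 + a / \<kappa>"
proof -
  let ?r = "\<lambda>n. real n * (1 + x n)\<^sup>2 / ((real n + 1) * (1 + p * x n)\<^sup>2)"
  \<comment> \<open>This is \<open>n * ln n * (?r n - 1)\<close>, written out in terms of quantities
    with known limits; only the first summand survives.\<close>
  have "(\<lambda>n. (ln (real n) * (real n * x n - \<kappa>) / \<kappa> + (1 - p\<^sup>2) * ((real n * x n)\<^sup>2 * (ln (real n) / real n))
       - 2 * p * (real n * x n * (ln (real n) / real n)) - p\<^sup>2 * (x n * (real n * x n) * (ln (real n) / real n)))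
       * (real n / (real n + 1)) / (1 + p * x n)\<^sup>2)
      \<longlonglongrightarrow> (a / \<kappa> + (1 - p\<^sup>2) * (\<kappa>\<^sup>2 * 0) - 2 * p * (\<kappa> * 0) - p\<^sup>2 * (0 * \<kappa> * 0)) * 1 / (1 + p * 0)\<^sup>2"
    using kappa_pos by (intro tendsto_intros x_second_order n_x_lim x_lim; (real_asymp | simp))
  then have *: "(\<lambda>n. (ln (real n) * (real n * x n - \<kappa>) / \<kappa> + (1 - p\<^sup>2) * ((real n * x n)\<^sup>2 * (ln (real n) / real n))
       - 2 * p * (real n * x n * (ln (real n) / real n)) - p\<^sup>2 * (x n * (real n * x n) * (ln (real n) / real n)))
       * (real n / (real n + 1)) / (1 + p * x n)\<^sup>2) \<longlonglongrightarrow> a / \<kappa>" by simp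
  have "(\<lambda>n. real n * ln (real n) * (?r n - 1)) \<longlonglongrightarrow> a / \<kappa>"
  proof (rule Lim_transform_eventually[OF *])
    show "\<forall>\<^sub>F n in sequentially. (ln (real n) * (real n * x n - \<kappa>) / \<kappa> + (1 - p\<^sup>2) * ((real n * x n)\<^sup>2 * (ln (real n) / real n))
       - 2 * p * (real n * x n * (ln (real n) / real n)) - p\<^sup>2 * (x n * (real n * x n) * (ln (real n) / real n)))
       * (real n / (real n + 1)) / (1 + p * x n)\<^sup>2 = real n * ln (real n) * (?r n - 1)"
      using eventually_gt_at_top[of 0]
    proof eventually_elim
      case (elim n)
      define P where "P = (1 + p * x n)\<^sup>2"
      have P: "P > 0" unfolding P_def using p_nonneg x_nonneg[of n]
        by (intro zero_less_power add_pos_nonneg mult_nonneg_nonneg) auto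
      have k: "(real n * x n - \<kappa>) / \<kappa> = 2 * (1 - p) * real n * x n - 1"
      proof -
        have "1 / \<kappa> = 2 * (1 - p)" using p_kappa(2) kappa_pos by (simp add: field_simps)
        moreover have "(real n * x n - \<kappa>) / \<kappa> = real n * x n * (1 / \<kappa>) - 1"
          using kappa_pos by (simp add: diff_divide_distrib)
        ultimately show ?thesis by (simp add: mult_ac)
      qed
      have "real n * ln (real n) * (?r n - 1) = ln (real n) * (real n / (real n + 1)) / P *
         (real n * (1 + x n)\<^sup>2 - (real n + 1) * P)"
      proof -
        have "?r n - 1 = (real n * (1 + x n)\<^sup>2 - (real n + 1) * P) / ((real n + 1) * P)"
          using P unfolding P_def[symmetric] by (simp add: diff_divide_distrib)
        then show ?thesis by simp
      qed
      also have "real n * (1 + x n)\<^sup>2 - (real n + 1) * P = (real n * x n - \<kappa>) / \<kappa>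
         + (1 - p\<^sup>2) * (real n * x n)\<^sup>2 / real n - 2 * p * x n - p\<^sup>2 * (x n)\<^sup>2"
        using elim unfolding k P_def by (simp add: field_simps power2_eq_square)
      finally have e: "real n * ln (real n) * (?r n - 1) = ln (real n) * (real n / (real n + 1)) / P *
        ((real n * x n - \<kappa>) / \<kappa> + (1 - p\<^sup>2) * (real n * x n)\<^sup>2 / real n - 2 * p * x n - p\<^sup>2 * (x n)\<^sup>2)" .
      define K where "K = (real n * x n - \<kappa>) / \<kappa>"
      have K: "ln (real n) * (real n * x n - \<kappa>) / \<kappa> = ln (real n) * K" by (simp add: K_def)
      show ?case unfolding e unfolding K unfolding P_def[symmetric] K_def[symmetric] using elim P
        by (simp add: divide_simps, simp add: algebra_simps power2_eq_square)
    qed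
  qed
  from rate_mult[OF n_ln_n_at_top rate_ln_ratio[of 0] this]
  have "(\<lambda>n. real n * ln (real n) * (ln (real (n + 1)) / ln (real n) * ?r n - 1)) \<longlonglongrightarrow> 1 + a / \<kappa>"
    by simp
  moreover have "\<forall>\<^sub>F n in sequentially. ln (real (n + 1)) / ln (real n) * ?r n = w (Suc n) / w n"
    using eventually_gt_at_top[of 1]
  proof eventually_elim
    case (elim n)
    have 1: "nu (Suc n) = nu n * (1 + x n)"
      using nu_pos[of n] elim by (simp add: nu_Suc x_def field_simps)
    have "1 + x n > 0" "1 + p * x n > 0" "ln (real n) > 0" "nu n > 0" "amp n > 0"
      using x_nonneg[of n] p_nonneg elim nu_pos[of n] amp_pos by (auto intro: add_pos_nonneg)
    then show ?case unfolding w_def l_def g_def 1 amp.simps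
      by (simp add: divide_simps power_mult_distrib)
  qed
  then have "\<forall>\<^sub>F n in sequentially. real n * ln (real n) * (ln (real (n + 1)) / ln (real n) * ?r n - 1)
      = real n * ln (real n) * (w (Suc n) / w n - 1)"
    by eventually_elim simp
  ultimately show ?thesis by (rule Lim_transform_eventually)
qed


lemma w_rate_pos: "1 + a / \<kappa> > 0"
  using kappa_pos index_pos by (simp add: field_simps)

lemma w_pos: "n > 1 \<Longrightarrow> w n > 0"
  using l_pos[of n] by (simp add: w_def)

lemma w_incr: "\<forall>\<^sub>F n in sequentially. w n < w (Suc n)"
  and w_at_top: "filterlim w at_top sequentially"
proof -
  have "\<forall>\<^sub>F n in sequentially. 0 < real n * ln (real n) * (w (Suc n) / w n - 1)"
    by (rule order_tendstoD(1)[OF w_rate w_rate_pos])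
  then show "\<forall>\<^sub>F n in sequentially. w n < w (Suc n)"
    using eventually_gt_at_top[of 1]
  proof eventually_elim
    case (elim n)
    then show ?case using w_pos[of n] by (simp add: zero_less_mult_iff field_simps)
  qed
  \<comment> \<open>Half of the rate of \<open>w\<close> is spent on the factor
    \<open>ln n powr (- c)\<close>. The product still increases, so \<open>w\<close> dominates a
    positive power of \<open>ln n\<close>.\<close>
  define c where "c = (1 + a / \<kappa>) / 2"
  have c: "c > 0" using w_rate_pos by (simp add: c_def)
  have "1 + k + - ((1 + k) / 2) * 1 = (1 + k) / 2" for k :: real by (simp add: field_simps)
  then have c': "1 + a / \<kappa> + - c * 1 > 0" using c unfolding c_def by (simp only:)
  define v where "v n = w n * ln (real n) powr (- c)" for n
  have "(\<lambda>n. real n * ln (real n) * (w (Suc n) / w n * (ln (real (n + 0 + 1)) / ln (real (n + 0))) powr (- c) - 1))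
      \<longlonglongrightarrow> 1 + a / \<kappa> + (- c) * 1"
    by (rule rate_mult[OF n_ln_n_at_top w_rate rate_powr[OF n_ln_n_at_top rate_ln_ratio]])
  then have "\<forall>\<^sub>F n in sequentially.
      0 < real n * ln (real n) * (w (Suc n) / w n * (ln (real (n + 0 + 1)) / ln (real (n + 0))) powr (- c) - 1)"
    by (rule order_tendstoD(1)) (rule c')
  then have "\<forall>\<^sub>F n in sequentially. v n < v (Suc n)"
    using eventually_gt_at_top[of 1]
  proof eventually_elim
    case (elim n)
    then have "w (Suc n) / w n * (ln (real (Suc n)) / ln (real n)) powr (- c) > 1"
    proof -
      have "real n * ln (real n) > 0" using elim by simp
      from zero_less_mult_pos[OF elim(1) this] show ?thesis by (simp add: add.commute)
    qed
    moreover have "w (Suc n) / w n * (ln (real (Suc n)) / ln (real n)) powr (- c) = v (Suc n) / v n"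
      using elim by (simp add: v_def powr_divide)
    moreover have "v n > 0" using elim w_pos[of n] by (simp add: v_def)
    ultimately show ?case by (simp only: less_divide_eq_1_pos)
  qed
  moreover have "\<forall>\<^sub>F n in sequentially. 0 < v n"
    using eventually_gt_at_top[of 1] by eventually_elim (simp add: v_def w_pos)
  ultimately obtain k where k: "k > 0" "\<forall>\<^sub>F n in sequentially. k \<le> v n"
    using eventually_incr_bounded_below by blast
  from k(2) eventually_gt_at_top[of 1] have "\<forall>\<^sub>F n in sequentially. k * ln (real n) powr c \<le> w n"
  proof eventually_elim
    case (elim n)
    then show ?case by (simp add: v_def powr_minus field_simps)
  qed
  moreover have "filterlim (\<lambda>n. k * ln (real n) powr c) at_top sequentially"
    using k c by real_asymp
  ultimately show "filterlim w at_top sequentially" by (rule filterlim_at_top_mono[rotated])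
qed

text \<open>The limit of \<open>s n / w n\<close>, and also of the quotient of the majorant \<open>s_majorant\<close> by \<open>w n\<close>.\<close>

definition slope :: real where "slope = \<kappa> ^ 3 / (a + \<kappa>)"

lemma slope_pos: "slope > 0"
  using kappa_pos index_pos by (simp add: slope_def add.assoc)

text \<open>As \<open>\<mu> (Suc n) / amp (Suc n) = x n / (g n * (1 + p * x n))\<close>, one step
  adds about \<open>\<kappa>\<^sup>2 * l n / n\<close> to \<open>S\<close>, against
  \<open>(1 + a / \<kappa>) * l n / n\<close> for \<open>w\<close>. It is applied twice: with
  \<open>\<theta> = 1\<close> to the majorant of \<open>s\<close>, then to \<open>s\<close> itself,
  where the majorant is what shows that \<open>\<theta>\<close> tends to 1.\<close>

lemma increment_ratio:
  assumes inc: "\<And>n. n \<ge> 1 \<Longrightarrow> S (Suc n) - S n = (\<mu> (Suc n) / amp (Suc n))\<^sup>2 * \<theta> n" and \<theta>: "\<theta> \<longlonglongrightarrow> 1"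
  shows "(\<lambda>n. S n / w n) \<longlonglongrightarrow> slope" "(\<lambda>n. real n * (S (Suc n) - S n) / l n) \<longlonglongrightarrow> \<kappa>\<^sup>2"
proof -
  have "(\<lambda>n. (real n * x n)\<^sup>2 / (1 + p * x n)\<^sup>2 * \<theta> n) \<longlonglongrightarrow> \<kappa>\<^sup>2 / (1 + p * 0)\<^sup>2 * 1"
    by (intro tendsto_intros n_x_lim x_lim \<theta>) simp
  then have *: "(\<lambda>n. (real n * x n)\<^sup>2 / (1 + p * x n)\<^sup>2 * \<theta> n) \<longlonglongrightarrow> \<kappa>\<^sup>2" by simp
  show lim: "(\<lambda>n. real n * (S (Suc n) - S n) / l n) \<longlonglongrightarrow> \<kappa>\<^sup>2"
  proof (rule Lim_transform_eventually[OF *])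
    show "\<forall>\<^sub>F n in sequentially. (real n * x n)\<^sup>2 / (1 + p * x n)\<^sup>2 * \<theta> n = real n * (S (Suc n) - S n) / l n"
      using eventually_gt_at_top[of 0]
    proof eventually_elim
      case (elim n)
      have "1 + p * x n > 0" using x_nonneg[of n] p_nonneg by (auto intro: add_pos_nonneg)
      then show ?case using inc[of n] elim amp_pos[of n] nu_pos[of n]
        by (simp add: l_def g_def x_def power_mult_distrib power_divide divide_simps)
          (simp add: power2_eq_square)
    qed
  qed
  show "(\<lambda>n. S n / w n) \<longlonglongrightarrow> slope"
  proof (rule stolz_cesaro[OF w_incr w_at_top])
    have "(\<lambda>n. (real n * (S (Suc n) - S n) / l n) / (real n * ln (real n) * (w (Suc n) / w n - 1)))
        \<longlonglongrightarrow> \<kappa>\<^sup>2 / (1 + a / \<kappa>)"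
      using w_rate_pos by (intro tendsto_divide lim w_rate) simp
    also have "\<kappa>\<^sup>2 / (1 + a / \<kappa>) = slope"
      using kappa_pos index_pos by (simp add: slope_def divide_simps power2_eq_square power3_eq_cube add.commute)
    finally show "(\<lambda>n. (S (Suc n) - S n) / (w (Suc n) - w n)) \<longlonglongrightarrow> slope"
    proof (rule Lim_transform_eventually)
      show "\<forall>\<^sub>F n in sequentially. (real n * (S (Suc n) - S n) / l n) / (real n * ln (real n) * (w (Suc n) / w n - 1))
        = (S (Suc n) - S n) / (w (Suc n) - w n)"
        using eventually_gt_at_top[of 1]
      proof eventually_elim
        case (elim n)
        have "real n * ln (real n) * (w (Suc n) / w n - 1) = real n / l n * (w (Suc n) - w n)"
          using w_pos[of n] l_pos[of n] elim by (simp add: w_def diff_divide_distrib right_diff_distrib)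
        then show ?case using elim l_pos[of n] by simp
      qed
    qed
  qed
qed

lemma s_Suc: "s (Suc n) = s n + ((\<mu> (Suc n))\<^sup>2 - p\<^sup>2 * (x n)\<^sup>2 * q n) / (amp (Suc n))\<^sup>2"
proof -
  have "1 + p * x n > 0" using x_nonneg[of n] p_nonneg by (auto intro: add_pos_nonneg)
  then show ?thesis using amp_pos[of n]
    by (simp add: s_def divide_simps) (simp add: power2_eq_square algebra_simps)
qed

lemma s_Suc': "n \<ge> 1 \<Longrightarrow> s (Suc n) = s n + (\<mu> (Suc n) / amp (Suc n))\<^sup>2 * (1 - p\<^sup>2 * (q n / (nu n)\<^sup>2))"
  using nu_pos[of n] amp_pos[of "Suc n"] unfolding s_Suc x_def by (simp add: field_simps)

lemma s_nonneg: "s n \<ge> 0"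
  using q_nonneg by (simp add: s_def)

lemma s_0 [simp]: "s 0 = 0" by (simp add: s_def)

lemma s_step: "s n \<le> s (Suc n)" and s_step_le: "n \<ge> 1 \<Longrightarrow> s (Suc n) \<le> s n + (\<mu> (Suc n) / amp (Suc n))\<^sup>2"
proof -
  have *: "0 \<le> 1 - p\<^sup>2 * (q n / (nu n)\<^sup>2)" "1 - p\<^sup>2 * (q n / (nu n)\<^sup>2) \<le> 1" if "n \<ge> 1"
  proof -
    have "q n / (nu n)\<^sup>2 \<le> 1" using q_le[of n] nu_pos[OF that] by simp
    moreover have "p\<^sup>2 \<le> 1" using p_nonneg p_less_1 by (simp add: power_le_one)
    ultimately have "p\<^sup>2 * (q n / (nu n)\<^sup>2) \<le> 1 * 1" using q_nonneg by (intro mult_mono) auto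
    then show "0 \<le> 1 - p\<^sup>2 * (q n / (nu n)\<^sup>2)" by simp
    show "1 - p\<^sup>2 * (q n / (nu n)\<^sup>2) \<le> 1" using q_nonneg by simp
  qed
  show "s n \<le> s (Suc n)"
  proof (cases "n = 0")
    case False
    then show ?thesis using * by (simp add: s_Suc')
  qed (simp add: s_nonneg)
  show "s (Suc n) \<le> s n + (\<mu> (Suc n) / amp (Suc n))\<^sup>2" if "n \<ge> 1"
    using *[OF that] that by (simp add: s_Suc' mult_left_le)
qed

lemma s_mono: "mono s"
  using s_step by (simp add: incseq_SucI)

lemma s_pos: "n \<ge> 1 \<Longrightarrow> s n > 0"
proof -
  have "s 1 > 0" using pos[of 1] amp_pos[of 1] by (simp add: s_def x_def)
  then show "n \<ge> 1 \<Longrightarrow> s n > 0" using monoD[OF s_mono, of 1 n] by simp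
qed

lemma s_majorant: "s n \<le> (\<Sum>k<n. (\<mu> (Suc k) / amp (Suc k))\<^sup>2)"
proof (induction n)
  case (Suc n)
  show ?case
  proof (cases "n = 0")
    case True
    then show ?thesis by (simp add: s_def x_def power_divide)
  next
    case False
    then show ?thesis using Suc s_step_le[of n] by simp
  qed
qed simp

lemma g_l_w: "n > 1 \<Longrightarrow> w n * (g n)\<^sup>2 = ln (real n) / real n"
  using g_pos[of n] by (simp add: w_def l_def)

lemma s_w_lim: "(\<lambda>n. s n / w n) \<longlonglongrightarrow> slope" and s_inc_lim: "(\<lambda>n. real n * (s (Suc n) - s n) / l n) \<longlonglongrightarrow> \<kappa>\<^sup>2"
proof -
  let ?S = "\<lambda>n. \<Sum>k<n. (\<mu> (Suc k) / amp (Suc k))\<^sup>2"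
  have S: "(\<lambda>n. ?S n / w n) \<longlonglongrightarrow> slope"
    by (rule increment_ratio(1)[where \<theta> = "\<lambda>_. 1"]) simp_all
  have ub: "(\<lambda>n. ?S n / w n * (ln (real n) / real n)) \<longlonglongrightarrow> slope * 0"
    by (intro tendsto_mult S) real_asymp
  \<comment> \<open>The quotient is \<open>s n * (g n)\<^sup>2\<close>, which the majorant bounds by
    a bounded multiple of \<open>w n * (g n)\<^sup>2 = ln n / n\<close>.\<close>
  have "(\<lambda>n. q n / (nu n)\<^sup>2) \<longlonglongrightarrow> 0"
  proof (rule tendsto_sandwich[OF _ _ tendsto_const])
    show "(\<lambda>n. ?S n / w n * (ln (real n) / real n)) \<longlonglongrightarrow> 0" using ub by simp
    show "\<forall>\<^sub>F n in sequentially. 0 \<le> q n / (nu n)\<^sup>2" by (simp add: q_nonneg)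
    show "\<forall>\<^sub>F n in sequentially. q n / (nu n)\<^sup>2 \<le> ?S n / w n * (ln (real n) / real n)"
      using eventually_gt_at_top[of 1]
    proof eventually_elim
      case (elim n)
      have "q n / (nu n)\<^sup>2 = s n * (g n)\<^sup>2"
        using amp_pos[of n] by (simp add: s_def g_def power_divide)
      also have "\<dots> \<le> ?S n * (g n)\<^sup>2" by (intro mult_right_mono s_majorant) simp
      also have "\<dots> = ?S n / w n * (w n * (g n)\<^sup>2)" using w_pos[OF elim] by simp
      finally show ?case using g_l_w[OF elim] by simp
    qed
  qed
  then have "(\<lambda>n. 1 - p\<^sup>2 * (q n / (nu n)\<^sup>2)) \<longlonglongrightarrow> 1 - p\<^sup>2 * 0" by (intro tendsto_intros)
  then have \<theta>: "(\<lambda>n. 1 - p\<^sup>2 * (q n / (nu n)\<^sup>2)) \<longlonglongrightarrow> 1" by simp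
  show "(\<lambda>n. s n / w n) \<longlonglongrightarrow> slope" "(\<lambda>n. real n * (s (Suc n) - s n) / l n) \<longlonglongrightarrow> \<kappa>\<^sup>2"
    using increment_ratio[OF _ \<theta>, of s] by (simp_all add: s_Suc')
qed

lemma s_at_top: "filterlim s at_top sequentially"
proof -
  have "filterlim (\<lambda>n. s n / w n * w n) at_top sequentially"
    by (rule filterlim_tendsto_pos_mult_at_top[OF s_w_lim slope_pos w_at_top])
  then show ?thesis
    by (rule filterlim_mono_eventually[OF _ order.refl order.refl])
       (use w_pos in \<open>auto intro!: eventually_mono[OF eventually_gt_at_top[of 1]] simp: less_imp_neq[THEN not_sym]\<close>)
qed

text \<open>One step adds a term of order \<open>l n / n\<close>, while \<open>s n\<close> itself is
  of order \<open>l n * ln n\<close>; the additional \<open>ln n\<close> forces the index to be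
  0.\<close>

lemma s_index: "has_index s 0"
  unfolding has_index_def
proof
  show "\<forall>\<^sub>F n in sequentially. 0 < s n"
    using eventually_ge_at_top[of 1] by eventually_elim (rule s_pos)
  have "(\<lambda>n. (real n * (s (Suc n) - s n) / l n) / (s n / w n) * (1 / ln (real n))) \<longlonglongrightarrow> \<kappa>\<^sup>2 / slope * 0"
    using slope_pos by (intro tendsto_intros s_inc_lim s_w_lim) (simp, real_asymp)
  then have "(\<lambda>n. (real n * (s (Suc n) - s n) / l n) / (s n / w n) * (1 / ln (real n))) \<longlonglongrightarrow> 0" by simp
  then show "(\<lambda>n. real n * (s (Suc n) / s n - 1)) \<longlonglongrightarrow> 0"
  proof (rule Lim_transform_eventually)
    show "\<forall>\<^sub>F n in sequentially. (real n * (s (Suc n) - s n) / l n) / (s n / w n) * (1 / ln (real n))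
       = real n * (s (Suc n) / s n - 1)"
      using eventually_gt_at_top[of 1]
    proof eventually_elim
      case (elim n)
      then show ?case using l_pos[of n] s_pos[of n] by (simp add: w_def field_simps)
    qed
  qed
qed

lemma s_floor: "t > 0 \<Longrightarrow> (\<lambda>n. s (nat \<lfloor>real n * t\<rfloor>) / s n) \<longlonglongrightarrow> 1"
  using has_index_floor[OF s_index] by simp

text \<open>The origin of the normalisation: \<open>G n\<close> is asymptotic to
  \<open>2 * n * g n\<close>, and \<open>sqrt (s n)\<close> to
  \<open>sqrt slope * sqrt (w n)\<close> with
  \<open>sqrt (w n) = sqrt (n * ln n) / (n * g n)\<close>, so the weight \<open>g n\<close>
  cancels.\<close>

lemma G_scaling:
  assumes "t \<ge> 0"
  shows "(\<lambda>n. G (nat \<lfloor>real n * t\<rfloor>) * sqrt (s n) / sqrt (real n * ln (real n))) \<longlonglongrightarrow> 2 * sqrt slope * sqrt t"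
proof (cases "t = 0")
  case True
  then show ?thesis by (simp add: G_def)
next
  case False
  with assms have t: "t > 0" by simp
  have "(\<lambda>n. G (nat \<lfloor>real n * t\<rfloor>) / G n * (G n / (real n * g n)) * sqrt (s n / w n))
      \<longlonglongrightarrow> t powr (1 / 2) * 2 * sqrt slope"
    by (intro tendsto_intros G_lim s_w_lim has_index_floor[OF G_index t])
  then have "(\<lambda>n. G (nat \<lfloor>real n * t\<rfloor>) / G n * (G n / (real n * g n)) * sqrt (s n / w n))
      \<longlonglongrightarrow> 2 * sqrt slope * sqrt t"
    using t by (simp add: powr_half_sqrt mult_ac)
  then show ?thesis
  proof (rule Lim_transform_eventually)
    show "\<forall>\<^sub>F n in sequentially. G (nat \<lfloor>real n * t\<rfloor>) / G n * (G n / (real n * g n)) * sqrt (s n / w n)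
      = G (nat \<lfloor>real n * t\<rfloor>) * sqrt (s n) / sqrt (real n * ln (real n))"
      using eventually_gt_at_top[of 1] has_index_pos[OF G_index]
    proof eventually_elim
      case (elim n)
      have "w n = (ln (real n) * real n) / (real n * g n)\<^sup>2"
        using g_pos[of n] elim by (simp add: w_def l_def power2_eq_square)
      then have "sqrt (w n) = sqrt (real n * ln (real n)) / (real n * g n)"
        using g_pos[of n] elim by (simp add: real_sqrt_divide mult.commute)
      then have "sqrt (s n / w n) = sqrt (s n) * (real n * g n) / sqrt (real n * ln (real n))"
        by (simp add: real_sqrt_divide)
      moreover have "g n > 0" using g_pos[of n] elim by simp
      ultimately show ?case using elim by (simp add: mult_ac)
    qed
  qed
qed

section \<open>Growth bounds for moments of the cluster weights\<close>

lemma amp_power_le: "(1 + real k * (p * x n)) * amp n ^ k \<le> amp (Suc n) ^ k"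
proof -
  have "1 + real k * (p * x n) \<le> (1 + p * x n) ^ k"
    using x_nonneg[of n] p_nonneg by (intro Bernoulli_inequality) (smt (verit) mult_nonneg_nonneg)
  from mult_right_mono[OF this, of "amp n ^ k"] show ?thesis
    using amp_pos[of n] by (simp add: power_mult_distrib mult.commute)
qed

lemma q_index: "has_index q (2 * \<gamma> + 1)"
proof -
  have "has_index (\<lambda>n. s n * (amp n)\<^sup>2) (0 + real 2 * (\<gamma> + 1 / 2))"
    by (rule has_index_mult[OF s_index has_index_power[OF amp_index]])
  then have "has_index (\<lambda>n. s n * (amp n)\<^sup>2) (2 * \<gamma> + 1)" by simp
  moreover have "(\<lambda>n. s n * (amp n)\<^sup>2) = q"
    using amp_pos by (auto simp: s_def fun_eq_iff less_imp_neq[THEN not_sym])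
  ultimately show ?thesis by simp
qed

text \<open>Relative to \<open>amp ^ 3\<close> both inhomogeneous terms have index
  \<open>- 3 / 2\<close> and are summable. \<open>r n\<close> will be the mean of
  \<open>P 3 n\<close>.\<close>

lemma third_moment_bound:
  assumes nonneg: "\<And>n. 0 \<le> r n"
    and rec: "\<And>n. r (Suc n) \<le> (1 + 3 * p * x n) * r n + (3 * p * \<mu> (Suc n) * x n * q n + \<mu> (Suc n) ^ 3)"
  shows "\<exists>C\<ge>0. \<forall>n. r n \<le> C * amp n ^ 3"
proof (rule relative_growth_bounded[where c = "\<lambda>n. 1 + 3 * p * x n"
      and e = "\<lambda>n. 3 * p * \<mu> (Suc n) * x n * q n + \<mu> (Suc n) ^ 3"])
  have "has_index (\<lambda>n. 3 * (\<mu> (Suc n) * x n * q n / amp (Suc n) ^ 3)) (\<gamma> + - 1 + (2 * \<gamma> + 1) - real 3 * (\<gamma> + 1 / 2))"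
    by (intro has_index_cmult has_index_divide has_index_mult memory_index x_index q_index
        has_index_power has_index_shift[OF amp_index]) simp
  then have 1: "summable (\<lambda>n. 3 * (\<mu> (Suc n) * x n * q n / amp (Suc n) ^ 3))"
    by (rule has_index_summable) simp
  have "has_index (\<lambda>n. \<mu> (Suc n) ^ 3 / amp (Suc n) ^ 3) (real 3 * \<gamma> - real 3 * (\<gamma> + 1 / 2))"
    by (intro has_index_divide memory_index has_index_power has_index_shift[OF amp_index])
  then have 2: "summable (\<lambda>n. \<mu> (Suc n) ^ 3 / amp (Suc n) ^ 3)"
    by (rule has_index_summable) simp
  show "summable (\<lambda>n. (3 * p * \<mu> (Suc n) * x n * q n + \<mu> (Suc n) ^ 3) / amp (Suc n) ^ 3)"
    using summable_add[OF summable_mult[OF 1, of p] 2]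
    by (simp add: add_divide_distrib mult_ac)
  show "(1 + 3 * p * x n) * amp n ^ 3 \<le> amp (Suc n) ^ 3" for n
    using amp_power_le[of 3 n] by (simp add: mult.assoc)
  show "0 \<le> 3 * p * \<mu> (Suc n) * x n * q n + \<mu> (Suc n) ^ 3" for n
    using less_imp_le[OF pos[of "Suc n"]] p_nonneg x_nonneg[of n] q_nonneg[of n] by simp
qed (rule zero_less_power[OF amp_pos] rec nonneg)+

text \<open>\<open>v n\<close> will be the variance of \<open>P 2 n\<close>, whose mean is
  \<open>q n = s n * (amp n)\<^sup>2\<close>. A bound by \<open>amp ^ 4\<close> is small against the
  squared mean because \<open>s\<close> diverges; this is the concentration of the cluster
  weights.\<close>

lemma variance_bound:
  assumes nonneg: "\<And>n. 0 \<le> v n" "\<And>n. 0 \<le> r n" and r: "\<And>n. r n \<le> C * amp n ^ 3" and "C \<ge> 0"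
    and rec: "\<And>n. v (Suc n) \<le> (1 + 4 * p * x n) * v n + 4 * p * \<mu> (Suc n) * x n * r n"
  shows "\<exists>C\<ge>0. \<forall>n. v n \<le> C * amp n ^ 4"
proof (rule relative_growth_bounded[where c = "\<lambda>n. 1 + 4 * p * x n"
      and e = "\<lambda>n. 4 * p * \<mu> (Suc n) * x n * r n"])
  have "has_index (\<lambda>n. \<mu> (Suc n) * x n * amp n ^ 3 / amp (Suc n) ^ 4) (\<gamma> + - 1 + real 3 * (\<gamma> + 1 / 2) - real 4 * (\<gamma> + 1 / 2))"
    by (intro has_index_divide has_index_mult memory_index x_index
        has_index_power amp_index has_index_shift[OF amp_index])
  then have "summable (\<lambda>n. \<mu> (Suc n) * x n * amp n ^ 3 / amp (Suc n) ^ 4)"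
    by (rule has_index_summable) simp
  from summable_mult[OF this, of "4 * p * C"]
  show "summable (\<lambda>n. 4 * p * \<mu> (Suc n) * x n * r n / amp (Suc n) ^ 4)"
  proof (rule summable_comparison_test[rotated], intro exI allI impI)
    fix n :: nat
    have "4 * p * \<mu> (Suc n) * x n * r n / amp (Suc n) ^ 4 \<le> 4 * p * \<mu> (Suc n) * x n * (C * amp n ^ 3) / amp (Suc n) ^ 4"
      using pos[of "Suc n"] p_nonneg x_nonneg[of n] amp_pos[of "Suc n"] r[of n]
      by (intro divide_right_mono mult_left_mono) (auto simp del: amp.simps)
    then show "norm (4 * p * \<mu> (Suc n) * x n * r n / amp (Suc n) ^ 4)
        \<le> 4 * p * C * (\<mu> (Suc n) * x n * amp n ^ 3 / amp (Suc n) ^ 4)"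
      using pos[of "Suc n"] p_nonneg x_nonneg[of n] amp_pos[of "Suc n"] nonneg
      by (simp add: abs_mult mult_ac del: amp.simps)
  qed
  show "(1 + 4 * p * x n) * amp n ^ 4 \<le> amp (Suc n) ^ 4" for n
    using amp_power_le[of 4 n] by (simp add: mult.assoc)
  show "0 \<le> 4 * p * \<mu> (Suc n) * x n * r n" for n
    using less_imp_le[OF pos[of "Suc n"]] p_nonneg x_nonneg[of n] nonneg(2)[of n] by simp
qed (rule zero_less_power[OF amp_pos] rec nonneg)+

end

section \<open>Square-integrable martingales\<close>

lemma integrable_mult_L2:
  fixes f g :: "'a \<Rightarrow> real"
  assumes [measurable]: "f \<in> borel_measurable M" "g \<in> borel_measurable M"
    and "integrable M (\<lambda>x. (f x)\<^sup>2)" "integrable M (\<lambda>x. (g x)\<^sup>2)"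
  shows "integrable M (\<lambda>x. f x * g x)"
proof (rule Bochner_Integration.integrable_bound)
  show "integrable M (\<lambda>x. (f x)\<^sup>2 + (g x)\<^sup>2)" using assms by auto
  have "\<bar>u * v\<bar> \<le> u\<^sup>2 + v\<^sup>2" for u v :: real
  proof -
    have "2 * \<bar>u * v\<bar> \<le> u\<^sup>2 + v\<^sup>2" using sum_squares_bound[of "\<bar>u\<bar>" "\<bar>v\<bar>"] by (simp add: abs_mult)
    then show ?thesis by linarith
  qed
  then show "AE x in M. norm (f x * g x) \<le> norm ((f x)\<^sup>2 + (g x)\<^sup>2)" by simp
qed simp

lemma integrable_add_square:
  fixes f g :: "'a \<Rightarrow> real"
  assumes [measurable]: "f \<in> borel_measurable M" "g \<in> borel_measurable M"
    and "integrable M (\<lambda>x. (f x)\<^sup>2)" "integrable M (\<lambda>x. (g x)\<^sup>2)"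
  shows "integrable M (\<lambda>x. (f x + g x)\<^sup>2)"
  using assms integrable_mult_L2[OF assms] by (simp add: power2_sum mult.assoc)

lemma integrable_sum_square:
  fixes f :: "'i \<Rightarrow> 'a \<Rightarrow> real"
  assumes "\<And>i. i \<in> I \<Longrightarrow> f i \<in> borel_measurable M" "\<And>i. i \<in> I \<Longrightarrow> integrable M (\<lambda>x. (f i x)\<^sup>2)"
  shows "integrable M (\<lambda>x. (\<Sum>i\<in>I. f i x)\<^sup>2)"
  using assms by (induction I rule: infinite_finite_induct)
    (auto intro!: integrable_add_square borel_measurable_sum)

context prob_space
begin

lemma integrable_of_square:
  assumes "f \<in> borel_measurable M" "integrable M (\<lambda>x. (f x :: real)\<^sup>2)" shows "integrable M f"
  using integrable_mult_L2[OF assms(1) _ assms(2), of "\<lambda>_. 1"] by simp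

lemma expectation_abs_le_sqrt:
  assumes [measurable]: "f \<in> borel_measurable M" and "integrable M (\<lambda>x. (f x :: real)\<^sup>2)"
  shows "expectation (\<lambda>x. \<bar>f x\<bar>) \<le> sqrt (expectation (\<lambda>x. (f x)\<^sup>2))"
proof -
  have "integrable M (\<lambda>x. \<bar>f x\<bar>)" using integrable_of_square[OF assms] by simp
  then have "variance (\<lambda>x. \<bar>f x\<bar>) = expectation (\<lambda>x. \<bar>f x\<bar>\<^sup>2) - (expectation (\<lambda>x. \<bar>f x\<bar>))\<^sup>2"
    using assms by (intro variance_eq) simp_all
  moreover have "0 \<le> variance (\<lambda>x. \<bar>f x\<bar>)" by (rule variance_positive)
  ultimately have "(expectation (\<lambda>x. \<bar>f x\<bar>))\<^sup>2 \<le> expectation (\<lambda>x. (f x)\<^sup>2)" by simp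
  then show ?thesis by (rule real_le_rsqrt)
qed

end

text \<open>The martingale property is expressed as orthogonality to square-integrable functions of
  the past, the form in which one-step expectations are computed below.\<close>

locale L2_martingale = prob_space +
  fixes F :: "nat \<Rightarrow> 'a measure" and R :: "nat \<Rightarrow> 'a \<Rightarrow> real"
  assumes sub: "\<And>n. subalgebra M (F n)" and filtration: "\<And>m n. m \<le> n \<Longrightarrow> sets (F m) \<subseteq> sets (F n)"
    and adapted: "\<And>n. R n \<in> borel_measurable (F n)"
    and sq_int: "\<And>n. integrable M (\<lambda>\<omega>. (R n \<omega>)\<^sup>2)"
    and orthogonal: "\<And>n h. h \<in> borel_measurable (F n) \<Longrightarrow> integrable M (\<lambda>\<omega>. (h \<omega>)\<^sup>2) \<Longrightarrow>
      expectation (\<lambda>\<omega>. h \<omega> * (R (Suc n) \<omega> - R n \<omega>)) = 0"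
begin

lemma adapted_mono: "m \<le> n \<Longrightarrow> f \<in> borel_measurable (F m) \<Longrightarrow> f \<in> borel_measurable (F n)"
  using filtration[of m n] sub measurable_from_subalg[of "F n" "F m" f borel]
  by (simp add: subalgebra_def)

lemma adapted_M: "f \<in> borel_measurable (F m) \<Longrightarrow> f \<in> borel_measurable M"
  by (rule measurable_from_subalg[OF sub])

lemma R_measurable [measurable]: "R n \<in> borel_measurable M"
  by (rule adapted_M[OF adapted])

lemma orthogonal_later:
  assumes h: "h \<in> borel_measurable (F m)" "integrable M (\<lambda>\<omega>. (h \<omega>)\<^sup>2)" and "m \<le> n"
  shows "expectation (\<lambda>\<omega>. h \<omega> * R n \<omega>) = expectation (\<lambda>\<omega>. h \<omega> * R m \<omega>)"
  using \<open>m \<le> n\<close>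
proof (induction n rule: dec_induct)
  case (step n)
  have hM [measurable]: "h \<in> borel_measurable M" by (rule adapted_M[OF h(1)])
  have i: "integrable M (\<lambda>\<omega>. h \<omega> * R k \<omega>)" for k
    by (rule integrable_mult_L2) (use h sq_int in auto)
  have "expectation (\<lambda>\<omega>. h \<omega> * (R (Suc n) \<omega> - R n \<omega>)) = 0"
    using step by (intro orthogonal adapted_mono[OF _ h(1)] h) auto
  then show ?case using i step.IH by (simp add: right_diff_distrib)
qed simp

lemma increment_second_moment:
  assumes "m \<le> n"
  shows "expectation (\<lambda>\<omega>. (R n \<omega> - R m \<omega>)\<^sup>2) = expectation (\<lambda>\<omega>. (R n \<omega>)\<^sup>2) - expectation (\<lambda>\<omega>. (R m \<omega>)\<^sup>2)"
proof -
  have i: "integrable M (\<lambda>\<omega>. R m \<omega> * R n \<omega>)" by (rule integrable_mult_L2) (use sq_int in auto)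
  have "expectation (\<lambda>\<omega>. (R n \<omega> - R m \<omega>)\<^sup>2)
      = expectation (\<lambda>\<omega>. (R n \<omega>)\<^sup>2 + (R m \<omega>)\<^sup>2 - 2 * (R m \<omega> * R n \<omega>))"
    by (intro Bochner_Integration.integral_cong) (simp_all add: power2_diff)
  also have "\<dots> = expectation (\<lambda>\<omega>. (R n \<omega>)\<^sup>2) + expectation (\<lambda>\<omega>. (R m \<omega>)\<^sup>2) - 2 * expectation (\<lambda>\<omega>. R m \<omega> * R n \<omega>)"
    using i sq_int by simp
  also have "expectation (\<lambda>\<omega>. R m \<omega> * R n \<omega>) = expectation (\<lambda>\<omega>. (R m \<omega>)\<^sup>2)"
    using orthogonal_later[OF adapted sq_int assms] by (simp add: power2_eq_square)
  finally show ?thesis by simp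
qed

text \<open>Expand the nonnegative mean of \<open>indicator A * (R n - R m)\<^sup>2\<close>; in the
  mixed term, orthogonality to \<open>indicator A * R m\<close> replaces \<open>R n\<close> by
  \<open>R m\<close>.\<close>

lemma submartingale_on:
  assumes A: "A \<in> sets (F m)" and "m \<le> n"
  shows "expectation (\<lambda>\<omega>. indicator A \<omega> * (R m \<omega>)\<^sup>2) \<le> expectation (\<lambda>\<omega>. indicator A \<omega> * (R n \<omega>)\<^sup>2)"
proof -
  have AM [measurable]: "A \<in> sets M" using A sub by (auto simp: subalgebra_def)
  let ?h = "\<lambda>\<omega>. indicator A \<omega> * R m \<omega> :: real"
  have h: "?h \<in> borel_measurable (F m)" using A adapted by measurable
  have i: "integrable M (\<lambda>\<omega>. indicator A \<omega> * f \<omega>)" if "integrable M f" for f :: "'a \<Rightarrow> real"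
    using integrable_real_mult_indicator[OF AM that] by (simp add: mult.commute)
  have h2: "integrable M (\<lambda>\<omega>. (?h \<omega>)\<^sup>2)"
  proof -
    have "(\<lambda>\<omega>. (?h \<omega>)\<^sup>2) = (\<lambda>\<omega>. indicator A \<omega> * (R m \<omega>)\<^sup>2)"
      by (auto simp: fun_eq_iff indicator_def)
    then show ?thesis using i[OF sq_int[of m]] by simp
  qed
  have hR: "integrable M (\<lambda>\<omega>. ?h \<omega> * R k \<omega>)" for k
    by (rule integrable_mult_L2) (use h2 sq_int adapted_M[OF h] in auto)
  have "0 \<le> expectation (\<lambda>\<omega>. indicator A \<omega> * (R n \<omega> - R m \<omega>)\<^sup>2)"
    by (intro integral_nonneg_AE) simp
  also have "\<dots> = expectation (\<lambda>\<omega>. indicator A \<omega> * (R n \<omega>)\<^sup>2 + ?h \<omega> * R m \<omega> - 2 * (?h \<omega> * R n \<omega>))"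
    by (intro Bochner_Integration.integral_cong) (simp_all add: power2_eq_square algebra_simps)
  also have "\<dots> = expectation (\<lambda>\<omega>. indicator A \<omega> * (R n \<omega>)\<^sup>2) + expectation (\<lambda>\<omega>. ?h \<omega> * R m \<omega>) - 2 * expectation (\<lambda>\<omega>. ?h \<omega> * R n \<omega>)"
    using hR i[OF sq_int] by simp
  also have "\<dots> = expectation (\<lambda>\<omega>. indicator A \<omega> * (R n \<omega>)\<^sup>2) - expectation (\<lambda>\<omega>. ?h \<omega> * R m \<omega>)"
    using orthogonal_later[OF h h2 \<open>m \<le> n\<close>] by simp
  finally show ?thesis by (simp add: power2_eq_square mult.assoc)
qed

lemma doob_maximal_inequality:
  assumes "c > 0"
  shows "prob {\<omega>\<in>space M. \<exists>k\<le>N. c \<le> \<bar>R k \<omega>\<bar>} \<le> expectation (\<lambda>\<omega>. (R N \<omega>)\<^sup>2) / c\<^sup>2"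
proof -
  \<comment> \<open>The level \<open>c\<close> is reached for the first time at time
    \<open>k\<close>. As this is decided by time \<open>k\<close>, \<open>submartingale_on\<close>
    passes from \<open>R k\<close> to \<open>R N\<close> on \<open>A k\<close>.\<close>
  define A where "A k = {\<omega>\<in>space M. c \<le> \<bar>R k \<omega>\<bar> \<and> (\<forall>j<k. \<bar>R j \<omega>\<bar> < c)}" for k
  have AF: "A k \<in> sets (F k)" for k
  proof -
    have *: "R j \<in> borel_measurable (F k)" if "j \<le> k" for j
      by (rule adapted_mono[OF that adapted])
    have "{\<omega>\<in>space (F k). c \<le> \<bar>R k \<omega>\<bar> \<and> (\<forall>j\<in>{..<k}. \<bar>R j \<omega>\<bar> < c)} \<in> sets (F k)"
      using * by (intro sets.sets_Collect_conj sets.sets_Collect_finite_All borel_measurable_le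
          borel_measurable_less borel_measurable_abs borel_measurable_const) auto
    then show ?thesis using sub[of k] by (simp add: A_def subalgebra_def Ball_def)
  qed
  have AM [measurable]: "A k \<in> sets M" for k using AF[of k] sub[of k] by (auto simp: subalgebra_def)
  have disj: "disjoint_family A"
    unfolding disjoint_family_on_def
  proof (intro ballI impI)
    fix j k :: nat assume "j \<noteq> k"
    then show "A j \<inter> A k = {}"
      by (cases j k rule: linorder_cases) (force simp: A_def)+
  qed
  have un: "{\<omega>\<in>space M. \<exists>k\<le>N. c \<le> \<bar>R k \<omega>\<bar>} = (\<Union>k\<le>N. A k)"
  proof (intro set_eqI iffI)
    fix \<omega> assume "\<omega> \<in> {\<omega>\<in>space M. \<exists>k\<le>N. c \<le> \<bar>R k \<omega>\<bar>}"
    then obtain k where k: "\<omega> \<in> space M" "k \<le> N" "c \<le> \<bar>R k \<omega>\<bar>" by blast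
    define m where "m = (LEAST k. c \<le> \<bar>R k \<omega>\<bar>)"
    have "c \<le> \<bar>R m \<omega>\<bar>" unfolding m_def by (rule LeastI) (rule k)
    moreover have "m \<le> N" unfolding m_def using k by (meson Least_le order_trans)
    moreover have "\<bar>R j \<omega>\<bar> < c" if "j < m" for j
      using that not_less_Least unfolding m_def by (metis not_less)
    ultimately show "\<omega> \<in> (\<Union>k\<le>N. A k)" using k by (auto simp: A_def)
  qed (auto simp: A_def)
  have i: "integrable M (\<lambda>\<omega>. indicator (A k) \<omega> * (R N \<omega>)\<^sup>2)" for k
    using integrable_real_mult_indicator[OF AM sq_int] by (simp add: mult.commute)
  have "c\<^sup>2 * prob (\<Union>k\<le>N. A k) = (\<Sum>k\<le>N. c\<^sup>2 * prob (A k))"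
    using disj by (subst finite_measure_finite_Union)
      (auto simp: sum_distrib_left disjoint_family_on_def)
  also have "\<dots> \<le> (\<Sum>k\<le>N. expectation (\<lambda>\<omega>. indicator (A k) \<omega> * (R N \<omega>)\<^sup>2))"
  proof (intro sum_mono)
    fix k assume "k \<in> {..N}"
    have "c\<^sup>2 * prob (A k) = expectation (\<lambda>\<omega>. indicator (A k) \<omega> * c\<^sup>2)" by simp
    also have "\<dots> \<le> expectation (\<lambda>\<omega>. indicator (A k) \<omega> * (R k \<omega>)\<^sup>2)"
    proof (intro integral_mono)
      show "integrable M (\<lambda>\<omega>. indicator (A k) \<omega> * (R k \<omega>)\<^sup>2)"
        using integrable_real_mult_indicator[OF AM sq_int] by (simp add: mult.commute)
      fix \<omega> show "indicator (A k) \<omega> * c\<^sup>2 \<le> indicator (A k) \<omega> * (R k \<omega>)\<^sup>2"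
        using assms abs_le_square_iff[of c "R k \<omega>"] by (auto simp: indicator_def A_def)
    next
      show "integrable M (\<lambda>\<omega>. indicator (A k) \<omega> * c\<^sup>2)"
        using integrable_real_mult_indicator[OF AM integrable_const[of "c\<^sup>2"]] by (simp only: mult.commute)
    qed
    also have "\<dots> \<le> expectation (\<lambda>\<omega>. indicator (A k) \<omega> * (R N \<omega>)\<^sup>2)"
      using \<open>k \<in> {..N}\<close> by (intro submartingale_on AF) simp
    finally show "c\<^sup>2 * prob (A k) \<le> expectation (\<lambda>\<omega>. indicator (A k) \<omega> * (R N \<omega>)\<^sup>2)" .
  qed
  also have "\<dots> = expectation (\<lambda>\<omega>. (\<Sum>k\<le>N. indicator (A k) \<omega>) * (R N \<omega>)\<^sup>2)"
    unfolding sum_distrib_right by (rule Bochner_Integration.integral_sum[symmetric, OF i])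
  also have "\<dots> \<le> expectation (\<lambda>\<omega>. (R N \<omega>)\<^sup>2)"
  proof (intro integral_mono sq_int)
    show "integrable M (\<lambda>\<omega>. (\<Sum>k\<le>N. indicator (A k) \<omega>) * (R N \<omega>)\<^sup>2)"
      unfolding sum_distrib_right by (rule Bochner_Integration.integrable_sum[OF i])
    fix \<omega>
    have "(\<Sum>k\<le>N. indicator (A k) \<omega>) = (indicator (\<Union>k\<le>N. A k) \<omega> :: real)"
      using disj by (subst indicator_UN_disjoint) (auto simp: disjoint_family_on_def)
    then show "(\<Sum>k\<le>N. indicator (A k) \<omega>) * (R N \<omega>)\<^sup>2 \<le> (R N \<omega>)\<^sup>2"
      by (simp add: indicator_def)
  qed
  finally show ?thesis using assms unfolding un by (simp add: field_simps)
qed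

end

section \<open>Clusters of the reinforced walk\<close>

text \<open>The index of the innovation recalled at time \<open>n\<close>; an inadmissible \<open>B n\<close> counts as
  no recollection, so that \<open>genealogy A B n\<close> always lies in \<open>{1..n}\<close> for \<open>n \<ge> 1\<close>.\<close>

function genealogy :: "(nat \<Rightarrow> bool) \<Rightarrow> (nat \<Rightarrow> nat) \<Rightarrow> nat \<Rightarrow> nat" where
  "genealogy A B n = (if A n \<and> 1 \<le> B n \<and> B n < n then genealogy A B (B n) else n)"
  by pat_completeness auto
termination by (relation "Wellfounded.measure (\<lambda>(A, B, n). n)") auto

declare genealogy.simps [simp del]

lemma genealogy_bounds: "genealogy A B n \<le> n" "1 \<le> n \<Longrightarrow> 1 \<le> genealogy A B n"
proof -
  have "genealogy A B n \<le> n \<and> (1 \<le> n \<longrightarrow> 1 \<le> genealogy A B n)"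
  proof (induction n rule: less_induct)
    case (less n)
    show ?case
    proof (cases "A n \<and> 1 \<le> B n \<and> B n < n")
      case True
      then show ?thesis using less.IH[of "B n"] genealogy.simps[of A B n] by simp
    next
      case False
      then show ?thesis using genealogy.simps[of A B n] by auto
    qed
  qed
  then show "genealogy A B n \<le> n" "1 \<le> n \<Longrightarrow> 1 \<le> genealogy A B n" by auto
qed

text \<open>The two recursions treat an inadmissible recall differently, as the value 0 and as a
  fresh innovation; hence the hypothesis on \<open>B\<close>.\<close>

lemma srrw_step_genealogy:
  assumes "\<And>m. 2 \<le> m \<Longrightarrow> 1 \<le> B m \<and> B m < m" "1 \<le> n"
  shows "srrw_step X A B n = X (genealogy A B n)"
  using assms(2)
proof (induction n rule: less_induct)
  case (less n)
  show ?case
  proof (cases "n \<le> 1")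
    case True
    then have "n = 1" using less by simp
    then show ?thesis using srrw_step.simps[of X A B 1] genealogy.simps[of A B 1] by simp
  next
    case False
    then have "1 \<le> B n" "B n < n" using assms(1)[of n] by simp_all
    then show ?thesis using False less.IH[of "B n"]
      srrw_step.simps[of X A B n] genealogy.simps[of A B n] by (cases "A n") simp_all
  qed
qed

section \<open>Independence of disjoint sets of coordinates\<close>

context srrw_rvm
begin

text \<open>The three sequences become one real family, indexed by the number of the sequence and
  the position, so that index sets can describe every sigma-algebra in use.\<close>

definition Z :: "nat \<times> nat \<Rightarrow> 'a \<Rightarrow> real" where
  "Z = (\<lambda>(i, k) \<omega>. if i = 0 then \<xi> (k + 1) \<omega>
     else if i = 1 then of_bool (\<alpha> (k + 2) \<omega>) else real (\<beta> (k + 2) \<omega>))"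

lemma Z_simps: "Z (0, k) = \<xi> (k + 1)" "Z (1, k) = (\<lambda>\<omega>. of_bool (\<alpha> (k + 2) \<omega>))"
    "Z (Suc 0, k) = (\<lambda>\<omega>. of_bool (\<alpha> (k + 2) \<omega>))" "Z (2, k) = (\<lambda>\<omega>. real (\<beta> (k + 2) \<omega>))"
  by (simp_all add: Z_def fun_eq_iff)

text \<open>\<open>H K\<close> below is the sigma-algebra generated by the coordinates \<open>Z i\<close> with \<open>i \<in> K\<close>.\<close>

definition evs :: "nat \<times> nat \<Rightarrow> 'a set set" where
  "evs i = {Z i -` A \<inter> space M | A. A \<in> sets borel}"

abbreviation idx :: "(nat \<times> nat) set" where "idx \<equiv> {0, 1, 2} \<times> UNIV"

text \<open>Bridges the index shifts: the model numbers its sequences from 1 or 2, \<open>Z\<close>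
  from 0.\<close>

lemma coordinate_indep:
  assumes "i \<in> {0, 1, 2 :: nat}"
  shows "indep_vars (\<lambda>_. borel) (\<lambda>k. Z (i, k)) UNIV"
proof -
  have shift: "indep_vars (\<lambda>_. N) (\<lambda>k. X (k + c)) UNIV" if "indep_vars (\<lambda>_. N) X {c..}"
    for N :: "'c measure" and X :: "nat \<Rightarrow> 'a \<Rightarrow> 'c" and c :: nat
    unfolding indep_vars_def2
  proof (intro conjI ballI indep_setsI)
    show rv: "random_variable N (X (k + c))" for k
      using that by (auto simp: indep_vars_def2)
    show "{X (k + c) -` A \<inter> space M |A. A \<in> sets N} \<subseteq> events" for k
      using rv[of k] by (auto intro: measurable_sets)
    fix A J assume J: "J \<noteq> {}" "finite (J :: nat set)" and "\<forall>k\<in>J. A k \<in> {X (k + c) -` A \<inter> space M |A. A \<in> sets N}"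
    then obtain B where B: "\<And>k. k \<in> J \<Longrightarrow> A k = X (k + c) -` B k \<inter> space M" "\<And>k. k \<in> J \<Longrightarrow> B k \<in> sets N"
      by (auto simp: Ball_def) metis
    let ?J = "(\<lambda>k. k + c) ` J"
    have "prob (\<Inter>j\<in>?J. X j -` B (j - c) \<inter> space M) = (\<Prod>j\<in>?J. prob (X j -` B (j - c) \<inter> space M))"
      by (rule indep_varsD[OF that]) (use J B in auto)
    moreover have "(\<Inter>j\<in>?J. X j -` B (j - c) \<inter> space M) = (\<Inter>j\<in>J. A j)"
      using B(1) by (auto simp del: INT_simps)
    ultimately show "prob (\<Inter>j\<in>J. A j) = (\<Prod>j\<in>J. prob (A j))"
      using B(1) by (simp add: prod.reindex inj_on_def del: INT_simps)
  qed
  have "indep_vars (\<lambda>_. borel) (\<lambda>k. Z (0, k)) UNIV"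
    using shift[OF innov_indep] by (simp add: Z_simps)
  moreover have "indep_vars (\<lambda>_. borel) (\<lambda>k. Z (1, k)) UNIV"
    unfolding Z_simps by (rule indep_vars_compose2[OF shift[OF recoll_indep]]) simp
  moreover have "indep_vars (\<lambda>_. borel) (\<lambda>k. Z (2, k)) UNIV"
    unfolding Z_simps by (rule indep_vars_compose2[OF shift[OF recall_indep]]) simp
  ultimately show ?thesis using assms by auto
qed

lemma Z_measurable: "i \<in> idx \<Longrightarrow> Z i \<in> borel_measurable M"
  using coordinate_indep[of "fst i"] by (auto simp: indep_vars_def2)

text \<open>Independence in two layers: a finite intersection is sorted by sequence,
  \<open>sequences_indep\<close> separates the three groups, and \<open>coordinate_indep\<close>
  factors each group.\<close>

lemma indep_evs: "indep_sets evs idx"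
proof (rule indep_setsI)
  fix i assume "i \<in> idx"
  then show "evs i \<subseteq> events"
    using Z_measurable[of i] by (auto simp: evs_def intro: measurable_sets)
next
  fix A J assume J: "J \<noteq> {}" "J \<subseteq> idx" "finite J" and A: "\<forall>j\<in>J. A j \<in> evs j"
  from A have "\<forall>j\<in>J. \<exists>B. B \<in> sets borel \<and> A j = Z j -` B \<inter> space M" by (auto simp: evs_def)
  then obtain B where B: "\<And>j. j \<in> J \<Longrightarrow> B j \<in> sets borel" "\<And>j. j \<in> J \<Longrightarrow> A j = Z j -` B j \<inter> space M"
    by metis
  define K where "K i = {k. (i, k) \<in> J}" for i
  have K: "finite (K i)" for i
    using finite_vimageI[OF J(3), of "Pair i"] by (simp add: K_def vimage_def inj_def)
  \<comment> \<open>A cylinder set gathering all constraints on sequence \<open>i\<close>, so that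
    they form one event of the random sequence as a whole.\<close>
  define C :: "nat \<Rightarrow> (nat \<Rightarrow> real) set" where "C i = {y \<in> space (\<Pi>\<^sub>M k\<in>UNIV. borel). \<forall>k\<in>K i. y k \<in> B (i, k)}" for i
  have C: "C i \<in> sets (\<Pi>\<^sub>M k\<in>UNIV. borel)" for i
    unfolding C_def
  proof (intro sets.sets_Collect_finite_All K)
    fix k assume "k \<in> K i"
    then have "B (i, k) \<in> sets borel" by (intro B) (simp add: K_def)
    from measurable_sets[OF measurable_component_singleton[of k UNIV "\<lambda>_. borel"] this]
    show "{y \<in> space (\<Pi>\<^sub>M k\<in>UNIV. borel). y k \<in> B (i, k)} \<in> sets (\<Pi>\<^sub>M k\<in>UNIV. (borel :: real measure))"
      by (simp add: vimage_def Int_def conj_commute)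
  qed
  let ?W = "\<lambda>i \<omega> k. if i = 0 then \<xi> (k + 1) \<omega> else if i = 1 then of_bool (\<alpha> (k + 2) \<omega>) else real (\<beta> (k + 2) \<omega>)"
  have W: "?W i \<omega> k = Z (i, k) \<omega>" for i \<omega> k by (simp add: Z_def)
  have vim: "?W i -` C i \<inter> space M = {\<omega>\<in>space M. \<forall>k\<in>K i. Z (i, k) \<omega> \<in> B (i, k)}" for i
    unfolding C_def by (simp only: vimage_def mem_Collect_eq W) (auto simp: space_PiM)
  have inter: "(\<Inter>j\<in>J. A j) = (\<Inter>i\<in>{0, 1, 2}. ?W i -` C i \<inter> space M)"
    unfolding vim
  proof (intro set_eqI iffI)
    fix \<omega> assume "\<omega> \<in> (\<Inter>j\<in>J. A j)"
    then have w: "\<omega> \<in> A j" if "j \<in> J" for j using that by blast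
    then have "\<omega> \<in> space M" using J(1) B(2) by blast
    moreover have "Z (i, k) \<omega> \<in> B (i, k)" if "k \<in> K i" for i k
      using w[of "(i, k)"] B(2)[of "(i, k)"] that by (simp add: K_def)
    ultimately show "\<omega> \<in> (\<Inter>i\<in>{0, 1, 2}. {\<omega>\<in>space M. \<forall>k\<in>K i. Z (i, k) \<omega> \<in> B (i, k)})"
      by blast
  next
    fix \<omega> assume w: "\<omega> \<in> (\<Inter>i\<in>{0, 1, 2}. {\<omega>\<in>space M. \<forall>k\<in>K i. Z (i, k) \<omega> \<in> B (i, k)})"
    show "\<omega> \<in> (\<Inter>j\<in>J. A j)"
    proof
      fix j assume j: "j \<in> J"
      obtain i k where ik: "j = (i, k)" by (cases j)
      then have "i \<in> {0, 1, 2}" "k \<in> K i" using j J(2) by (auto simp: K_def)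
      with w have "Z j \<omega> \<in> B j" "\<omega> \<in> space M" unfolding ik by blast+
      then show "\<omega> \<in> A j" using B(2)[OF j] by simp
    qed
  qed
  have "prob (\<Inter>j\<in>J. A j) = (\<Prod>i\<in>{0, 1, 2}. prob (?W i -` C i \<inter> space M))"
    unfolding inter by (rule indep_varsD[OF sequences_indep]) (simp_all add: C)
  also have "\<dots> = (\<Prod>i\<in>{0, 1, 2}. \<Prod>k\<in>K i. prob (A (i, k)))"
  proof (rule prod.cong[OF refl])
    fix i :: nat assume i: "i \<in> {0, 1, 2}"
    show "prob (?W i -` C i \<inter> space M) = (\<Prod>k\<in>K i. prob (A (i, k)))"
    proof (cases "K i = {}")
      case True
      then show ?thesis unfolding vim by (simp add: prob_space)
    next
      case False
      have "prob (\<Inter>k\<in>K i. Z (i, k) -` B (i, k) \<inter> space M) = (\<Prod>k\<in>K i. prob (Z (i, k) -` B (i, k) \<inter> space M))"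
        by (rule indep_varsD[OF coordinate_indep[OF i] False K]) (auto simp: K_def B)
      moreover have "(\<Inter>k\<in>K i. Z (i, k) -` B (i, k) \<inter> space M) = ?W i -` C i \<inter> space M"
        unfolding vim using False by auto
      ultimately show ?thesis using B by (simp add: K_def)
    qed
  qed
  also have "\<dots> = (\<Prod>j\<in>(SIGMA i:{0, 1, 2}. K i). prob (A j))"
    using K by (subst prod.Sigma) simp_all
  also have "(SIGMA i:{0, 1, 2}. K i) = J"
    using J(2) by (auto simp: K_def)
  finally show "prob (\<Inter>j\<in>J. A j) = (\<Prod>j\<in>J. prob (A j))" .
qed

definition H :: "(nat \<times> nat) set \<Rightarrow> 'a measure" where
  "H K = sigma (space M) (\<Union>i\<in>K. evs i)"

lemma space_H [simp]: "space (H K) = space M"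
  unfolding H_def by (rule space_measure_of) (auto simp: evs_def)

lemma sets_H: "sets (H K) = sigma_sets (space M) (\<Union>i\<in>K. evs i)"
  unfolding H_def by (rule sets_measure_of) (auto simp: evs_def)

lemma sets_H_mono: "K \<subseteq> L \<Longrightarrow> sets (H K) \<subseteq> sets (H L)"
  unfolding sets_H by (rule sigma_sets_mono') blast

lemma subalgebra_H:
  assumes "K \<subseteq> idx" shows "subalgebra M (H K)"
  unfolding subalgebra_def sets_H
proof
  have "\<forall>i\<in>idx. evs i \<subseteq> events" using indep_evs unfolding indep_sets_def by (rule conjunct1)
  then show "sigma_sets (space M) (\<Union>i\<in>K. evs i) \<subseteq> events"
    using assms by (intro sets.sigma_sets_subset) blast
qed simp

lemma H_mono:
  assumes "K \<subseteq> L" "f \<in> measurable (H K) N" shows "f \<in> measurable (H L) N"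
proof (rule measurable_from_subalg[OF _ assms(2)])
  show "subalgebra (H L) (H K)"
    unfolding subalgebra_def using sets_H_mono[OF assms(1)] by simp
qed

lemma H_measurable: "K \<subseteq> idx \<Longrightarrow> f \<in> measurable (H K) N \<Longrightarrow> f \<in> measurable M N"
  by (rule measurable_from_subalg[OF subalgebra_H])

lemma Z_H:
  assumes "i \<in> K" shows "Z i \<in> borel_measurable (H K)"
proof (rule measurableI)
  fix A :: "real set" assume "A \<in> sets borel"
  then have "Z i -` A \<inter> space M \<in> evs i" unfolding evs_def by blast
  with assms have "Z i -` A \<inter> space M \<in> (\<Union>i\<in>K. evs i)" by blast
  then show "Z i -` A \<inter> space (H K) \<in> sets (H K)"
    unfolding space_H sets_H by (rule sigma_sets.Basic)
qed simp

text \<open>Stated over a general field because the moments need real factors and the characteristic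
  function complex ones.\<close>

lemma indep_H:
  fixes f g :: "'a \<Rightarrow> 'b::{second_countable_topology, real_normed_field, banach}"
  assumes KL: "K \<subseteq> idx" "L \<subseteq> idx" "K \<inter> L = {}"
    and f: "f \<in> borel_measurable (H K)" "integrable M f" and g: "g \<in> borel_measurable (H L)" "integrable M g"
  shows "expectation (\<lambda>\<omega>. f \<omega> * g \<omega>) = expectation f * expectation g"
    "integrable M (\<lambda>\<omega>. f \<omega> * g \<omega>)"
proof -
  have "indep_sets (\<lambda>j. sigma_sets (space M) (\<Union>i\<in>(case j of True \<Rightarrow> K | False \<Rightarrow> L). evs i)) UNIV"
  proof (rule indep_sets_collect_sigma)
    show "indep_sets evs (\<Union>j\<in>UNIV. case j of True \<Rightarrow> K | False \<Rightarrow> L)"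
      by (rule indep_sets_mono_index[OF _ indep_evs]) (use KL in \<open>auto split: bool.splits\<close>)
    show "Int_stable (evs i)" for i
      unfolding Int_stable_def evs_def
    proof safe
      fix A B :: "real set" assume "A \<in> sets borel" "B \<in> sets borel"
      then show "\<exists>C. Z i -` A \<inter> space M \<inter> (Z i -` B \<inter> space M) = Z i -` C \<inter> space M \<and> C \<in> sets borel"
        by (intro exI[of _ "A \<inter> B"]) auto
    qed
    show "disjoint_family_on (case_bool K L) UNIV"
      using KL by (auto simp: disjoint_family_on_def split: bool.splits)
  qed
  then have ind: "indep_set (sets (H K)) (sets (H L))"
    unfolding indep_set_def sets_H
    by (rule indep_sets_mono_sets) (simp split: bool.splits)
  have sub: "sigma_sets (space M) {h -` A \<inter> space M | A. A \<in> sets borel} \<subseteq> sets (H K')"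
    if "h \<in> borel_measurable (H K')" for h :: "'a \<Rightarrow> 'b" and K'
    using that sets.sigma_sets_subset[of "{h -` A \<inter> space M | A. A \<in> sets borel}" "H K'"]
    by (auto simp: measurable_def)
  have "indep_var borel f borel g"
    unfolding indep_var_eq
  proof (intro conjI)
    show "indep_set (sigma_sets (space M) {f -` A \<inter> space M | A. A \<in> sets borel})
       (sigma_sets (space M) {g -` A \<inter> space M | A. A \<in> sets borel})"
      using ind unfolding indep_set_def
      by (rule indep_sets_mono_sets) (use sub[OF f(1)] sub[OF g(1)] in \<open>auto split: bool.splits\<close>)
  qed (use f g in auto)
  from indep_var_lebesgue_integral[OF this f(2) g(2)] indep_var_integrable[OF this f(2) g(2)]
  show "expectation (\<lambda>\<omega>. f \<omega> * g \<omega>) = expectation f * expectation g"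
    "integrable M (\<lambda>\<omega>. f \<omega> * g \<omega>)" .
qed

end

lemma integrable_mult_bounded:
  fixes f h :: "'a \<Rightarrow> real"
  assumes "integrable M f" "h \<in> borel_measurable M" "\<And>x. \<bar>h x\<bar> \<le> C"
  shows "integrable M (\<lambda>x. f x * h x)"
proof (rule Bochner_Integration.integrable_bound)
  show "integrable M (\<lambda>x. C * f x)" using assms(1) by simp
  have "C \<ge> 0" using assms(3) abs_ge_zero order_trans by blast
  moreover have "\<bar>f x\<bar> * \<bar>h x\<bar> \<le> \<bar>f x\<bar> * C" for x
    by (intro mult_left_mono assms(3)) simp
  ultimately show "AE x in M. norm (f x * h x) \<le> norm (C * f x)"
    by (simp add: abs_mult mult.commute)
qed (use assms in auto)

section \<open>Roots and clusters of the critical walk\<close>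

locale critical_srrw = srrw_rvm + critical_memory +
  assumes sq_integrable: "integrable M (\<lambda>\<omega>. (\<xi> 1 \<omega>)\<^sup>2)" and unit_variance: "variance (\<xi> 1) = 1"
begin

definition rt :: "nat \<Rightarrow> 'a \<Rightarrow> nat" where
  "rt n \<omega> = genealogy (\<lambda>i. \<alpha> i \<omega>) (\<lambda>i. \<beta> i \<omega>) n"

text \<open>Defined through the root on the whole space; the agreement with \<open>srrw_step\<close>
  is only almost sure, see \<open>srrw_eq_AE\<close>.\<close>

definition X :: "nat \<Rightarrow> 'a \<Rightarrow> real" where "X n \<omega> = \<xi> (rt n \<omega>) \<omega>"

definition Y :: "nat \<Rightarrow> 'a \<Rightarrow> real" where "Y n \<omega> = (\<Sum>k=1..n. \<mu> k * X k \<omega>)"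

text \<open>\<open>D n i\<close> is the total memory weight at time \<open>n\<close> of the cluster of times that repeat the
  innovation \<open>\<xi> i\<close>.\<close>

definition D :: "nat \<Rightarrow> nat \<Rightarrow> 'a \<Rightarrow> real" where
  "D n i \<omega> = (\<Sum>k=1..n. \<mu> k * of_bool (rt k \<omega> = i))"

text \<open>Given the genealogy, \<open>P 2 n\<close> is the variance of \<open>Y n\<close>, while
  \<open>P 3 n\<close> bounds the error of the Gaussian approximation.\<close>

definition P :: "nat \<Rightarrow> nat \<Rightarrow> 'a \<Rightarrow> real" where "P j n \<omega> = (\<Sum>i=1..n. D n i \<omega> ^ j)"

text \<open>The walk with its conditional means removed. The mean of step \<open>k + 1\<close> is
  formed at time \<open>k\<close>, hence the sum up to \<open>n - 1\<close>.\<close>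

definition R :: "nat \<Rightarrow> 'a \<Rightarrow> real" where
  "R n \<omega> = (\<Sum>k=1..n. X k \<omega>) - (\<Sum>k=1..<n. p * Y k \<omega> / nu k)"

text \<open>Coordinates describing the genealogy up to time \<open>n\<close>, then with the past innovations added,
  then with all innovations added. The shifts by 1 and 2 are those of \<open>Z\<close>.\<close>

definition T :: "nat \<Rightarrow> (nat \<times> nat) set" where "T n = {1, 2} \<times> {k. k + 2 \<le> n}"
definition F :: "nat \<Rightarrow> (nat \<times> nat) set" where "F n = T n \<union> {0} \<times> {..<n}"
definition Fx :: "nat \<Rightarrow> (nat \<times> nat) set" where "Fx n = T n \<union> {0} \<times> UNIV"

lemma F_mono: "m \<le> n \<Longrightarrow> F m \<subseteq> F n"
  and T_F: "T n \<subseteq> F n" and F_Fx: "F n \<subseteq> Fx n" and T_Fx: "T n \<subseteq> Fx n"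
  and T_idx: "T n \<subseteq> idx" and F_idx: "F n \<subseteq> idx" and Fx_idx: "Fx n \<subseteq> idx"
  by (auto simp: T_def F_def Fx_def)

lemma innov_H: "1 \<le> m \<Longrightarrow> (0, m - 1) \<in> K \<Longrightarrow> \<xi> m \<in> borel_measurable (H K)"
  using Z_H[of "(0, m - 1)" K] by (simp add: Z_simps)

lemma recoll_H: "2 \<le> m \<Longrightarrow> (1, m - 2) \<in> K \<Longrightarrow> Measurable.pred (H K) (\<alpha> m)"
proof -
  assume m: "2 \<le> m" "(1, m - 2) \<in> K"
  then have [measurable]: "Z (1, m - 2) \<in> borel_measurable (H K)" by (intro Z_H)
  have "Measurable.pred (H K) (\<lambda>\<omega>. Z (1, m - 2) \<omega> = 1)" by measurable
  moreover obtain j where "m = j + 2" using m(1) by (metis le_add_diff_inverse2)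
  then have "\<alpha> m = (\<lambda>\<omega>. Z (1, m - 2) \<omega> = 1)"
    by (simp add: Z_simps)
  ultimately show ?thesis by simp
qed

lemma recall_H: "2 \<le> m \<Longrightarrow> (2, m - 2) \<in> K \<Longrightarrow> \<beta> m \<in> measurable (H K) (count_space UNIV)"
proof -
  assume m: "2 \<le> m" "(2, m - 2) \<in> K"
  then have [measurable]: "Z (2, m - 2) \<in> borel_measurable (H K)" by (intro Z_H)
  have "(\<lambda>\<omega>. nat \<lfloor>Z (2, m - 2) \<omega>\<rfloor>) \<in> measurable (H K) (count_space UNIV)" by measurable
  moreover obtain j where "m = j + 2" using m(1) by (metis le_add_diff_inverse2)
  then have "\<beta> m = (\<lambda>\<omega>. nat \<lfloor>Z (2, m - 2) \<omega>\<rfloor>)"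
    by (simp add: Z_simps)
  ultimately show ?thesis by simp
qed

lemma rt_le: "rt n \<omega> \<le> n" and rt_ge: "1 \<le> n \<Longrightarrow> 1 \<le> rt n \<omega>"
  unfolding rt_def by (rule genealogy_bounds, rule genealogy_bounds)

lemma rt_eq: "rt n \<omega> = (if \<alpha> n \<omega> \<and> 1 \<le> \<beta> n \<omega> \<and> \<beta> n \<omega> < n then rt (\<beta> n \<omega>) \<omega> else n)"
  unfolding rt_def by (rule genealogy.simps)

lemma rt_H: "n \<le> N \<Longrightarrow> rt n \<in> measurable (H (T N)) (count_space UNIV)"
proof (induction n rule: less_induct)
  case (less n)
  show ?case
  proof (cases "n \<le> 1")
    case True
    then have "rt n \<omega> = n" for \<omega> by (subst rt_eq) auto
    then have "rt n = (\<lambda>_. n)" by auto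
    then show ?thesis by simp
  next
    case False
    then have K: "(1, n - 2) \<in> T N" "(2, n - 2) \<in> T N" "2 \<le> n" using less.prems by (auto simp: T_def)
    note [measurable] = recoll_H[OF K(3,1)] recall_H[OF K(3,2)]
    \<comment> \<open>The root is evaluated at the random time \<open>\<beta> n\<close>; the cut-off
      at \<open>n\<close> lets the induction hypothesis apply for each fixed value
      \<open>k\<close>.\<close>
    have "(\<lambda>\<omega>. if k < n then rt k \<omega> else 0) \<in> measurable (H (T N)) (count_space UNIV)" for k
      using less.IH[of k] less.prems by (cases "k < n") simp_all
    then have [measurable]: "(\<lambda>\<omega>. (if \<beta> n \<omega> < n then rt (\<beta> n \<omega>) \<omega> else 0)) \<in> measurable (H (T N)) (count_space UNIV)"
      by (rule measurable_compose_countable) measurable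
    have "rt n = (\<lambda>\<omega>. if \<alpha> n \<omega> \<and> 1 \<le> \<beta> n \<omega> \<and> \<beta> n \<omega> < n
        then (if \<beta> n \<omega> < n then rt (\<beta> n \<omega>) \<omega> else 0) else n)"
      by (subst rt_eq[abs_def]) auto
    also have "\<dots> \<in> measurable (H (T N)) (count_space UNIV)" by measurable
    finally show ?thesis .
  qed
qed

lemma rt_H_of_bool: "n \<le> N \<Longrightarrow> (\<lambda>\<omega>. of_bool (rt n \<omega> = i) :: real) \<in> borel_measurable (H (T N))"
  using rt_H[of n N] by measurable

lemma X_sum: "1 \<le> n \<Longrightarrow> X n \<omega> = (\<Sum>i=1..n. of_bool (rt n \<omega> = i) * \<xi> i \<omega>)"
proof -
  assume "1 \<le> n"
  then have "rt n \<omega> \<in> {1..n}" using rt_le rt_ge by simp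
  then have "(\<Sum>i=1..n. of_bool (rt n \<omega> = i) * \<xi> i \<omega>) = (\<Sum>i\<in>{rt n \<omega>}. \<xi> i \<omega>)"
    by (intro sum.mono_neutral_cong_right) auto
  then show ?thesis by (simp add: X_def)
qed

lemma X_H: "1 \<le> n \<Longrightarrow> n \<le> N \<Longrightarrow> X n \<in> borel_measurable (H (F N))"
proof -
  assume n: "1 \<le> n" "n \<le> N"
  have "(\<lambda>\<omega>. \<Sum>i=1..n. of_bool (rt n \<omega> = i) * \<xi> i \<omega>) \<in> borel_measurable (H (F N))"
    using n by (intro borel_measurable_sum borel_measurable_times innov_H
        H_mono[OF T_F rt_H_of_bool]) (auto simp: F_def)
  then show ?thesis using X_sum[OF n(1)] by (simp add: fun_eq_iff[symmetric] cong: measurable_cong)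
qed

lemma Y_H: "n \<le> N \<Longrightarrow> Y n \<in> borel_measurable (H (F N))"
  unfolding Y_def[abs_def] by (intro borel_measurable_sum borel_measurable_times X_H) auto

lemma D_H: "n \<le> N \<Longrightarrow> D n i \<in> borel_measurable (H (T N))"
  unfolding D_def[abs_def] by (intro borel_measurable_sum borel_measurable_times rt_H_of_bool) auto

lemma P_H: "n \<le> N \<Longrightarrow> P j n \<in> borel_measurable (H (T N))"
  unfolding P_def[abs_def] by (intro borel_measurable_sum borel_measurable_power D_H) auto

lemma R_H: "n \<le> N \<Longrightarrow> R n \<in> borel_measurable (H (F N))"
  unfolding R_def[abs_def]
  by (intro borel_measurable_diff borel_measurable_sum borel_measurable_times borel_measurable_divide X_H Y_H) auto

lemma innov_measurable: "1 \<le> n \<Longrightarrow> \<xi> n \<in> borel_measurable M"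
  using innov_indep by (simp add: indep_vars_def2)

lemmas X_measurable = H_measurable[OF F_idx X_H[OF _ order.refl]]
lemmas Y_measurable [measurable] = H_measurable[OF F_idx Y_H[OF order.refl]]
lemmas D_measurable [measurable] = H_measurable[OF T_idx D_H[OF order.refl]]
lemmas P_measurable [measurable] = H_measurable[OF T_idx P_H[OF order.refl]]
lemmas R_measurable [measurable] = H_measurable[OF F_idx R_H[OF order.refl]]
lemmas rt_measurable [measurable] = H_measurable[OF T_idx rt_H[OF order.refl]]

lemma D_nonneg: "0 \<le> D n i \<omega>" and D_le: "D n i \<omega> \<le> nu n"
proof -
  have *: "0 \<le> \<mu> k * of_bool (rt k \<omega> = i)" "\<mu> k * of_bool (rt k \<omega> = i) \<le> \<mu> k" if "k \<in> {1..n}" for k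
    using pos[of k] that by auto
  show "0 \<le> D n i \<omega>" "D n i \<omega> \<le> nu n"
    unfolding D_def nu_def by (rule sum_nonneg sum_mono, rule *, assumption)+
qed

lemma P_nonneg: "0 \<le> P j n \<omega>"
  unfolding P_def by (intro sum_nonneg zero_le_power D_nonneg)

lemma P_le: "P j n \<omega> \<le> real n * nu n ^ j"
  unfolding P_def using sum_bounded_above[of "{1..n}" "\<lambda>i. D n i \<omega> ^ j" "nu n ^ j"]
  by (simp add: power_mono D_le D_nonneg)

lemma P_integrable: "integrable M (P j n)"
  by (rule integrable_const_bound[of _ "real n * nu n ^ j"]) (auto simp: P_nonneg P_le)

lemma innov_moments:
  assumes "1 \<le> n"
  shows "integrable M (\<xi> n)" "expectation (\<xi> n) = 0"
    "integrable M (\<lambda>\<omega>. (\<xi> n \<omega>)\<^sup>2)" "expectation (\<lambda>\<omega>. (\<xi> n \<omega>)\<^sup>2) = 1"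
proof -
  have m: "\<xi> n \<in> borel_measurable M" "\<xi> 1 \<in> borel_measurable M" using assms by (auto intro: innov_measurable)
  have "integrable (distr M borel (\<xi> n)) (\<lambda>x. x)" "integrable (distr M borel (\<xi> n)) (\<lambda>x. x\<^sup>2)"
    "integral\<^sup>L (distr M borel (\<xi> n)) (\<lambda>x. x) = 0" "integral\<^sup>L (distr M borel (\<xi> n)) (\<lambda>x. x\<^sup>2) = 1"
    unfolding innov_ident[OF assms]
    using m innov_integrable sq_integrable innov_mean unit_variance
    by (simp_all add: integrable_distr_eq integral_distr)
  then show "integrable M (\<xi> n)" "expectation (\<xi> n) = 0"
    "integrable M (\<lambda>\<omega>. (\<xi> n \<omega>)\<^sup>2)" "expectation (\<lambda>\<omega>. (\<xi> n \<omega>)\<^sup>2) = 1"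
    using m by (simp_all add: integrable_distr_eq integral_distr)
qed

lemma recoll_expectation: "2 \<le> n \<Longrightarrow> expectation (\<lambda>\<omega>. of_bool (\<alpha> n \<omega>)) = p"
proof -
  assume n: "2 \<le> n"
  have [measurable]: "\<alpha> n \<in> measurable M (count_space UNIV)"
    using recoll_indep n by (simp add: indep_vars_def2)
  have "expectation (\<lambda>\<omega>. of_bool (\<alpha> n \<omega>)) = integral\<^sup>L (distr M (count_space UNIV) (\<alpha> n)) (of_bool :: bool \<Rightarrow> real)"
    by (subst integral_distr) auto
  also have "\<dots> = p" unfolding recoll_law[OF n] using p_range by simp
  finally show ?thesis .
qed

lemma recall_expectation:
  assumes "1 \<le> n" "1 \<le> k" "k \<le> n"
  shows "expectation (\<lambda>\<omega>. of_bool (\<beta> (Suc n) \<omega> = k)) = \<mu> k / nu n"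
proof -
  have [measurable]: "\<beta> (Suc n) \<in> measurable M (count_space UNIV)"
    using recall_indep assms by (simp add: indep_vars_def2)
  have "expectation (\<lambda>\<omega>. of_bool (\<beta> (Suc n) \<omega> = k)) = expectation (indicator {\<omega>\<in>space M. \<beta> (Suc n) \<omega> = k})"
    by (intro Bochner_Integration.integral_cong) (auto simp: indicator_def)
  also have "\<dots> = \<mu> k / nu n" using recall_law[of "Suc n" k] assms by (simp add: nu_def)
  finally show ?thesis .
qed

text \<open>The masses prescribed by \<open>recall_law\<close> on \<open>1..m - 1\<close> already
  add up to 1, so other values are null.\<close>

lemma recall_admissible: "AE \<omega> in M. \<forall>m\<ge>2. 1 \<le> \<beta> m \<omega> \<and> \<beta> m \<omega> < m"
proof -
  have "AE \<omega> in M. 1 \<le> \<beta> m \<omega> \<and> \<beta> m \<omega> < m" if m: "2 \<le> m" for m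
  proof -
    obtain n where n: "m = Suc n" "1 \<le> n" using m by (cases m) auto
    have [measurable]: "\<beta> m \<in> measurable M (count_space UNIV)"
      using recall_indep m by (simp add: indep_vars_def2)
    have "prob {\<omega>\<in>space M. \<beta> m \<omega> \<in> {1..n}} = (\<Sum>k\<in>{1..n}. prob {\<omega>\<in>space M. \<beta> m \<omega> = k})"
    proof -
      have "{\<omega>\<in>space M. \<beta> m \<omega> \<in> {1..n}} = (\<Union>k\<in>{1..n}. {\<omega>\<in>space M. \<beta> m \<omega> = k})" by auto
      moreover have "prob \<dots> = (\<Sum>k\<in>{1..n}. prob {\<omega>\<in>space M. \<beta> m \<omega> = k})"
        by (rule finite_measure_finite_Union) (auto simp: disjoint_family_on_def)
      ultimately show ?thesis by simp
    qed
    also have "\<dots> = (\<Sum>k\<in>{1..n}. \<mu> k / nu n)"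
      using recall_law[of m] m n by (intro sum.cong) (auto simp: nu_def)
    also have "\<dots> = 1" using nu_pos[OF n(2)] by (simp add: nu_def flip: sum_divide_distrib)
    finally have "AE \<omega> in M. \<omega> \<in> {\<omega>\<in>space M. \<beta> m \<omega> \<in> {1..n}}" by (subst (asm) prob_eq_1) auto
    then show ?thesis by eventually_elim (use n in auto)
  qed
  then show ?thesis by (subst AE_all_countable) (metis (mono_tags, lifting) AE_I2 AE_mp)
qed

lemma srrw_eq_AE: "AE \<omega> in M. \<forall>n. srrw \<xi> \<alpha> \<beta> n \<omega> = (\<Sum>k=1..n. X k \<omega>)"
  using recall_admissible
proof eventually_elim
  case (elim \<omega>)
  then show ?case
    unfolding srrw_def X_def rt_def by (intro allI sum.cong srrw_step_genealogy) auto
qed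


text \<open>Stands in for conditioning at time \<open>n\<close>: recollection and recall at time
  \<open>Suc n\<close> are independent of \<open>H (Fx n)\<close>. All innovations belong to
  \<open>Fx n\<close> so that \<open>c\<close> may involve the fresh
  \<open>\<xi> (Suc n)\<close>.\<close>

lemma one_step:
  assumes n: "1 \<le> n"
    and f: "\<And>k. 1 \<le> k \<Longrightarrow> k \<le> n \<Longrightarrow> f k \<in> borel_measurable (H (Fx n))" "\<And>k. 1 \<le> k \<Longrightarrow> k \<le> n \<Longrightarrow> integrable M (f k)"
    and c: "c \<in> borel_measurable (H (Fx n))" "integrable M c"
    and W: "\<And>\<omega>. W \<omega> = (if \<alpha> (Suc n) \<omega> \<and> 1 \<le> \<beta> (Suc n) \<omega> \<and> \<beta> (Suc n) \<omega> \<le> n then f (\<beta> (Suc n) \<omega>) \<omega> else c \<omega>)"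
  shows "integrable M W"
    "expectation W = (\<Sum>k=1..n. p * \<mu> k / nu n * expectation (f k)) + (1 - p) * expectation c"
proof -
  \<comment> \<open>Position \<open>n - 1\<close> of sequences 1 and 2 is time \<open>Suc n\<close>,
    as \<open>Z\<close> shifts them by 2.\<close>
  have ids: "{(1, n - 1)} \<subseteq> idx" "{(2, n - 1)} \<subseteq> idx" "{(1, n - 1)} \<inter> {(2, n - 1)} = ({} :: (nat \<times> nat) set)"
    by auto
  define e where "e k \<omega> = (of_bool (\<alpha> (Suc n) \<omega>) * of_bool (\<beta> (Suc n) \<omega> = k) :: real)" for k \<omega>
  have a: "(\<lambda>\<omega>. of_bool (\<alpha> (Suc n) \<omega>) :: real) \<in> borel_measurable (H K)" if "(1, n - 1) \<in> K" for K
    using recoll_H[of "Suc n" K] that n by (auto simp: numeral_2_eq_2)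
  have b: "(\<lambda>\<omega>. of_bool (\<beta> (Suc n) \<omega> = k) :: real) \<in> borel_measurable (H K)" if "(2, n - 1) \<in> K" for k K
  proof -
    have [measurable]: "\<beta> (Suc n) \<in> measurable (H K) (count_space UNIV)"
      using recall_H[of "Suc n" K] that n by (auto simp: numeral_2_eq_2)
    show ?thesis by measurable
  qed
  have ab_int: "integrable M (\<lambda>\<omega>. of_bool (\<alpha> (Suc n) \<omega>) :: real)" "integrable M (\<lambda>\<omega>. of_bool (\<beta> (Suc n) \<omega> = k) :: real)" for k
    by (rule integrable_const_bound[of _ 1]; use H_measurable[OF ids(1) a] H_measurable[OF ids(2) b] in simp)+
  have e_exp: "expectation (e k) = p * \<mu> k / nu n" and e_int: "integrable M (e k)" if "1 \<le> k" "k \<le> n" for k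
  proof -
    show "integrable M (e k)" unfolding e_def[abs_def]
      by (rule indep_H(2)[OF ids a _ b]) (use ab_int in auto)
    have "expectation (e k) = expectation (\<lambda>\<omega>. of_bool (\<alpha> (Suc n) \<omega>)) * expectation (\<lambda>\<omega>. of_bool (\<beta> (Suc n) \<omega> = k))"
      unfolding e_def[abs_def] by (rule indep_H(1)[OF ids a _ b]) (use ab_int in auto)
    then show "expectation (e k) = p * \<mu> k / nu n"
      using recoll_expectation[of "Suc n"] recall_expectation[OF n that] n by simp
  qed
  have disj: "Fx n \<inter> {1, 2} \<times> {n - 1} = {}" using n by (auto simp: Fx_def T_def)
  have e_H: "e k \<in> borel_measurable (H ({1, 2} \<times> {n - 1}))" for k
    unfolding e_def[abs_def] by (intro borel_measurable_times a b) auto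
  have N_idx: "{1, 2} \<times> {n - 1} \<subseteq> idx" by auto
  have fc: "expectation (\<lambda>\<omega>. (f k \<omega> - c \<omega>) * e k \<omega>) = (expectation (f k) - expectation c) * (p * \<mu> k / nu n)"
    and fc_int: "integrable M (\<lambda>\<omega>. (f k \<omega> - c \<omega>) * e k \<omega>)" if k: "1 \<le> k" "k \<le> n" for k
    using indep_H[OF Fx_idx N_idx disj _ _ e_H e_int[OF k], of "\<lambda>\<omega>. f k \<omega> - c \<omega>"] f[OF k] c e_exp[OF k]
    by simp_all
  \<comment> \<open>The case distinction turns into a sum of products of independent factors: at
    most one \<open>e k \<omega>\<close> is 1, and none in the range when nothing admissible is
    recalled.\<close>
  have W_eq: "W \<omega> = c \<omega> + (\<Sum>k=1..n. (f k \<omega> - c \<omega>) * e k \<omega>)" for \<omega>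
  proof (cases "\<alpha> (Suc n) \<omega> \<and> 1 \<le> \<beta> (Suc n) \<omega> \<and> \<beta> (Suc n) \<omega> \<le> n")
    case True
    have "(\<Sum>k=1..n. (f k \<omega> - c \<omega>) * e k \<omega>) = (\<Sum>k\<in>{\<beta> (Suc n) \<omega>}. f k \<omega> - c \<omega>)"
      using True by (intro sum.mono_neutral_cong_right) (auto simp: e_def)
    then show ?thesis using True W by simp
  next
    case False
    then have "(\<Sum>k=1..n. (f k \<omega> - c \<omega>) * e k \<omega>) = 0"
      by (intro sum.neutral) (auto simp: e_def)
    then show ?thesis using W[of \<omega>] unfolding if_not_P[OF False] by simp
  qed
  have si: "integrable M (\<lambda>\<omega>. \<Sum>k=1..n. (f k \<omega> - c \<omega>) * e k \<omega>)"
    by (intro Bochner_Integration.integrable_sum fc_int) auto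
  show "integrable M W" unfolding W_eq[abs_def] using c si by simp
  have "expectation W = expectation c + (\<Sum>k=1..n. expectation (\<lambda>\<omega>. (f k \<omega> - c \<omega>) * e k \<omega>))"
    unfolding W_eq[abs_def] using c si fc_int by (simp add: Bochner_Integration.integral_sum)
  also have "\<dots> = expectation c + (\<Sum>k=1..n. p * \<mu> k / nu n * expectation (f k) - p * \<mu> k / nu n * expectation c)"
    by (intro arg_cong2[where f = "(+)"] sum.cong refl) (subst fc, auto simp: right_diff_distrib diff_divide_distrib mult_ac)
  also have "\<dots> = expectation c + ((\<Sum>k=1..n. p * \<mu> k / nu n * expectation (f k)) - (\<Sum>k=1..n. p * \<mu> k / nu n) * expectation c)"
    by (simp add: sum_subtractf sum_distrib_right)
  also have "(\<Sum>k=1..n. p * \<mu> k / nu n) = p"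
    using nu_pos[OF n] by (simp add: nu_def flip: sum_divide_distrib sum_distrib_left)
  finally show "expectation W = (\<Sum>k=1..n. p * \<mu> k / nu n * expectation (f k)) + (1 - p) * expectation c"
    by (simp add: algebra_simps)
qed

text \<open>Sort the times \<open>k\<close> by their root \<open>i\<close>: the weights
  \<open>\<mu> k\<close> in a cluster add up to one more factor
  \<open>D n i \<omega>\<close>.\<close>

lemma sum_weighted_D: "(\<Sum>k=1..n. \<mu> k * D n (rt k \<omega>) \<omega> ^ j) = P (Suc j) n \<omega>"
proof -
  have "(\<Sum>k=1..n. \<mu> k * D n (rt k \<omega>) \<omega> ^ j) = (\<Sum>k=1..n. \<Sum>i=1..n. \<mu> k * of_bool (rt k \<omega> = i) * D n i \<omega> ^ j)"
  proof (intro sum.cong refl)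
    fix k assume k: "k \<in> {1..n}"
    then have "rt k \<omega> \<in> {1..n}" using rt_le[of k \<omega>] rt_ge[of k \<omega>] by auto
    then have "(\<Sum>i=1..n. \<mu> k * of_bool (rt k \<omega> = i) * D n i \<omega> ^ j) = (\<Sum>i\<in>{rt k \<omega>}. \<mu> k * D n i \<omega> ^ j)"
      by (intro sum.mono_neutral_cong_right) auto
    then show "\<mu> k * D n (rt k \<omega>) \<omega> ^ j = (\<Sum>i=1..n. \<mu> k * of_bool (rt k \<omega> = i) * D n i \<omega> ^ j)" by simp
  qed
  also have "\<dots> = (\<Sum>i=1..n. \<Sum>k=1..n. \<mu> k * of_bool (rt k \<omega> = i) * D n i \<omega> ^ j)"
    by (rule sum.swap)
  also have "\<dots> = P (Suc j) n \<omega>"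
    unfolding P_def by (intro sum.cong refl) (simp only: power_Suc sum_distrib_right[symmetric] D_def[symmetric])
  finally show ?thesis .
qed

text \<open>Resolves the random index into a finite sum, for measurability.\<close>

lemma D_rt_eq: "k \<le> n \<Longrightarrow> D n (rt k \<omega>) \<omega> = (\<Sum>i\<le>n. of_bool (rt k \<omega> = i) * D n i \<omega>)"
proof -
  assume "k \<le> n"
  then have "rt k \<omega> \<in> {..n}" using rt_le[of k \<omega>] by simp
  then have "(\<Sum>i\<le>n. of_bool (rt k \<omega> = i) * D n i \<omega>) = (\<Sum>i\<in>{rt k \<omega>}. D n i \<omega>)"
    by (intro sum.mono_neutral_cong_right) auto
  then show ?thesis by simp
qed

lemma D_rt_H: "k \<le> n \<Longrightarrow> (\<lambda>\<omega>. D n (rt k \<omega>) \<omega>) \<in> borel_measurable (H (T n))"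
  unfolding D_rt_eq by (intro borel_measurable_sum borel_measurable_times rt_H_of_bool D_H) auto

text \<open>A new step joins the cluster of time \<open>k\<close> with probability \<open>p * \<mu> k / nu n\<close>, so averages over the
  joined cluster are size-biased and turn into power sums of the cluster weights.\<close>

lemma tree_step:
  assumes n: "1 \<le> n"
    and u: "u0 \<in> borel_measurable (H (T n))" "u1 \<in> borel_measurable (H (T n))" "u2 \<in> borel_measurable (H (T n))"
      "integrable M u0" "integrable M u1" "integrable M u2"
    and W: "\<And>\<omega>. W \<omega> = u0 \<omega> + (if \<alpha> (Suc n) \<omega> \<and> 1 \<le> \<beta> (Suc n) \<omega> \<and> \<beta> (Suc n) \<omega> \<le> n
        then u1 \<omega> * D n (rt (\<beta> (Suc n) \<omega>) \<omega>) \<omega> + u2 \<omega> * (D n (rt (\<beta> (Suc n) \<omega>) \<omega>) \<omega>)\<^sup>2 else 0)"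
  shows "expectation W = expectation u0
      + p / nu n * (expectation (\<lambda>\<omega>. u1 \<omega> * P 2 n \<omega>) + expectation (\<lambda>\<omega>. u2 \<omega> * P 3 n \<omega>))"
proof -
  note H_M = H_measurable[OF T_idx]
  \<comment> \<open>The value of \<open>W\<close> if time \<open>k\<close> is recalled. Its
    \<open>\<mu>\<close>-weighted sum over \<open>k\<close> is evaluated by
    \<open>sum_weighted_D\<close>.\<close>
  define f where "f k \<omega> = u0 \<omega> + (u1 \<omega> * D n (rt k \<omega>) \<omega> + u2 \<omega> * (D n (rt k \<omega>) \<omega>)\<^sup>2)" for k \<omega>
  have i1: "integrable M (\<lambda>\<omega>. u1 \<omega> * D n (rt k \<omega>) \<omega>)" and i2: "integrable M (\<lambda>\<omega>. u2 \<omega> * (D n (rt k \<omega>) \<omega>)\<^sup>2)"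
    if "k \<le> n" for k
  proof -
    have m: "(\<lambda>\<omega>. D n (rt k \<omega>) \<omega>) \<in> borel_measurable M" by (rule H_M[OF D_rt_H[OF that]])
    show "integrable M (\<lambda>\<omega>. u1 \<omega> * D n (rt k \<omega>) \<omega>)"
      by (rule integrable_mult_bounded[of _ _ _ "nu n"]) (use u m D_le D_nonneg in auto)
    show "integrable M (\<lambda>\<omega>. u2 \<omega> * (D n (rt k \<omega>) \<omega>)\<^sup>2)"
      by (rule integrable_mult_bounded[of _ _ _ "(nu n)\<^sup>2"]) (use u m D_le D_nonneg in \<open>auto intro: power_mono\<close>)
  qed
  have f: "f k \<in> borel_measurable (H (Fx n))" "integrable M (f k)" if "1 \<le> k" "k \<le> n" for k
  proof -
    show "f k \<in> borel_measurable (H (Fx n))" unfolding f_def[abs_def]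
      by (rule H_mono[OF T_Fx]) (intro borel_measurable_add borel_measurable_times borel_measurable_power u D_rt_H that)
    show "integrable M (f k)" unfolding f_def[abs_def] using u i1 i2 that by simp
  qed
  have "expectation W = (\<Sum>k=1..n. p * \<mu> k / nu n * expectation (f k)) + (1 - p) * expectation u0"
    by (rule one_step(2)[OF n f H_mono[OF T_Fx u(1)] u(4)]) (simp_all add: W f_def)
  also have "(\<Sum>k=1..n. p * \<mu> k / nu n * expectation (f k)) = p / nu n * (\<Sum>k=1..n. \<mu> k * expectation (f k))"
    by (simp add: sum_distrib_left mult_ac)
  also have "(\<Sum>k=1..n. \<mu> k * expectation (f k)) = (\<Sum>k=1..n. expectation (\<lambda>\<omega>. \<mu> k * f k \<omega>))" by simp
  also have "\<dots> = expectation (\<lambda>\<omega>. \<Sum>k=1..n. \<mu> k * f k \<omega>)"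
    using f by (subst Bochner_Integration.integral_sum) auto
  also have "(\<lambda>\<omega>. \<Sum>k=1..n. \<mu> k * f k \<omega>) = (\<lambda>\<omega>. nu n * u0 \<omega> + (u1 \<omega> * P 2 n \<omega> + u2 \<omega> * P 3 n \<omega>))"
  proof
    fix \<omega>
    have "(\<Sum>k=1..n. \<mu> k * f k \<omega>) = (\<Sum>k=1..n. \<mu> k) * u0 \<omega>
        + (u1 \<omega> * (\<Sum>k=1..n. \<mu> k * D n (rt k \<omega>) \<omega> ^ 1) + u2 \<omega> * (\<Sum>k=1..n. \<mu> k * D n (rt k \<omega>) \<omega> ^ 2))"
      by (simp add: f_def sum_distrib_left sum_distrib_right sum.distrib algebra_simps)
    then show "(\<Sum>k=1..n. \<mu> k * f k \<omega>) = nu n * u0 \<omega> + (u1 \<omega> * P 2 n \<omega> + u2 \<omega> * P 3 n \<omega>)"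
      unfolding sum_weighted_D by (simp add: nu_def numeral_2_eq_2 numeral_3_eq_3)
  qed
  also have "expectation \<dots> = nu n * expectation u0 + (expectation (\<lambda>\<omega>. u1 \<omega> * P 2 n \<omega>) + expectation (\<lambda>\<omega>. u2 \<omega> * P 3 n \<omega>))"
  proof -
    have "integrable M (\<lambda>\<omega>. u1 \<omega> * P 2 n \<omega>)" "integrable M (\<lambda>\<omega>. u2 \<omega> * P 3 n \<omega>)"
      using integrable_mult_bounded[OF u(5) P_measurable, of 2 n "real n * nu n ^ 2"]
        integrable_mult_bounded[OF u(6) P_measurable, of 3 n "real n * nu n ^ 3"]
      by (simp_all add: P_nonneg P_le)
    then show ?thesis using u by simp
  qed
  finally show ?thesis using nu_pos[OF n] by (simp add: field_simps)
qed

text \<open>Only the cluster joined at time \<open>Suc n\<close> changes; \<open>d\<close> is its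
  previous weight, which is 0 for a newly opened cluster.\<close>

lemma P_Suc:
  assumes "1 \<le> n" "1 \<le> j"
  defines "d \<equiv> \<lambda>\<omega>. if \<alpha> (Suc n) \<omega> \<and> 1 \<le> \<beta> (Suc n) \<omega> \<and> \<beta> (Suc n) \<omega> \<le> n then D n (rt (\<beta> (Suc n) \<omega>) \<omega>) \<omega> else 0"
  shows "P j (Suc n) \<omega> = P j n \<omega> + (d \<omega> + \<mu> (Suc n)) ^ j - d \<omega> ^ j"
proof -
  let ?r = "rt (Suc n) \<omega>"
  \<comment> \<open>No time up to \<open>n\<close> has root \<open>Suc n\<close>, so a new cluster
    had weight 0 and both cases of \<open>d\<close> read \<open>D n ?r \<omega>\<close>.\<close>
  have z: "D n (Suc n) \<omega> = 0"
    unfolding D_def using rt_le by (intro sum.neutral) (auto, metis Suc_n_not_le_n order_trans)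
  have d: "d \<omega> = D n ?r \<omega>"
    unfolding d_def by (subst rt_eq[of "Suc n"]) (auto simp: z less_Suc_eq_le)
  have r: "?r \<in> {1..Suc n}" using rt_le[of "Suc n" \<omega>] rt_ge[of "Suc n" \<omega>] by simp
  have "P j (Suc n) \<omega> = (\<Sum>i=1..Suc n. (D n i \<omega> + \<mu> (Suc n) * of_bool (?r = i)) ^ j)"
    unfolding P_def by (simp add: D_def)
  also have "\<dots> = (D n ?r \<omega> + \<mu> (Suc n)) ^ j + (\<Sum>i\<in>{1..Suc n} - {?r}. (D n i \<omega> + \<mu> (Suc n) * of_bool (?r = i)) ^ j)"
    using r by (subst sum.remove[of _ ?r]) auto
  also have "(\<Sum>i\<in>{1..Suc n} - {?r}. (D n i \<omega> + \<mu> (Suc n) * of_bool (?r = i)) ^ j) = (\<Sum>i\<in>{1..Suc n} - {?r}. D n i \<omega> ^ j)"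
    by (intro sum.cong) auto
  also have "\<dots> = (\<Sum>i=1..Suc n. D n i \<omega> ^ j) - D n ?r \<omega> ^ j"
    using r by (subst sum_diff1) auto
  also have "(\<Sum>i=1..Suc n. D n i \<omega> ^ j) = P j n \<omega>"
    using assms(2) by (simp add: P_def z)
  finally show ?thesis unfolding d by simp
qed

text \<open>Each right-hand side is a polynomial of degree two in \<open>d\<close> with coefficients
  known at time \<open>n\<close>, the shape that \<open>tree_step\<close> expects; hence the summand
  \<open>0 * d\<^sup>2\<close>.\<close>

lemma power_steps:
  fixes n :: nat and \<omega> :: 'a
  assumes n: "1 \<le> n"
  defines "b \<equiv> \<alpha> (Suc n) \<omega> \<and> 1 \<le> \<beta> (Suc n) \<omega> \<and> \<beta> (Suc n) \<omega> \<le> n"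
    and "d \<equiv> D n (rt (\<beta> (Suc n) \<omega>) \<omega>) \<omega>" and "m \<equiv> \<mu> (Suc n)"
  shows "P 2 (Suc n) \<omega> = P 2 n \<omega> + m\<^sup>2 + (if b then 2 * m * d + 0 * d\<^sup>2 else 0)"
    "P 3 (Suc n) \<omega> = P 3 n \<omega> + m ^ 3 + (if b then 3 * m\<^sup>2 * d + 3 * m * d\<^sup>2 else 0)"
    "(P 2 (Suc n) \<omega>)\<^sup>2 = (P 2 n \<omega> + m\<^sup>2)\<^sup>2 + (if b then 4 * m * (P 2 n \<omega> + m\<^sup>2) * d + 4 * m\<^sup>2 * d\<^sup>2 else 0)"
proof -
  have "P j (Suc n) \<omega> = (if b then P j n \<omega> + (d + m) ^ j - d ^ j else P j n \<omega> + m ^ j)" if "1 \<le> j" for j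
    using P_Suc[OF n that, of \<omega>, folded b_def d_def m_def] that by (cases b) simp_all
  note * = this[of 2] this[of 3]
  show "P 2 (Suc n) \<omega> = P 2 n \<omega> + m\<^sup>2 + (if b then 2 * m * d + 0 * d\<^sup>2 else 0)"
    "P 3 (Suc n) \<omega> = P 3 n \<omega> + m ^ 3 + (if b then 3 * m\<^sup>2 * d + 3 * m * d\<^sup>2 else 0)"
    "(P 2 (Suc n) \<omega>)\<^sup>2 = (P 2 n \<omega> + m\<^sup>2)\<^sup>2 + (if b then 4 * m * (P 2 n \<omega> + m\<^sup>2) * d + 4 * m\<^sup>2 * d\<^sup>2 else 0)"
    by (cases b; simp add: * power2_eq_square power3_eq_cube algebra_simps)+
qed

lemma P_0 [simp]: "P j 0 \<omega> = 0" by (simp add: P_def)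

lemma P_1: "P j (Suc 0) \<omega> = \<mu> 1 ^ j"
proof -
  have "rt 1 \<omega> = 1" using rt_le[of 1 \<omega>] rt_ge[of 1 \<omega>] by simp
  then show ?thesis by (simp add: P_def D_def)
qed

lemma x_0 [simp]: "x 0 = 0" by (simp add: x_def)

lemma expectation_P2: "expectation (P 2 n) = q n"
proof (induction n)
  case (Suc n)
  show ?case
  proof (cases "n = 0")
    case True
    then show ?thesis using prob_space by (simp add: P_1[abs_def])
  next
    case False
    let ?m = "\<mu> (Suc n)"
    have "expectation (P 2 (Suc n)) = expectation (\<lambda>\<omega>. P 2 n \<omega> + ?m\<^sup>2)
        + p / nu n * (expectation (\<lambda>\<omega>. 2 * ?m * P 2 n \<omega>) + expectation (\<lambda>\<omega>. 0 * P 3 n \<omega>))"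
      proof (rule tree_step)
      show "P 2 (Suc n) \<omega> = P 2 n \<omega> + ?m\<^sup>2 + (if \<alpha> (Suc n) \<omega> \<and> 1 \<le> \<beta> (Suc n) \<omega> \<and> \<beta> (Suc n) \<omega> \<le> n
        then 2 * ?m * D n (rt (\<beta> (Suc n) \<omega>) \<omega>) \<omega> + 0 * (D n (rt (\<beta> (Suc n) \<omega>) \<omega>) \<omega>)\<^sup>2 else 0)" for \<omega>
        by (rule power_steps) (use False in simp)
    qed (use False P_H P_integrable in auto)
    also have "\<dots> = q n + ?m\<^sup>2 + p / nu n * (2 * ?m * q n)"
      using Suc prob_space by (simp add: P_integrable)
    finally show ?thesis by (simp add: x_def field_simps)
  qed
qed simp

lemma expectation_P3:
  "expectation (P 3 (Suc n)) = (1 + 3 * p * x n) * expectation (P 3 n)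
    + (3 * p * \<mu> (Suc n) * x n * q n + \<mu> (Suc n) ^ 3)"
proof (cases "n = 0")
  case True
  have "P 3 0 = (\<lambda>_. 0)" by auto
  then show ?thesis using True prob_space by (simp add: P_1[abs_def])
next
  case False
  let ?m = "\<mu> (Suc n)"
  have "expectation (P 3 (Suc n)) = expectation (\<lambda>\<omega>. P 3 n \<omega> + ?m ^ 3)
      + p / nu n * (expectation (\<lambda>\<omega>. 3 * ?m\<^sup>2 * P 2 n \<omega>) + expectation (\<lambda>\<omega>. 3 * ?m * P 3 n \<omega>))"
  proof (rule tree_step)
    show "P 3 (Suc n) \<omega> = P 3 n \<omega> + ?m ^ 3 + (if \<alpha> (Suc n) \<omega> \<and> 1 \<le> \<beta> (Suc n) \<omega> \<and> \<beta> (Suc n) \<omega> \<le> n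
      then 3 * ?m\<^sup>2 * D n (rt (\<beta> (Suc n) \<omega>) \<omega>) \<omega> + 3 * ?m * (D n (rt (\<beta> (Suc n) \<omega>) \<omega>) \<omega>)\<^sup>2 else 0)" for \<omega>
      by (rule power_steps) (use False in simp)
  qed (use False P_H P_integrable in auto)
  also have "\<dots> = expectation (P 3 n) + ?m ^ 3 + p / nu n * (3 * ?m\<^sup>2 * q n + 3 * ?m * expectation (P 3 n))"
    using prob_space by (simp add: P_integrable expectation_P2)
  finally show ?thesis by (simp add: x_def field_simps power2_eq_square add_divide_distrib)
qed

definition var_P :: "nat \<Rightarrow> real" where "var_P n = expectation (\<lambda>\<omega>. (P 2 n \<omega>)\<^sup>2) - (q n)\<^sup>2"

lemma P_square_integrable: "integrable M (\<lambda>\<omega>. (P 2 n \<omega>)\<^sup>2)"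
  by (rule integrable_const_bound[of _ "(real n * nu n ^ 2)\<^sup>2"]) (auto intro!: power_mono simp: P_nonneg P_le)

lemma var_P_eq: "var_P n = expectation (\<lambda>\<omega>. (P 2 n \<omega> - q n)\<^sup>2)"
  unfolding var_P_def using variance_eq[OF P_integrable P_square_integrable] by (simp add: expectation_P2)

lemma var_P_nonneg: "0 \<le> var_P n"
  unfolding var_P_eq by (intro integral_nonneg_AE) simp

text \<open>When the squared mean is subtracted, the terms free of the variance and of
  \<open>P 3\<close> cancel up to \<open>- 4 * (p * x n * q n)\<^sup>2\<close>, which is
  dropped.\<close>

lemma var_P_Suc: "var_P (Suc n) \<le> (1 + 4 * p * x n) * var_P n + 4 * p * \<mu> (Suc n) * x n * expectation (P 3 n)"
proof (cases "n = 0")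
  case True
  then show ?thesis using prob_space by (simp add: P_1[abs_def] var_P_def)
next
  case False
  let ?m = "\<mu> (Suc n)"
  define V where "V = expectation (\<lambda>\<omega>. (P 2 n \<omega>)\<^sup>2)"
  have "expectation (\<lambda>\<omega>. (P 2 (Suc n) \<omega>)\<^sup>2) = expectation (\<lambda>\<omega>. (P 2 n \<omega> + ?m\<^sup>2)\<^sup>2)
      + p / nu n * (expectation (\<lambda>\<omega>. 4 * ?m * (P 2 n \<omega> + ?m\<^sup>2) * P 2 n \<omega>) + expectation (\<lambda>\<omega>. 4 * ?m\<^sup>2 * P 3 n \<omega>))"
  proof (rule tree_step)
    show "(P 2 (Suc n) \<omega>)\<^sup>2 = (P 2 n \<omega> + ?m\<^sup>2)\<^sup>2 + (if \<alpha> (Suc n) \<omega> \<and> 1 \<le> \<beta> (Suc n) \<omega> \<and> \<beta> (Suc n) \<omega> \<le> n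
      then 4 * ?m * (P 2 n \<omega> + ?m\<^sup>2) * D n (rt (\<beta> (Suc n) \<omega>) \<omega>) \<omega> + 4 * ?m\<^sup>2 * (D n (rt (\<beta> (Suc n) \<omega>) \<omega>) \<omega>)\<^sup>2 else 0)" for \<omega>
      by (rule power_steps) (use False in simp)
    show "integrable M (\<lambda>\<omega>. (P 2 n \<omega> + ?m\<^sup>2)\<^sup>2)"
      by (rule integrable_add_square) (use P_square_integrable in auto)
    show "(\<lambda>\<omega>. (P 2 n \<omega> + ?m\<^sup>2)\<^sup>2) \<in> borel_measurable (H (T n))"
      "(\<lambda>\<omega>. 4 * ?m * (P 2 n \<omega> + ?m\<^sup>2)) \<in> borel_measurable (H (T n))"
      by (intro borel_measurable_power borel_measurable_add borel_measurable_times P_H borel_measurable_const order.refl)+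
  qed (use False P_integrable in auto)
  also have "expectation (\<lambda>\<omega>. (P 2 n \<omega> + ?m\<^sup>2)\<^sup>2) = V + 2 * ?m\<^sup>2 * q n + ?m ^ 4"
  proof -
    have "expectation (\<lambda>\<omega>. (P 2 n \<omega> + ?m\<^sup>2)\<^sup>2) = expectation (\<lambda>\<omega>. (P 2 n \<omega>)\<^sup>2 + 2 * ?m\<^sup>2 * P 2 n \<omega> + ?m ^ 4)"
      by (intro Bochner_Integration.integral_cong) (simp_all add: power2_eq_square power4_eq_xxxx algebra_simps)
    then show ?thesis using prob_space by (simp add: P_integrable P_square_integrable expectation_P2 V_def)
  qed
  also have "expectation (\<lambda>\<omega>. 4 * ?m * (P 2 n \<omega> + ?m\<^sup>2) * P 2 n \<omega>) = 4 * ?m * V + 4 * ?m ^ 3 * q n"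
  proof -
    have "expectation (\<lambda>\<omega>. 4 * ?m * (P 2 n \<omega> + ?m\<^sup>2) * P 2 n \<omega>) = expectation (\<lambda>\<omega>. 4 * ?m * (P 2 n \<omega>)\<^sup>2 + 4 * ?m ^ 3 * P 2 n \<omega>)"
      by (intro Bochner_Integration.integral_cong) (simp_all add: power2_eq_square power3_eq_cube algebra_simps)
    then show ?thesis by (simp add: P_integrable P_square_integrable expectation_P2 V_def)
  qed
  also have "expectation (\<lambda>\<omega>. 4 * ?m\<^sup>2 * P 3 n \<omega>) = 4 * ?m\<^sup>2 * expectation (P 3 n)" by simp
  finally have "expectation (\<lambda>\<omega>. (P 2 (Suc n) \<omega>)\<^sup>2) = V + 2 * ?m\<^sup>2 * q n + ?m ^ 4
      + p / nu n * (4 * ?m * V + 4 * ?m ^ 3 * q n + 4 * ?m\<^sup>2 * expectation (P 3 n))" .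
  also have "\<dots> = V + 2 * ?m\<^sup>2 * q n + ?m ^ 4 + 4 * p * x n * V + 4 * p * x n * ?m\<^sup>2 * q n + 4 * p * x n * ?m * expectation (P 3 n)"
    by (simp add: x_def field_simps power2_eq_square power3_eq_cube add_divide_distrib)
  also have "\<dots> = (1 + 4 * p * x n) * var_P n + 4 * p * ?m * x n * expectation (P 3 n) + (q (Suc n))\<^sup>2 - 4 * (p * x n * q n)\<^sup>2"
    unfolding var_P_def V_def[symmetric] by (simp add: power2_eq_square power4_eq_xxxx algebra_simps)
  finally have "expectation (\<lambda>\<omega>. (P 2 (Suc n) \<omega>)\<^sup>2) - (q (Suc n))\<^sup>2
      = (1 + 4 * p * x n) * var_P n + 4 * p * ?m * x n * expectation (P 3 n) - 4 * (p * x n * q n)\<^sup>2" by linarith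
  then show ?thesis unfolding var_P_def[of "Suc n"] by simp
qed

lemma P3_bound: "\<exists>C\<ge>0. \<forall>n. expectation (P 3 n) \<le> C * amp n ^ 3"
  by (rule third_moment_bound) (simp_all only: expectation_P3 order.refl, auto intro!: integral_nonneg_AE simp: P_nonneg)

lemma var_P_bound: "\<exists>C\<ge>0. \<forall>n. var_P n \<le> C * amp n ^ 4"
proof -
  obtain C where C: "C \<ge> 0" "\<And>n. expectation (P 3 n) \<le> C * amp n ^ 3" using P3_bound by blast
  show ?thesis
    by (rule variance_bound[OF var_P_nonneg _ C(2,1) var_P_Suc]) (auto intro!: integral_nonneg_AE simp: P_nonneg)
qed


section \<open>The martingales \<open>MM\<close> and \<open>R\<close>\<close>

lemma X_square_integrable:
  assumes "1 \<le> n" shows "integrable M (\<lambda>\<omega>. (X n \<omega>)\<^sup>2)"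
proof (rule Bochner_Integration.integrable_bound)
  show "integrable M (\<lambda>\<omega>. \<Sum>i=1..n. (\<xi> i \<omega>)\<^sup>2)"
    by (intro Bochner_Integration.integrable_sum innov_moments) auto
  have "(X n \<omega>)\<^sup>2 \<le> (\<Sum>i=1..n. (\<xi> i \<omega>)\<^sup>2)" for \<omega>
    unfolding X_def using rt_le[of n \<omega>] rt_ge[OF assms, of \<omega>] by (intro member_le_sum) auto
  moreover have "0 \<le> (\<Sum>i=1..n. (\<xi> i \<omega>)\<^sup>2)" for \<omega> by (intro sum_nonneg) simp
  ultimately show "AE \<omega> in M. norm ((X n \<omega>)\<^sup>2) \<le> norm (\<Sum>i=1..n. (\<xi> i \<omega>)\<^sup>2)" by auto
qed (use X_measurable[OF assms] in simp)

lemma Y_square_integrable: "integrable M (\<lambda>\<omega>. (Y n \<omega>)\<^sup>2)"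
  unfolding Y_def
proof (intro integrable_sum_square)
  fix k assume "k \<in> {1..n}"
  then show "(\<lambda>\<omega>. \<mu> k * X k \<omega>) \<in> borel_measurable M" "integrable M (\<lambda>\<omega>. (\<mu> k * X k \<omega>)\<^sup>2)"
    using X_measurable[of k] X_square_integrable[of k] by (simp_all add: power_mult_distrib)
qed

lemma R_square_integrable: "integrable M (\<lambda>\<omega>. (R n \<omega>)\<^sup>2)"
proof -
  have 1: "integrable M (\<lambda>\<omega>. (\<Sum>k=1..n. X k \<omega>)\<^sup>2)"
    by (intro integrable_sum_square) (use X_measurable X_square_integrable in auto)
  have 2: "integrable M (\<lambda>\<omega>. (\<Sum>k=1..<n. - (p * Y k \<omega> / nu k))\<^sup>2)"
    by (intro integrable_sum_square) (use Y_square_integrable in \<open>auto simp: power_mult_distrib power_divide\<close>)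
  have "integrable M (\<lambda>\<omega>. ((\<Sum>k=1..n. X k \<omega>) + (\<Sum>k=1..<n. - (p * Y k \<omega> / nu k)))\<^sup>2)"
    by (rule integrable_add_square[OF _ _ 1 2]) (use X_measurable in auto)
  then show ?thesis by (simp add: R_def sum_negf)
qed

lemma X_Suc: "X (Suc n) \<omega> = (if \<alpha> (Suc n) \<omega> \<and> 1 \<le> \<beta> (Suc n) \<omega> \<and> \<beta> (Suc n) \<omega> \<le> n
    then X (\<beta> (Suc n) \<omega>) \<omega> else \<xi> (Suc n) \<omega>)"
  unfolding X_def by (subst rt_eq) (simp add: less_Suc_eq_le)

lemma X_1: "X 1 = \<xi> 1"
proof
  fix \<omega> have "rt 1 \<omega> = 1" using rt_le[of 1 \<omega>] rt_ge[of 1 \<omega>] by simp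
  then show "X 1 \<omega> = \<xi> 1 \<omega>" by (simp add: X_def)
qed

lemma expectation_innov:
  assumes h: "h \<in> borel_measurable (H (F n))" "integrable M (\<lambda>\<omega>. (h \<omega>)\<^sup>2)"
  shows "expectation (\<lambda>\<omega>. h \<omega> * \<xi> (Suc n) \<omega>) = 0"
proof -
  have "integrable M h" by (rule integrable_of_square[OF H_measurable[OF F_idx h(1)] h(2)])
  then have "expectation (\<lambda>\<omega>. h \<omega> * \<xi> (Suc n) \<omega>) = expectation h * expectation (\<xi> (Suc n))"
    by (intro indep_H(1)[OF F_idx _ _ h(1) _ innov_H[of _ "{(0, n)}"]])
      (auto simp: F_def T_def innov_moments)
  then show ?thesis by (simp add: innov_moments)
qed

text \<open>The tested form of the conditional mean \<open>p * Y n / nu n\<close> of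
  \<open>X (Suc n)\<close>: a recalled step averages the earlier ones with weights
  \<open>\<mu> k\<close>, and a fresh innovation contributes nothing.\<close>

lemma expectation_step:
  assumes h: "h \<in> borel_measurable (H (F n))" "integrable M (\<lambda>\<omega>. (h \<omega>)\<^sup>2)"
  shows "expectation (\<lambda>\<omega>. h \<omega> * X (Suc n) \<omega>) = p / nu n * expectation (\<lambda>\<omega>. h \<omega> * Y n \<omega>)"
proof (cases "n = 0")
  case True
  then show ?thesis using expectation_innov[OF h] X_1 by (simp add: Y_def)
next
  case False
  then have n: "1 \<le> n" by simp
  have hM: "h \<in> borel_measurable M" by (rule H_measurable[OF F_idx h(1)])
  have hX: "integrable M (\<lambda>\<omega>. h \<omega> * X k \<omega>)" if "1 \<le> k" for k
    by (rule integrable_mult_L2[OF hM X_measurable h(2) X_square_integrable]) (use that in auto)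
  have "expectation (\<lambda>\<omega>. h \<omega> * X (Suc n) \<omega>)
      = (\<Sum>k=1..n. p * \<mu> k / nu n * expectation (\<lambda>\<omega>. h \<omega> * X k \<omega>)) + (1 - p) * expectation (\<lambda>\<omega>. h \<omega> * \<xi> (Suc n) \<omega>)"
  proof (rule one_step(2)[OF n])
    fix k assume k: "1 \<le> k" "k \<le> n"
    show "(\<lambda>\<omega>. h \<omega> * X k \<omega>) \<in> borel_measurable (H (Fx n))"
      by (rule H_mono[OF F_Fx]) (intro borel_measurable_times h X_H k)
    show "integrable M (\<lambda>\<omega>. h \<omega> * X k \<omega>)" by (rule hX) fact
  next
    show "(\<lambda>\<omega>. h \<omega> * \<xi> (Suc n) \<omega>) \<in> borel_measurable (H (Fx n))"
      by (intro borel_measurable_times H_mono[OF F_Fx h(1)] innov_H) (auto simp: Fx_def)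
    show "integrable M (\<lambda>\<omega>. h \<omega> * \<xi> (Suc n) \<omega>)"
      by (rule integrable_mult_L2[OF hM _ h(2)]) (auto intro: innov_measurable innov_moments)
  qed (simp add: X_Suc)
  also have "\<dots> = p / nu n * (\<Sum>k=1..n. expectation (\<lambda>\<omega>. \<mu> k * (h \<omega> * X k \<omega>)))"
    by (simp add: expectation_innov[OF h] sum_distrib_left mult_ac)
  also have "(\<Sum>k=1..n. expectation (\<lambda>\<omega>. \<mu> k * (h \<omega> * X k \<omega>))) = expectation (\<lambda>\<omega>. h \<omega> * Y n \<omega>)"
    using hX by (subst Bochner_Integration.integral_sum[symmetric]) (auto simp: Y_def sum_distrib_left mult_ac)
  finally show ?thesis .
qed

text \<open>A step copies an earlier one or is a fresh innovation, so by induction its second moment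
  is an average of ones.\<close>

lemma X_second_moment: "1 \<le> n \<Longrightarrow> expectation (\<lambda>\<omega>. (X n \<omega>)\<^sup>2) = 1"
proof (induction n rule: less_induct)
  case (less m)
  show ?case
  proof (cases "m = 1")
    case True
    then show ?thesis using innov_moments[of 1] X_1 by simp
  next
    case False
    with less.prems obtain n where m: "m = Suc n" and n: "1 \<le> n" by (cases m) auto
    have "expectation (\<lambda>\<omega>. (X (Suc n) \<omega>)\<^sup>2)
        = (\<Sum>k=1..n. p * \<mu> k / nu n * expectation (\<lambda>\<omega>. (X k \<omega>)\<^sup>2)) + (1 - p) * expectation (\<lambda>\<omega>. (\<xi> (Suc n) \<omega>)\<^sup>2)"
    proof (rule one_step(2)[OF n])
      fix k assume k: "1 \<le> k" "k \<le> n"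
      show "(\<lambda>\<omega>. (X k \<omega>)\<^sup>2) \<in> borel_measurable (H (Fx n))"
        by (rule H_mono[OF F_Fx]) (intro borel_measurable_power X_H k)
    next
      show "(\<lambda>\<omega>. (\<xi> (Suc n) \<omega>)\<^sup>2) \<in> borel_measurable (H (Fx n))"
        by (intro borel_measurable_power innov_H) (auto simp: Fx_def)
    qed (auto simp: X_Suc X_square_integrable innov_moments)
    also have "\<dots> = (\<Sum>k=1..n. p * \<mu> k / nu n) + (1 - p)"
      using less.IH m by (simp add: innov_moments)
    also have "(\<Sum>k=1..n. p * \<mu> k / nu n) = p"
      using nu_pos[OF n] by (simp add: nu_def flip: sum_divide_distrib sum_distrib_left)
    finally show ?thesis by (simp add: m)
  qed
qed

lemma Y_Suc: "Y (Suc n) \<omega> = Y n \<omega> + \<mu> (Suc n) * X (Suc n) \<omega>"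
  by (simp add: Y_def)

lemma YX_moment: "expectation (\<lambda>\<omega>. Y n \<omega> * X (Suc n) \<omega>) = p / nu n * expectation (\<lambda>\<omega>. (Y n \<omega>)\<^sup>2)"
  using expectation_step[OF Y_H Y_square_integrable] by (simp add: power2_eq_square)

lemma YX_integrable: "integrable M (\<lambda>\<omega>. Y n \<omega> * X (Suc n) \<omega>)"
  by (rule integrable_mult_L2) (auto intro: X_measurable Y_square_integrable X_square_integrable)

lemma Y_second_moment: "expectation (\<lambda>\<omega>. (Y n \<omega>)\<^sup>2) = q n"
proof (induction n)
  case (Suc n)
  let ?m = "\<mu> (Suc n)"
  have "expectation (\<lambda>\<omega>. (Y (Suc n) \<omega>)\<^sup>2)
      = expectation (\<lambda>\<omega>. (Y n \<omega>)\<^sup>2 + 2 * ?m * (Y n \<omega> * X (Suc n) \<omega>) + ?m\<^sup>2 * (X (Suc n) \<omega>)\<^sup>2)"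
    by (intro Bochner_Integration.integral_cong) (simp_all add: Y_Suc power2_eq_square algebra_simps)
  also have "\<dots> = q n + 2 * ?m * (p / nu n * q n) + ?m\<^sup>2"
    using YX_integrable Y_square_integrable X_square_integrable X_second_moment
    by (simp add: YX_moment Suc)
  finally show ?case by (simp add: x_def field_simps)
qed (simp add: Y_def)

definition MM :: "nat \<Rightarrow> 'a \<Rightarrow> real" where "MM n \<omega> = Y n \<omega> / amp n"

lemma MM_second_moment: "expectation (\<lambda>\<omega>. (MM n \<omega>)\<^sup>2) = s n"
  and MM_square_integrable: "integrable M (\<lambda>\<omega>. (MM n \<omega>)\<^sup>2)"
  using Y_square_integrable by (simp_all add: MM_def power_divide Y_second_moment s_def)

lemma MM_measurable [measurable]: "MM n \<in> borel_measurable M"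
  unfolding MM_def[abs_def] by simp

sublocale YM: L2_martingale M "\<lambda>n. H (F n)" MM
proof unfold_locales
  show "subalgebra M (H (F n))" for n by (rule subalgebra_H[OF F_idx])
  show "sets (H (F m)) \<subseteq> sets (H (F n))" if "m \<le> n" for m n by (rule sets_H_mono[OF F_mono[OF that]])
  show "MM n \<in> borel_measurable (H (F n))" for n
    unfolding MM_def[abs_def] by (intro borel_measurable_divide Y_H) auto
  fix n :: nat and h :: "'a \<Rightarrow> real" assume h: "h \<in> borel_measurable (H (F n))" "integrable M (\<lambda>\<omega>. (h \<omega>)\<^sup>2)"
  have hM: "h \<in> borel_measurable M" by (rule H_measurable[OF F_idx h(1)])
  have hY: "integrable M (\<lambda>\<omega>. h \<omega> * Y n \<omega>)" and hX: "integrable M (\<lambda>\<omega>. h \<omega> * X (Suc n) \<omega>)"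
    by (rule integrable_mult_L2[OF hM]; use h in \<open>auto intro: X_measurable Y_square_integrable X_square_integrable\<close>)+
  define A where "A = 1 / amp (Suc n)"
  have "expectation (\<lambda>\<omega>. h \<omega> * (MM (Suc n) \<omega> - MM n \<omega>))
      = expectation (\<lambda>\<omega>. (A - 1 / amp n) * (h \<omega> * Y n \<omega>) + A * \<mu> (Suc n) * (h \<omega> * X (Suc n) \<omega>))"
    by (intro Bochner_Integration.integral_cong)
      (simp_all add: MM_def Y_Suc A_def algebra_simps add_divide_distrib diff_divide_distrib del: amp.simps)
  also have "\<dots> = (A - 1 / amp n + A * x n * p) * expectation (\<lambda>\<omega>. h \<omega> * Y n \<omega>)"
  proof -
    have "expectation (\<lambda>\<omega>. b * (h \<omega> * Y n \<omega>) + c * (h \<omega> * X (Suc n) \<omega>))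
        = b * expectation (\<lambda>\<omega>. h \<omega> * Y n \<omega>) + c * expectation (\<lambda>\<omega>. h \<omega> * X (Suc n) \<omega>)" for b c
      using hY hX by simp
    then show ?thesis by (simp only: expectation_step[OF h]) (simp add: x_def algebra_simps)
  qed
  also have "A - 1 / amp n + A * x n * p = 0"
  proof -
    have "A * (1 + p * x n) = 1 / amp n"
      using amp_pos[of n] amp_pos[of "Suc n"] unfolding A_def amp.simps by (simp add: zero_less_mult_iff)
    then show ?thesis by (simp add: algebra_simps)
  qed
  finally show "expectation (\<lambda>\<omega>. h \<omega> * (MM (Suc n) \<omega> - MM n \<omega>)) = 0" by simp
qed (rule MM_square_integrable)

lemma R_Suc: "R (Suc n) \<omega> = R n \<omega> + (X (Suc n) \<omega> - p * Y n \<omega> / nu n)"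
  by (cases "n = 0") (simp_all add: R_def Y_def)

sublocale RM: L2_martingale M "\<lambda>n. H (F n)" R
proof unfold_locales
  show "R n \<in> borel_measurable (H (F n))" for n by (rule R_H[OF order.refl])
  fix n :: nat and h :: "'a \<Rightarrow> real" assume h: "h \<in> borel_measurable (H (F n))" "integrable M (\<lambda>\<omega>. (h \<omega>)\<^sup>2)"
  have hM: "h \<in> borel_measurable M" by (rule H_measurable[OF F_idx h(1)])
  have hY: "integrable M (\<lambda>\<omega>. h \<omega> * Y n \<omega>)" and hX: "integrable M (\<lambda>\<omega>. h \<omega> * X (Suc n) \<omega>)"
    by (rule integrable_mult_L2[OF hM]; use h in \<open>auto intro: X_measurable Y_square_integrable X_square_integrable\<close>)+
  have "expectation (\<lambda>\<omega>. h \<omega> * (R (Suc n) \<omega> - R n \<omega>))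
      = expectation (\<lambda>\<omega>. h \<omega> * X (Suc n) \<omega> - p / nu n * (h \<omega> * Y n \<omega>))"
    by (intro Bochner_Integration.integral_cong) (simp_all add: R_Suc algebra_simps)
  also have "\<dots> = 0" using hX hY by (simp add: expectation_step[OF h])
  finally show "expectation (\<lambda>\<omega>. h \<omega> * (R (Suc n) \<omega> - R n \<omega>)) = 0" .
qed (rule YM.sub YM.filtration R_square_integrable | assumption)+

text \<open>Centring a step at its conditional mean cannot raise its second moment, which is 1, and
  the increments are orthogonal.\<close>

lemma R_second_moment: "expectation (\<lambda>\<omega>. (R n \<omega>)\<^sup>2) \<le> real n"
proof (induction n)
  case 0
  then show ?case by (simp add: R_def)
next
  case (Suc n)
  let ?c = "p / nu n"
  have "expectation (\<lambda>\<omega>. (R (Suc n) \<omega> - R n \<omega>)\<^sup>2)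
      = expectation (\<lambda>\<omega>. (X (Suc n) \<omega>)\<^sup>2 - 2 * ?c * (Y n \<omega> * X (Suc n) \<omega>) + ?c\<^sup>2 * (Y n \<omega>)\<^sup>2)"
    by (intro Bochner_Integration.integral_cong) (simp_all add: R_Suc power2_eq_square algebra_simps)
  also have "\<dots> = 1 - ?c\<^sup>2 * expectation (\<lambda>\<omega>. (Y n \<omega>)\<^sup>2)"
    using YX_integrable Y_square_integrable X_square_integrable X_second_moment
    by (simp add: YX_moment power2_eq_square)
  also have "\<dots> \<le> 1" by (simp add: Y_second_moment q_nonneg)
  finally show ?case using RM.increment_second_moment[of n "Suc n"] Suc by simp
qed

end

section \<open>The central limit theorem for the memory-weighted sums\<close>

text \<open>Near 0 the Taylor remainder is below \<open>e * t\<^sup>2\<close>, without a rate since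
  only two moments are given; away from 0 the trivial bound 2 is absorbed by
  \<open>C * \<bar>t\<bar> ^ 3\<close>. With \<open>t * D n i\<close> for \<open>t\<close>, the two
  terms add up over the clusters to multiples of \<open>P 2 n\<close> and
  \<open>P 3 n\<close>.\<close>

lemma (in prob_space) char_quadratic_bound:
  fixes \<xi> :: "'a \<Rightarrow> real"
  assumes m [measurable]: "\<xi> \<in> borel_measurable M" and int: "integrable M \<xi>" "integrable M (\<lambda>\<omega>. (\<xi> \<omega>)\<^sup>2)"
    and mean: "expectation \<xi> = 0" and var: "variance \<xi> = 1" and e: "e > 0"
  shows "\<exists>C\<ge>0. \<forall>t. cmod (char (distr M borel \<xi>) t - of_real (exp (- t\<^sup>2 / 2))) \<le> e * t\<^sup>2 + C * \<bar>t\<bar> ^ 3"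
proof -
  define \<phi> where "\<phi> = char (distr M borel \<xi>)"
  \<comment> \<open>The remainder in \<open>char_approx3'\<close>: dominated by
    \<open>6 * (\<xi> \<omega>)\<^sup>2\<close> and vanishing with \<open>t\<close>, so that its
    mean vanishes too.\<close>
  define h where "h t \<omega> = min (6 * (\<xi> \<omega>)\<^sup>2) (\<bar>t\<bar> * \<bar>\<xi> \<omega>\<bar> ^ 3)" for t \<omega>
  have h_meas [measurable]: "h t \<in> borel_measurable M" for t unfolding h_def[abs_def] by measurable
  have h_int: "integrable M (h t)" for t
    by (rule Bochner_Integration.integrable_bound[of _ "\<lambda>\<omega>. 6 * (\<xi> \<omega>)\<^sup>2"]) (use int in \<open>auto simp: h_def\<close>)
  interpret d: real_distribution "distr M borel \<xi>" by (rule real_distribution_distr) simp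
  have approx: "cmod (\<phi> t - (1 - t\<^sup>2 / 2)) \<le> t\<^sup>2 / 6 * expectation (h t)" for t
    using char_approx3'[OF m int mean var refl, of t] unfolding \<phi>_def h_def by simp
  have "(\<lambda>n. expectation (h (1 / real (Suc n)))) \<longlonglongrightarrow> expectation (\<lambda>\<omega>. 0)"
  proof (rule integral_dominated_convergence[where w = "\<lambda>\<omega>. 6 * (\<xi> \<omega>)\<^sup>2"])
    show "AE \<omega> in M. (\<lambda>n. h (1 / real (Suc n)) \<omega>) \<longlonglongrightarrow> 0"
    proof (rule AE_I2)
      fix \<omega>
      have "(\<lambda>n. 1 / real (Suc n) * \<bar>\<xi> \<omega>\<bar> ^ 3) \<longlonglongrightarrow> 0 * \<bar>\<xi> \<omega>\<bar> ^ 3"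
        by (intro tendsto_intros LIMSEQ_inverse_real_of_nat[unfolded inverse_eq_divide])
      then have *: "(\<lambda>n. 1 / real (Suc n) * \<bar>\<xi> \<omega>\<bar> ^ 3) \<longlonglongrightarrow> 0" by simp
      show "(\<lambda>n. h (1 / real (Suc n)) \<omega>) \<longlonglongrightarrow> 0"
        by (rule tendsto_sandwich[OF _ _ tendsto_const *]) (auto simp: h_def intro!: always_eventually)
    qed
  qed (use int in \<open>auto simp: h_def\<close>)
  then have "\<forall>\<^sub>F n in sequentially. expectation (h (1 / real (Suc n))) < 3 * e"
    using e by (intro order_tendstoD(2)[where y = "expectation (\<lambda>\<omega>. 0)"]) auto
  then obtain n where n: "expectation (h (1 / real (Suc n))) < 3 * e" by (auto simp: eventually_sequentially)
  \<comment> \<open>The first entry makes the mean of \<open>h\<close> small; the other two give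
    \<open>\<bar>t\<bar> * \<bar>t\<bar> \<le> 1 * (2 * e)\<close>, which bounds the quartic
    remainder of \<open>exp\<close>.\<close>
  define \<delta> where "\<delta> = min (1 / real (Suc n)) (min 1 (2 * e))"
  have \<delta>: "\<delta> > 0" using e by (simp add: \<delta>_def)
  have bound: "cmod (\<phi> t - of_real (exp (- t\<^sup>2 / 2))) \<le> e * t\<^sup>2 + 2 / \<delta> ^ 3 * \<bar>t\<bar> ^ 3" for t
  proof (cases "\<bar>t\<bar> \<le> \<delta>")
    case True
    have "expectation (h t) \<le> expectation (h (1 / real (Suc n)))"
    proof (intro integral_mono h_int)
      fix \<omega>
      have "\<bar>t\<bar> * \<bar>\<xi> \<omega>\<bar> ^ 3 \<le> \<bar>1 / real (Suc n)\<bar> * \<bar>\<xi> \<omega>\<bar> ^ 3"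
        using True by (intro mult_right_mono) (auto simp: \<delta>_def)
      then show "h t \<omega> \<le> h (1 / real (Suc n)) \<omega>" unfolding h_def by linarith
    qed
    then have "t\<^sup>2 / 6 * expectation (h t) \<le> t\<^sup>2 / 6 * (3 * e)"
      using n by (intro mult_left_mono) auto
    moreover have "t\<^sup>2 / 6 * (3 * e) = e / 2 * t\<^sup>2" by simp
    ultimately have 1: "cmod (\<phi> t - (1 - t\<^sup>2 / 2)) \<le> e / 2 * t\<^sup>2" using approx[of t] by linarith
    have 2: "\<bar>exp (- t\<^sup>2 / 2) - (1 - t\<^sup>2 / 2)\<bar> \<le> e / 2 * t\<^sup>2"
    proof -
      let ?y = "t\<^sup>2 / 2"
      have "1 - ?y \<le> exp (- ?y)" using exp_ge_add_one_self[of "- ?y"] by simp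
      moreover have "exp (- ?y) \<le> 1 / (1 + ?y)"
        using exp_ge_add_one_self[of ?y] by (simp add: exp_minus field_simps add_pos_nonneg)
      moreover have "1 / (1 + ?y) \<le> 1 - ?y + ?y\<^sup>2"
      proof -
        have "(1 - y + y\<^sup>2) * (1 + y) = 1 + y ^ 3" for y :: real
          by (simp add: algebra_simps power2_eq_square power3_eq_cube)
        then have "1 \<le> (1 - ?y + ?y\<^sup>2) * (1 + ?y)" by (simp del: power_divide)
        then show ?thesis by (simp add: pos_divide_le_eq add_pos_nonneg)
      qed
      moreover have "?y\<^sup>2 \<le> e / 2 * t\<^sup>2"
      proof -
        have "\<bar>t\<bar> * \<bar>t\<bar> \<le> 1 * (2 * e)" using True e \<delta> by (intro mult_mono) (auto simp: \<delta>_def)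
        then have "t\<^sup>2 \<le> 2 * e" by (simp add: power2_eq_square)
        then have "t\<^sup>2 * t\<^sup>2 \<le> 2 * e * t\<^sup>2"
          using mult_right_mono[of "t\<^sup>2" "2 * e" "t\<^sup>2"] by simp
        then show ?thesis by (simp add: power2_eq_square field_simps)
      qed
      ultimately show ?thesis by simp
    qed
    have "cmod (\<phi> t - of_real (exp (- t\<^sup>2 / 2))) \<le> cmod (\<phi> t - (1 - t\<^sup>2 / 2)) + cmod (of_real (1 - t\<^sup>2 / 2) - of_real (exp (- t\<^sup>2 / 2)))"
      using norm_triangle_ineq[of "\<phi> t - (1 - t\<^sup>2 / 2)" "of_real (1 - t\<^sup>2 / 2) - of_real (exp (- t\<^sup>2 / 2))"] by simp
    also have "cmod (of_real (1 - t\<^sup>2 / 2) - of_real (exp (- t\<^sup>2 / 2))) = \<bar>exp (- t\<^sup>2 / 2) - (1 - t\<^sup>2 / 2)\<bar>"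
      by (simp only: of_real_diff[symmetric] norm_of_real abs_minus_commute)
    finally have "cmod (\<phi> t - of_real (exp (- t\<^sup>2 / 2))) \<le> e * t\<^sup>2" using 1 2 by simp
    moreover have "0 \<le> 2 / \<delta> ^ 3 * \<bar>t\<bar> ^ 3" using \<delta> by simp
    ultimately show ?thesis by linarith
  next
    case False
    have "cmod (\<phi> t - of_real (exp (- t\<^sup>2 / 2))) \<le> cmod (\<phi> t) + cmod (of_real (exp (- t\<^sup>2 / 2)))"
      by (rule norm_triangle_ineq4)
    also have "\<dots> \<le> 1 + 1" unfolding \<phi>_def
      by (intro add_mono d.cmod_char_le_1) (simp add: norm_of_real)
    also have "1 \<le> (\<bar>t\<bar> / \<delta>) ^ 3" using False \<delta> by (intro one_le_power) simp
    then have "1 + 1 \<le> 2 / \<delta> ^ 3 * \<bar>t\<bar> ^ 3" by (simp add: power_divide)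
    finally show ?thesis using e by (simp add: add_increasing)
  qed
  show ?thesis
    by (rule exI[of _ "2 / \<delta> ^ 3"]) (use bound \<delta> in \<open>auto simp: \<phi>_def\<close>)
qed

context critical_srrw
begin

lemma Y_clusters: "Y n \<omega> = (\<Sum>i=1..n. D n i \<omega> * \<xi> i \<omega>)"
proof -
  have "Y n \<omega> = (\<Sum>k=1..n. \<Sum>i=1..n. \<mu> k * of_bool (rt k \<omega> = i) * \<xi> i \<omega>)"
    unfolding Y_def
  proof (intro sum.cong refl)
    fix k assume k: "k \<in> {1..n}"
    then have "rt k \<omega> \<in> {1..n}" using rt_le[of k \<omega>] rt_ge[of k \<omega>] by auto
    then have "(\<Sum>i=1..n. \<mu> k * of_bool (rt k \<omega> = i) * \<xi> i \<omega>) = (\<Sum>i\<in>{rt k \<omega>}. \<mu> k * \<xi> i \<omega>)"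
      by (intro sum.mono_neutral_cong_right) auto
    then show "\<mu> k * X k \<omega> = (\<Sum>i=1..n. \<mu> k * of_bool (rt k \<omega> = i) * \<xi> i \<omega>)" by (simp add: X_def)
  qed
  also have "\<dots> = (\<Sum>i=1..n. \<Sum>k=1..n. \<mu> k * of_bool (rt k \<omega> = i) * \<xi> i \<omega>)" by (rule sum.swap)
  also have "\<dots> = (\<Sum>i=1..n. D n i \<omega> * \<xi> i \<omega>)"
    by (intro sum.cong refl) (simp only: sum_distrib_right[symmetric] D_def[symmetric])
  finally show ?thesis .
qed

abbreviation \<phi> :: "real \<Rightarrow> complex" where "\<phi> \<equiv> char (distr M borel (\<xi> 1))"

lemma char_innov: "1 \<le> i \<Longrightarrow> char (distr M borel (\<lambda>\<omega>. d * \<xi> i \<omega>)) t = \<phi> (t * d)"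
proof -
  assume i: "1 \<le> i"
  have [measurable]: "\<xi> i \<in> borel_measurable M" by (rule innov_measurable[OF i])
  have "char (distr M borel (\<lambda>\<omega>. d * \<xi> i \<omega>)) t = char (distr M borel (\<xi> i)) (t * d)"
    unfolding char_def by (subst (1 2) integral_distr) (auto simp: mult_ac)
  then show ?thesis by (simp add: innov_ident[OF i])
qed

text \<open>Conditionally on the genealogy, \<open>Y n\<close> is a weighted sum of i.i.d. innovations.\<close>

lemma char_Y: "expectation (\<lambda>\<omega>. iexp (t * Y n \<omega>)) = expectation (\<lambda>\<omega>. \<Prod>i=1..n. \<phi> (t * D n i \<omega>))"
proof -
  \<comment> \<open>The genealogy up to time \<open>n\<close> takes finitely many values, so
    conditioning on it is a finite sum over the possible root maps in \<open>L\<close>.\<close>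
  define L where "L = PiE {1..n} (\<lambda>_. {1..n})"
  have fin: "finite L" unfolding L_def by (intro finite_PiE) auto
  define v where "v \<omega> = restrict (\<lambda>k. rt k \<omega>) {1..n}" for \<omega>
  have v: "v \<omega> \<in> L" for \<omega>
    unfolding v_def L_def
  proof (rule restrict_PiE_iff[THEN iffD2], rule ballI)
    fix k assume "k \<in> {1..n}"
    then show "rt k \<omega> \<in> {1..n}" using rt_le[of k \<omega>] rt_ge[of k \<omega>] by simp
  qed
  define d where "d l i = (\<Sum>k=1..n. \<mu> k * of_bool (l k = i))" for l :: "nat \<Rightarrow> nat" and i
  have d: "D n i \<omega> = d (v \<omega>) i" for i \<omega>
    unfolding D_def d_def v_def by (intro sum.cong) auto
  \<comment> \<open>On \<open>L\<close> this is the indicator of the root map \<open>l\<close>,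
    written as a product so that measurability reduces to that of single roots.\<close>
  define E where "E l \<omega> = (\<Prod>k=1..n. of_bool (rt k \<omega> = l k) :: complex)" for l \<omega>
  have E: "E l \<omega> = of_bool (v \<omega> = l)" if "l \<in> L" for l \<omega>
  proof (cases "v \<omega> = l")
    case True
    then show ?thesis by (auto simp: E_def v_def)
  next
    case False
    have "v \<omega> = l" if "\<forall>k\<in>{1..n}. rt k \<omega> = l k"
      by (rule PiE_ext[OF v[unfolded L_def] \<open>l \<in> L\<close>[unfolded L_def]]) (use that in \<open>simp add: v_def\<close>)
    with False obtain k where "k \<in> {1..n}" "rt k \<omega> \<noteq> l k" by blast
    then show ?thesis using False by (auto simp: E_def)
  qed
  have E_H: "E l \<in> borel_measurable (H (T n))" for l
    unfolding E_def[abs_def]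
  proof (intro borel_measurable_prod)
    fix k assume "k \<in> {1..n}"
    then have [measurable]: "rt k \<in> measurable (H (T n)) (count_space UNIV)" by (intro rt_H) simp
    show "(\<lambda>\<omega>. of_bool (rt k \<omega> = l k) :: complex) \<in> borel_measurable (H (T n))" by measurable
  qed
  have E_int: "integrable M (E l)" for l
  proof (rule integrable_const_bound[of _ 1])
    have "cmod (E l \<omega>) \<le> 1" for \<omega>
      unfolding E_def prod_norm[symmetric] by (intro prod_le_1) simp
    then show "AE \<omega> in M. cmod (E l \<omega>) \<le> 1" by simp
  qed (rule H_measurable[OF T_idx E_H])
  define S where "S l \<omega> = iexp (t * (\<Sum>i=1..n. d l i * \<xi> i \<omega>))" for l \<omega>
  have S_H: "S l \<in> borel_measurable (H ({0} \<times> UNIV))" for l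
  proof -
    have "(\<lambda>\<omega>. \<Sum>i=1..n. d l i * \<xi> i \<omega>) \<in> borel_measurable (H ({0} \<times> UNIV))"
      by (intro borel_measurable_sum borel_measurable_times innov_H) auto
    then show ?thesis unfolding S_def[abs_def] by measurable
  qed
  have S_int: "integrable M (S l)" for l
    by (rule integrable_const_bound[of _ 1]) (use H_measurable[OF _ S_H] in \<open>auto simp: S_def\<close>)
  have S_exp: "expectation (S l) = (\<Prod>i=1..n. \<phi> (t * d l i))" for l
  proof -
    have iv: "indep_vars (\<lambda>_. borel) (\<lambda>i \<omega>. d l i * \<xi> i \<omega>) {1..n}"
      by (rule indep_vars_compose2[OF indep_vars_subset[OF innov_indep]]) auto
    have "(\<lambda>\<omega>. \<Sum>i=1..n. d l i * \<xi> i \<omega>) \<in> borel_measurable M"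
      by (intro borel_measurable_sum borel_measurable_times innov_measurable) auto
    then have "expectation (S l) = char (distr M borel (\<lambda>\<omega>. \<Sum>i=1..n. d l i * \<xi> i \<omega>)) t"
      unfolding char_def S_def by (subst integral_distr) auto
    also have "\<dots> = (\<Prod>i=1..n. \<phi> (t * d l i))"
      unfolding char_distr_sum[OF iv] by (intro prod.cong refl char_innov) auto
    finally show ?thesis .
  qed
  have one: "f (v \<omega>) = (\<Sum>l\<in>L. E l \<omega> * f l)" for f :: "(nat \<Rightarrow> nat) \<Rightarrow> complex" and \<omega>
  proof -
    have "(\<Sum>l\<in>L. E l \<omega> * f l) = (\<Sum>l\<in>{v \<omega>}. f l)"
      using fin v by (intro sum.mono_neutral_cong_right) (auto simp: E)
    then show ?thesis by simp
  qed
  have ids: "T n \<subseteq> idx" "{0} \<times> UNIV \<subseteq> idx" "T n \<inter> {0} \<times> UNIV = {}" by (auto simp: T_def)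
  have ES: "expectation (\<lambda>\<omega>. E l \<omega> * S l \<omega>) = expectation (E l) * expectation (S l)"
    "integrable M (\<lambda>\<omega>. E l \<omega> * S l \<omega>)" for l
    by (rule indep_H[OF ids E_H E_int S_H S_int])+
  have "expectation (\<lambda>\<omega>. iexp (t * Y n \<omega>)) = expectation (\<lambda>\<omega>. \<Sum>l\<in>L. E l \<omega> * S l \<omega>)"
    unfolding Y_clusters d by (intro Bochner_Integration.integral_cong refl) (simp add: one[symmetric] S_def)
  also have "\<dots> = (\<Sum>l\<in>L. expectation (E l) * (\<Prod>i=1..n. \<phi> (t * d l i)))"
    by (subst Bochner_Integration.integral_sum) (simp_all add: ES S_exp)
  also have "\<dots> = expectation (\<lambda>\<omega>. \<Sum>l\<in>L. E l \<omega> * (\<Prod>i=1..n. \<phi> (t * d l i)))"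
    using E_int by (subst Bochner_Integration.integral_sum) auto
  also have "\<dots> = expectation (\<lambda>\<omega>. \<Prod>i=1..n. \<phi> (t * D n i \<omega>))"
    unfolding d by (intro Bochner_Integration.integral_cong refl) (simp add: one[symmetric])
  finally show ?thesis .
qed

text \<open>Two replacements. Each factor of the conditional characteristic function gives way to
  its Gaussian counterpart, and errors add up because all factors have modulus at most 1. Then the
  random variance \<open>P 2 n\<close> gives way to its mean \<open>q n\<close>, at the cost of its
  standard deviation, since \<open>exp (- y)\<close> is 1-Lipschitz for
  \<open>y \<ge> 0\<close>.\<close>

lemma char_Y_bound:
  assumes C: "\<And>t. cmod (\<phi> t - of_real (exp (- t\<^sup>2 / 2))) \<le> e * t\<^sup>2 + C * \<bar>t\<bar> ^ 3"
  shows "cmod (expectation (\<lambda>\<omega>. iexp (t * Y n \<omega>)) - of_real (exp (- t\<^sup>2 * q n / 2)))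
    \<le> e * t\<^sup>2 * q n + C * \<bar>t\<bar> ^ 3 * expectation (P 3 n) + t\<^sup>2 / 2 * sqrt (var_P n)"
proof -
  interpret d: real_distribution "distr M borel (\<xi> 1)" by (rule real_distribution_distr) (simp add: innov_measurable)
  have \<phi>_meas [measurable]: "\<phi> \<in> borel_measurable borel" by (rule d.char_measurable)
  define A where "A \<omega> = (\<Prod>i=1..n. \<phi> (t * D n i \<omega>))" for \<omega>
  define B where "B \<omega> = exp (- t\<^sup>2 * P 2 n \<omega> / 2)" for \<omega>
  have A_meas [measurable]: "A \<in> borel_measurable M" unfolding A_def[abs_def] by measurable
  have B_meas [measurable]: "B \<in> borel_measurable M" unfolding B_def[abs_def] by measurable
  have A_le: "cmod (A \<omega>) \<le> 1" for \<omega>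
    unfolding A_def prod_norm[symmetric] by (intro prod_le_1 conjI norm_ge_zero d.cmod_char_le_1)
  have B_le: "0 \<le> B \<omega>" "B \<omega> \<le> 1" for \<omega> by (auto simp: B_def P_nonneg)
  have A_int: "integrable M A" by (rule integrable_const_bound[of _ 1]) (auto simp: A_le)
  have B_int: "integrable M B" by (rule integrable_const_bound[of _ 1]) (auto simp: B_le)
  have AB: "cmod (A \<omega> - of_real (B \<omega>)) \<le> e * t\<^sup>2 * P 2 n \<omega> + C * \<bar>t\<bar> ^ 3 * P 3 n \<omega>" for \<omega>
  proof -
    have B_eq: "complex_of_real (B \<omega>) = (\<Prod>i=1..n. of_real (exp (- (t * D n i \<omega>)\<^sup>2 / 2)))"
    proof -
      have "- t\<^sup>2 * P 2 n \<omega> / 2 = (\<Sum>i=1..n. - (t * D n i \<omega>)\<^sup>2 / 2)"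
        by (simp add: P_def sum_distrib_left sum_divide_distrib power_mult_distrib sum_negf)
      then show ?thesis by (simp add: B_def exp_sum of_real_prod)
    qed
    have "cmod (A \<omega> - of_real (B \<omega>)) \<le> (\<Sum>i=1..n. cmod (\<phi> (t * D n i \<omega>) - of_real (exp (- (t * D n i \<omega>)\<^sup>2 / 2))))"
      unfolding A_def B_eq
    proof (rule norm_prod_diff)
      show "cmod (\<phi> (t * D n i \<omega>)) \<le> 1" for i by (rule d.cmod_char_le_1)
      show "cmod (of_real (exp (- (t * D n i \<omega>)\<^sup>2 / 2))) \<le> 1" for i unfolding norm_of_real by simp
    qed
    also have "\<dots> \<le> (\<Sum>i=1..n. e * (t * D n i \<omega>)\<^sup>2 + C * \<bar>t * D n i \<omega>\<bar> ^ 3)"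
      by (intro sum_mono C)
    also have "\<dots> = e * t\<^sup>2 * P 2 n \<omega> + C * \<bar>t\<bar> ^ 3 * P 3 n \<omega>"
      by (simp add: P_def sum.distrib sum_distrib_left power_mult_distrib abs_mult D_nonneg mult_ac)
    finally show ?thesis .
  qed
  have "cmod (expectation A - expectation (\<lambda>\<omega>. of_real (B \<omega>))) = cmod (expectation (\<lambda>\<omega>. A \<omega> - of_real (B \<omega>)))"
    using A_int B_int by simp
  also have "\<dots> \<le> expectation (\<lambda>\<omega>. cmod (A \<omega> - of_real (B \<omega>)))" by (rule integral_norm_bound)
  also have "\<dots> \<le> expectation (\<lambda>\<omega>. e * t\<^sup>2 * P 2 n \<omega> + C * \<bar>t\<bar> ^ 3 * P 3 n \<omega>)"
    using A_int B_int by (intro integral_mono AB) (auto intro!: integrable_norm simp: P_integrable)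
  also have "\<dots> = e * t\<^sup>2 * q n + C * \<bar>t\<bar> ^ 3 * expectation (P 3 n)"
    by (simp add: P_integrable expectation_P2)
  finally have 1: "cmod (expectation A - of_real (expectation B)) \<le> e * t\<^sup>2 * q n + C * \<bar>t\<bar> ^ 3 * expectation (P 3 n)"
    by simp
  have exp_lip: "\<bar>exp (- x) - exp (- y)\<bar> \<le> \<bar>x - y\<bar>" if "0 \<le> x" "0 \<le> y" for x y :: real
  proof -
    have *: "exp (- x) - exp (- y) \<le> y - x" if "0 \<le> x" "x \<le> y" for x y :: real
    proof -
      have "exp (- x) - exp (- y) = exp (- x) * (1 - exp (- (y - x)))" by (simp add: exp_diff exp_minus field_simps)
      also have "\<dots> \<le> 1 * (y - x)"
      proof (intro mult_mono)
        show "1 - exp (- (y - x)) \<le> y - x" using exp_ge_add_one_self[of "- (y - x)"] by linarith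
      qed (use that in auto)
      finally show ?thesis by simp
    qed
    show ?thesis using *[of x y] *[of y x] that by (cases "x \<le> y") auto
  qed
  have "\<bar>expectation B - exp (- t\<^sup>2 * q n / 2)\<bar> = \<bar>expectation (\<lambda>\<omega>. B \<omega> - exp (- t\<^sup>2 * q n / 2))\<bar>"
    using B_int prob_space by simp
  also have "\<dots> \<le> expectation (\<lambda>\<omega>. \<bar>B \<omega> - exp (- t\<^sup>2 * q n / 2)\<bar>)"
    using integral_norm_bound[of M "\<lambda>\<omega>. B \<omega> - exp (- t\<^sup>2 * q n / 2)"] by simp
  also have "\<dots> \<le> expectation (\<lambda>\<omega>. t\<^sup>2 / 2 * \<bar>P 2 n \<omega> - q n\<bar>)"
  proof (intro integral_mono)
    show "\<bar>B \<omega> - exp (- t\<^sup>2 * q n / 2)\<bar> \<le> t\<^sup>2 / 2 * \<bar>P 2 n \<omega> - q n\<bar>" for \<omega>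
    proof -
      have "\<bar>B \<omega> - exp (- t\<^sup>2 * q n / 2)\<bar> \<le> \<bar>t\<^sup>2 / 2 * P 2 n \<omega> - t\<^sup>2 / 2 * q n\<bar>"
        using exp_lip[of "t\<^sup>2 / 2 * P 2 n \<omega>" "t\<^sup>2 / 2 * q n"] P_nonneg[of 2 n \<omega>] q_nonneg[of n] by (simp add: B_def)
      also have "\<dots> = t\<^sup>2 / 2 * \<bar>P 2 n \<omega> - q n\<bar>" by (simp add: right_diff_distrib[symmetric] abs_mult del: times_divide_eq_left)
      finally show ?thesis .
    qed
  qed (use B_int P_integrable in auto)
  also have "\<dots> = t\<^sup>2 / 2 * expectation (\<lambda>\<omega>. \<bar>P 2 n \<omega> - q n\<bar>)" by simp
  also have "expectation (\<lambda>\<omega>. \<bar>P 2 n \<omega> - q n\<bar>) \<le> sqrt (var_P n)"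
    unfolding var_P_eq
  proof (rule expectation_abs_le_sqrt)
    show "integrable M (\<lambda>\<omega>. (P 2 n \<omega> - q n)\<^sup>2)"
      using integrable_add_square[OF P_measurable _ P_square_integrable, of "\<lambda>_. - q n" n] by simp
  qed simp
  finally have 2: "\<bar>expectation B - exp (- t\<^sup>2 * q n / 2)\<bar> \<le> t\<^sup>2 / 2 * sqrt (var_P n)"
    by (simp add: mult_left_mono)
  have "cmod (expectation A - of_real (exp (- t\<^sup>2 * q n / 2)))
      \<le> cmod (expectation A - of_real (expectation B)) + cmod (of_real (expectation B) - of_real (exp (- t\<^sup>2 * q n / 2)))"
    using norm_triangle_ineq[of "expectation A - of_real (expectation B)" "of_real (expectation B) - of_real (exp (- t\<^sup>2 * q n / 2))"] by simp
  also have "cmod (of_real (expectation B) - of_real (exp (- t\<^sup>2 * q n / 2))) = \<bar>expectation B - exp (- t\<^sup>2 * q n / 2)\<bar>"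
    by (simp only: of_real_diff[symmetric] norm_of_real)
  finally show ?thesis using 1 2 unfolding char_Y A_def by linarith
qed

lemma s_inverse_tendsto: "(\<lambda>n. inverse (s n)) \<longlonglongrightarrow> 0"
  by (rule tendsto_inverse_0_at_top[OF s_at_top])

lemma char_MM: "(\<lambda>n. expectation (\<lambda>\<omega>. iexp (u * (MM n \<omega> / sqrt (s n))))) \<longlonglongrightarrow> of_real (exp (- u\<^sup>2 / 2))"
proof (rule LIMSEQ_I)
  fix e :: real assume e: "e > 0"
  \<comment> \<open>With \<open>t\<close> normalised below so that
    \<open>t\<^sup>2 * q n = u\<^sup>2\<close>, the first error term is at most
    \<open>e / 4\<close>.\<close>
  define e' where "e' = e / (4 * (u\<^sup>2 + 1))"
  have u1: "u\<^sup>2 + 1 > 0" by (simp add: add_nonneg_pos)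
  have e': "e' > 0" "e' * u\<^sup>2 \<le> e / 4"
    using e u1 by (auto simp: e'_def field_simps)
  obtain C where C: "C \<ge> 0" "\<And>t. cmod (\<phi> t - of_real (exp (- t\<^sup>2 / 2))) \<le> e' * t\<^sup>2 + C * \<bar>t\<bar> ^ 3"
    using char_quadratic_bound[OF innov_measurable innov_integrable sq_integrable innov_mean unit_variance e'(1)] by auto
  obtain C3 where C3: "C3 \<ge> 0" "\<And>n. expectation (P 3 n) \<le> C3 * amp n ^ 3" using P3_bound by blast
  obtain C4 where C4: "C4 \<ge> 0" "\<And>n. var_P n \<le> C4 * amp n ^ 4" using var_P_bound by blast
  \<comment> \<open>The two remaining error terms after normalisation, of orders
    \<open>s n powr (- 3 / 2)\<close> and \<open>1 / s n\<close>.\<close>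
  have "(\<lambda>n. C * \<bar>u\<bar> ^ 3 * C3 * (sqrt (inverse (s n)) ^ 3) + u\<^sup>2 / 2 * sqrt C4 * inverse (s n))
      \<longlonglongrightarrow> C * \<bar>u\<bar> ^ 3 * C3 * (sqrt 0 ^ 3) + u\<^sup>2 / 2 * sqrt C4 * 0"
    by (intro tendsto_intros s_inverse_tendsto)
  then have "\<forall>\<^sub>F n in sequentially. C * \<bar>u\<bar> ^ 3 * C3 * (sqrt (inverse (s n)) ^ 3) + u\<^sup>2 / 2 * sqrt C4 * inverse (s n) < e / 2"
    by (rule order_tendstoD) (use e in simp)
  then have "\<forall>\<^sub>F n in sequentially. norm (expectation (\<lambda>\<omega>. iexp (u * (MM n \<omega> / sqrt (s n)))) - of_real (exp (- u\<^sup>2 / 2))) < e"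
    using eventually_ge_at_top[of 1]
  proof eventually_elim
    case (elim n)
    have s: "s n > 0" and amp: "amp n > 0" using s_pos[OF elim(2)] amp_pos by auto
    define t where "t = u / (amp n * sqrt (s n))"
    have t1: "u * (MM n \<omega> / sqrt (s n)) = t * Y n \<omega>" for \<omega> by (simp add: t_def MM_def)
    have qn: "q n = s n * (amp n)\<^sup>2" using amp by (simp add: s_def)
    have t2: "t\<^sup>2 * q n = u\<^sup>2" using s amp by (simp add: t_def qn power_divide power_mult_distrib)
    have "cmod (expectation (\<lambda>\<omega>. iexp (t * Y n \<omega>)) - of_real (exp (- t\<^sup>2 * q n / 2)))
      \<le> e' * t\<^sup>2 * q n + C * \<bar>t\<bar> ^ 3 * expectation (P 3 n) + t\<^sup>2 / 2 * sqrt (var_P n)"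
      by (rule char_Y_bound[OF C(2)])
    also have "e' * t\<^sup>2 * q n = e' * u\<^sup>2" using t2 by (simp add: mult.assoc)
    also have "C * \<bar>t\<bar> ^ 3 * expectation (P 3 n) \<le> C * \<bar>t\<bar> ^ 3 * (C3 * amp n ^ 3)"
      using C(1) C3(2) by (intro mult_left_mono) auto
    also have "C * \<bar>t\<bar> ^ 3 * (C3 * amp n ^ 3) = C * \<bar>u\<bar> ^ 3 * C3 * (sqrt (inverse (s n)) ^ 3)"
    proof -
      have "sqrt (inverse (s n)) = 1 / sqrt (s n)" by (simp add: inverse_eq_divide real_sqrt_divide)
      then show ?thesis using s amp by (simp add: t_def abs_mult power_divide power_mult_distrib)
    qed
    also have "t\<^sup>2 / 2 * sqrt (var_P n) \<le> t\<^sup>2 / 2 * (sqrt C4 * (amp n)\<^sup>2)"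
    proof (intro mult_left_mono)
      have "sqrt (var_P n) \<le> sqrt (C4 * ((amp n)\<^sup>2)\<^sup>2)" using C4(2)[of n] by simp
      also have "\<dots> = sqrt C4 * (amp n)\<^sup>2" by (simp only: real_sqrt_mult real_sqrt_abs) simp
      finally show "sqrt (var_P n) \<le> sqrt C4 * (amp n)\<^sup>2" .
    qed simp
    also have "t\<^sup>2 / 2 * (sqrt C4 * (amp n)\<^sup>2) = u\<^sup>2 / 2 * sqrt C4 * inverse (s n)"
      using s amp by (simp add: t_def power_divide power_mult_distrib field_simps)
    finally have "cmod (expectation (\<lambda>\<omega>. iexp (t * Y n \<omega>)) - of_real (exp (- t\<^sup>2 * q n / 2))) < e"
      using elim(1) e'(2) e by linarith
    then show ?case using t2 unfolding t1 by (simp del: of_real_exp)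
  qed
  then show "\<exists>no. \<forall>n\<ge>no. norm (expectation (\<lambda>\<omega>. iexp (u * (MM n \<omega> / sqrt (s n)))) - of_real (exp (- u\<^sup>2 / 2))) < e"
    by (simp add: eventually_sequentially)
qed

theorem clt:
  fixes \<psi> :: "real \<Rightarrow> real"
  assumes "\<And>x. isCont \<psi> x" "\<And>x. \<bar>\<psi> x\<bar> \<le> b"
  shows "(\<lambda>n. expectation (\<lambda>\<omega>. \<psi> (MM n \<omega> / sqrt (s n)))) \<longlonglongrightarrow> integral\<^sup>L std_normal_distribution \<psi>"
proof -
  let ?d = "\<lambda>n. distr M borel (\<lambda>\<omega>. MM n \<omega> / sqrt (s n))"
  have rd: "real_distribution (?d n)" for n by (rule real_distribution_distr) simp
  have "weak_conv_m ?d std_normal_distribution"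
  proof (rule levy_continuity[OF rd real_dist_normal_dist])
    fix t
    have "char (?d n) t = expectation (\<lambda>\<omega>. iexp (t * (MM n \<omega> / sqrt (s n))))" for n
      unfolding char_def by (subst integral_distr) auto
    then show "(\<lambda>n. char (?d n) t) \<longlonglongrightarrow> char std_normal_distribution t"
      using char_MM[of t] by (simp add: char_std_normal_distribution)
  qed
  from weak_conv_imp_integral_bdd_continuous_conv[OF rd real_dist_normal_dist this, of \<psi> b] assms
  have "(\<lambda>n. integral\<^sup>L (?d n) \<psi>) \<longlonglongrightarrow> integral\<^sup>L std_normal_distribution \<psi>" by simp
  moreover have "\<psi> \<in> borel_measurable borel"
    using assms by (intro borel_measurable_continuous_onI continuous_at_imp_continuous_on) auto
  then have "integral\<^sup>L (?d n) \<psi> = expectation (\<lambda>\<omega>. \<psi> (MM n \<omega> / sqrt (s n)))" for n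
    by (subst integral_distr) auto
  ultimately show ?thesis by simp
qed

end

section \<open>Approximation of the paths\<close>

text \<open>Polya's argument: a monotone function is squeezed between its values at neighbouring
  points of a finite grid, chosen fine enough for the uniformly continuous limit.\<close>

lemma uniform_limit_monotone:
  fixes f :: "nat \<Rightarrow> real \<Rightarrow> real"
  assumes mono: "\<And>n x y. a \<le> x \<Longrightarrow> x \<le> y \<Longrightarrow> y \<le> b \<Longrightarrow> f n x \<le> f n y"
    and lim: "\<And>x. a \<le> x \<Longrightarrow> x \<le> b \<Longrightarrow> (\<lambda>n. f n x) \<longlonglongrightarrow> h x"
    and cont: "continuous_on {a..b} h"
  shows "uniform_limit {a..b} f h sequentially"
proof (rule uniform_limitI)
  fix e :: real assume e: "e > 0"
  show "\<forall>\<^sub>F n in sequentially. \<forall>x\<in>{a..b}. dist (f n x) (h x) < e"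
  proof (cases "a < b")
    case False
    then have "{a..b} \<subseteq> {a}" by auto
    moreover have "\<forall>\<^sub>F n in sequentially. \<forall>x\<in>{a..b}. dist (f n x) (h x) < e" if "a = b"
      using tendstoD[OF lim[of a] e] that by simp
    ultimately show ?thesis using False by (cases "a = b") auto
  next
    case True
    have "uniformly_continuous_on {a..b} h" by (rule compact_uniformly_continuous[OF cont]) simp
    then obtain d where d: "d > 0" "\<And>x y. x \<in> {a..b} \<Longrightarrow> y \<in> {a..b} \<Longrightarrow> dist y x < d \<Longrightarrow> dist (h y) (h x) < e / 2"
      using e unfolding uniformly_continuous_on_def by (meson half_gt_zero)
    obtain m :: nat where m: "m > 0" "(b - a) / d < real m"
      using reals_Archimedean2[of "max 1 ((b - a) / d)"] by (metis max_less_iff_conj of_nat_0_less_iff zero_less_one less_trans)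
    define w where "w = (b - a) / real m"
    have w: "w > 0" "w < d" using True m d(1) by (auto simp: w_def field_simps)
    define u where "u j = a + real j * w" for j
    have u_range: "u j \<in> {a..b}" if "j \<le> m" for j
    proof -
      have "0 \<le> real j * w" "real j * w \<le> real m * w" using that w by (auto intro!: mult_right_mono)
      moreover have "real m * w = b - a" using m by (simp add: w_def)
      ultimately show ?thesis by (simp add: u_def)
    qed
    have "\<forall>\<^sub>F n in sequentially. \<forall>j\<in>{..m}. dist (f n (u j)) (h (u j)) < e / 2"
    proof (intro eventually_ball_finite ballI)
      fix j assume "j \<in> {..m}"
      then have "(\<lambda>n. f n (u j)) \<longlonglongrightarrow> h (u j)" using u_range[of j] by (intro lim) auto
      then show "\<forall>\<^sub>F n in sequentially. dist (f n (u j)) (h (u j)) < e / 2"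
        using e by (intro tendstoD) auto
    qed simp
    then show ?thesis
    proof eventually_elim
      case (elim n)
      show ?case
      proof
        fix x assume x: "x \<in> {a..b}"
        define j where "j = nat \<lfloor>(x - a) / w\<rfloor>"
        have fl: "real j \<le> (x - a) / w" "(x - a) / w < real j + 1"
          using x w unfolding j_def by (simp_all add: of_nat_floor)
        have lo: "u j \<le> x" using fl(1) w by (simp add: u_def field_simps)
        have "real j * w \<le> b - a" using lo x by (simp add: u_def)
        also have "b - a = real m * w" using m by (simp add: w_def)
        finally have "real j \<le> real m" using w(1) by simp
        then have jm: "j \<le> m" by simp
        \<comment> \<open>The grid point to the right of \<open>x\<close>, capped at the last one
          for \<open>x = b\<close>.\<close>
        define k where "k = min (Suc j) m"
        have km: "k \<le> m" by (simp add: k_def)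
        have hi: "x \<le> u k"
        proof (cases "Suc j \<le> m")
          case True
          then show ?thesis using fl(2) w by (simp add: k_def u_def field_simps)
        next
          case False
          then show ?thesis using x m by (simp add: k_def u_def w_def)
        qed
        have "real k * w \<le> (real j + 1) * w" using w by (intro mult_right_mono) (auto simp: k_def)
        then have uk: "u k \<le> u j + w" by (simp add: u_def algebra_simps)
        have "f n (u j) \<le> f n x" "f n x \<le> f n (u k)"
          using mono lo hi x u_range[OF jm] u_range[OF km] by auto
        moreover have "\<bar>f n (u j) - h (u j)\<bar> < e / 2" "\<bar>f n (u k) - h (u k)\<bar> < e / 2"
          using elim jm km by (auto simp: dist_real_def)
        moreover have "dist (h (u j)) (h x) < e / 2" "dist (h (u k)) (h x) < e / 2"
        proof -
          have "dist (u j) x < d" "dist (u k) x < d"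
            using lo hi uk w by (simp_all add: dist_real_def)
          from d(2)[OF x u_range[OF jm] this(1)] d(2)[OF x u_range[OF km] this(2)]
          show "dist (h (u j)) (h x) < e / 2" "dist (h (u k)) (h x) < e / 2" .
        qed
        ultimately show "dist (f n x) (h x) < e" unfolding dist_real_def by linarith
      qed
    qed
  qed
qed

lemma (in prob_space) markov_square:
  assumes [measurable]: "f \<in> borel_measurable M" and "integrable M (\<lambda>\<omega>. (f \<omega>)\<^sup>2)" "c > 0"
  shows "prob {\<omega>\<in>space M. c \<le> \<bar>f \<omega> :: real\<bar>} \<le> expectation (\<lambda>\<omega>. (f \<omega>)\<^sup>2) / c\<^sup>2"
proof -
  have "{\<omega>\<in>space M. c \<le> \<bar>f \<omega>\<bar>} = {\<omega>\<in>space M. c\<^sup>2 \<le> (f \<omega>)\<^sup>2}"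
    using assms(3) abs_le_square_iff[of c] by auto
  then show ?thesis using integral_Markov_inequality_measure[of M "\<lambda>\<omega>. (f \<omega>)\<^sup>2" "space M" "c\<^sup>2"] assms
    by simp
qed

section \<open>Freezing the martingale inside the walk\<close>

context critical_srrw
begin

abbreviation scale :: "nat \<Rightarrow> real" where "scale n \<equiv> sqrt (real n * ln (real n))"

text \<open>The limit of \<open>p * G n * sqrt (s n) / scale n\<close>; by
  \<open>sigma_square\<close> it is the standard deviation of the limit law.\<close>

definition \<sigma> :: real where "\<sigma> = 2 * p * sqrt slope"

definition V :: "nat \<Rightarrow> 'a \<Rightarrow> real" where "V n \<omega> = \<sigma> * (MM n \<omega> / sqrt (s n))"

definition S :: "nat \<Rightarrow> 'a \<Rightarrow> real" where "S n \<omega> = (\<Sum>k=1..n. X k \<omega>)"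

lemma sigma_nonneg: "\<sigma> \<ge> 0"
  using p_nonneg slope_pos by (simp add: \<sigma>_def)

lemma V_measurable [measurable]: "V n \<in> borel_measurable M"
  unfolding V_def[abs_def] by simp

lemma MM_abs_diff_integrable: "integrable M (\<lambda>\<omega>. \<bar>MM k \<omega> - MM n \<omega>\<bar>)"
  using integrable_of_square[OF MM_measurable MM_square_integrable] by simp

lemma MM_normalised:
  "integrable M (\<lambda>\<omega>. (MM n \<omega> / sqrt (s n))\<^sup>2)" "expectation (\<lambda>\<omega>. (MM n \<omega> / sqrt (s n))\<^sup>2) \<le> 1"
  using MM_square_integrable MM_second_moment s_nonneg[of n]
  by (simp_all add: power_divide)

lemma S_decomposition: "S m \<omega> = R m \<omega> + p * (\<Sum>k=1..<m. g k * MM k \<omega>)"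
proof -
  have "p * Y k \<omega> / nu k = p * (g k * MM k \<omega>)" for k
    using amp_pos[of k] by (simp add: g_def MM_def)
  then show ?thesis by (simp add: S_def R_def sum_distrib_left)
qed

lemma G_mono: "m \<le> n \<Longrightarrow> G m \<le> G n"
  unfolding G_def by (intro sum_mono2) (auto simp: g_nonneg)

lemma G_uniform:
  assumes "K > 0"
  shows "uniform_limit {0..K} (\<lambda>n t. p * G (nat \<lfloor>real n * t\<rfloor>) * sqrt (s n) / scale n) (\<lambda>t. \<sigma> * sqrt t) sequentially"
proof (rule uniform_limit_monotone)
  fix n :: nat and x y :: real assume "0 \<le> x" "x \<le> y"
  then have "nat \<lfloor>real n * x\<rfloor> \<le> nat \<lfloor>real n * y\<rfloor>" by (intro nat_mono floor_mono mult_left_mono) auto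
  then show "p * G (nat \<lfloor>real n * x\<rfloor>) * sqrt (s n) / scale n \<le> p * G (nat \<lfloor>real n * y\<rfloor>) * sqrt (s n) / scale n"
    using p_nonneg s_nonneg by (cases n) (auto intro!: divide_right_mono mult_right_mono mult_left_mono G_mono)
next
  fix t :: real assume "0 \<le> t"
  from tendsto_mult[OF tendsto_const[of p] G_scaling[OF this]]
  show "(\<lambda>n. p * G (nat \<lfloor>real n * t\<rfloor>) * sqrt (s n) / scale n) \<longlonglongrightarrow> \<sigma> * sqrt t"
    by (simp add: \<sigma>_def mult_ac)
qed (intro continuous_intros)

text \<open>By orthogonality of increments the second moment of the difference is
  \<open>\<bar>s k - s n\<bar>\<close>, whichever index is larger.\<close>

lemma MM_difference: "expectation (\<lambda>\<omega>. \<bar>MM k \<omega> - MM n \<omega>\<bar>) \<le> sqrt \<bar>s k - s n\<bar>"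
proof -
  have "expectation (\<lambda>\<omega>. \<bar>MM k \<omega> - MM n \<omega>\<bar>) \<le> sqrt (expectation (\<lambda>\<omega>. (MM k \<omega> - MM n \<omega>)\<^sup>2))"
  proof (rule expectation_abs_le_sqrt)
    show "integrable M (\<lambda>\<omega>. (MM k \<omega> - MM n \<omega>)\<^sup>2)"
      using integrable_add_square[of "MM k" M "\<lambda>\<omega>. - MM n \<omega>"] MM_square_integrable by simp
  qed simp
  also have "expectation (\<lambda>\<omega>. (MM k \<omega> - MM n \<omega>)\<^sup>2) = \<bar>s k - s n\<bar>"
  proof (cases "n \<le> k")
    case True
    then show ?thesis using YM.increment_second_moment[OF True] monoD[OF s_mono True]
      by (simp add: MM_second_moment)
  next
    case False
    then have "k \<le> n" by simp
    then show ?thesis using YM.increment_second_moment[of k n] monoD[OF s_mono, of k n]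
      by (simp add: MM_second_moment power2_commute[of "MM k _"])
  qed
  finally show ?thesis .
qed

text \<open>The cost of replacing \<open>MM k\<close> by \<open>MM n\<close> for all
  \<open>k \<le> n * K\<close>. Absolute values inside the sum make it a bound for all
  \<open>t \<le> K\<close> at once.\<close>

definition err :: "nat \<Rightarrow> nat \<Rightarrow> 'a \<Rightarrow> real" where
  "err K n \<omega> = p * (\<Sum>k=1..<Suc (n * K). g k * \<bar>MM k \<omega> - MM n \<omega>\<bar>) / scale n"

lemma err_measurable [measurable]: "err K n \<in> borel_measurable M"
  unfolding err_def[abs_def] by measurable

lemma err_nonneg: "0 \<le> err K n \<omega>"
proof -
  have "0 \<le> real n * ln (real n)" by (cases n) auto
  then show ?thesis unfolding err_def using p_nonneg g_nonneg
    by (intro divide_nonneg_nonneg mult_nonneg_nonneg sum_nonneg) auto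
qed

lemma err_integrable: "integrable M (err K n)"
  unfolding err_def[abs_def]
  by (intro integrable_divide_zero integrable_mult_right Bochner_Integration.integrable_sum MM_abs_diff_integrable)

lemma err_expectation:
  "expectation (err K n) \<le> p * (\<Sum>k=1..<Suc (n * K). g k * sqrt \<bar>s k - s n\<bar>) / scale n"
proof -
  have nn: "0 \<le> real n * ln (real n)" by (cases n) auto
  have eq: "expectation (err K n) = p * (\<Sum>k=1..<Suc (n * K). g k * expectation (\<lambda>\<omega>. \<bar>MM k \<omega> - MM n \<omega>\<bar>)) / scale n"
    unfolding err_def[abs_def] using MM_abs_diff_integrable by (simp add: Bochner_Integration.integral_sum)
  show ?thesis unfolding eq
    by (intro divide_right_mono mult_left_mono sum_mono MM_difference p_nonneg g_nonneg) (use nn in simp)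
qed

text \<open>Brings the upper end \<open>Suc (n * K)\<close> into the floor form of
  \<open>G_scaling\<close>, with \<open>t = K + 1\<close>.\<close>

lemma G_Suc_bound: "1 \<le> n \<Longrightarrow> G (Suc (n * K)) \<le> G (nat \<lfloor>real n * real (Suc K)\<rfloor>)"
proof (rule G_mono)
  assume "1 \<le> n"
  have "nat \<lfloor>real n * real (Suc K)\<rfloor> = n * Suc K"
    unfolding of_nat_mult[symmetric] by (simp only: floor_of_nat nat_int)
  then show "Suc (n * K) \<le> nat \<lfloor>real n * real (Suc K)\<rfloor>" using \<open>1 \<le> n\<close> by simp
qed

text \<open>Before time \<open>\<delta> n\<close> the weights \<open>g\<close> are negligible, after it \<open>s\<close> is almost constant.\<close>

lemma weighted_fluctuation:
  assumes K: "1 \<le> K"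
  shows "(\<lambda>n. (\<Sum>k=1..<Suc (n * K). g k * sqrt \<bar>s k - s n\<bar>) / scale n) \<longlonglongrightarrow> 0"
proof (rule LIMSEQ_I)
  fix e :: real assume e: "e > 0"
  define c where "c = 2 * sqrt slope"
  have c: "c > 0" using slope_pos by (simp add: c_def)
  \<comment> \<open>\<open>c * sqrt \<delta>\<close> is the limit of the bound for the times before
    \<open>\<delta> * n\<close>; this choice makes it at most \<open>e / 4\<close>.\<close>
  define \<delta> where "\<delta> = min 1 ((e / (2 * c))\<^sup>2 / 4)"
  have \<delta>: "0 < \<delta>" "\<delta> \<le> 1" using e c by (auto simp: \<delta>_def)
  have sqd: "c * sqrt \<delta> < e / 2"
  proof -
    have "sqrt \<delta> \<le> sqrt ((e / (2 * c) / 2)\<^sup>2)" by (rule real_sqrt_le_mono) (simp add: \<delta>_def power_divide)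
    also have "\<dots> = e / (4 * c)" using e c by simp
    finally have "c * sqrt \<delta> \<le> c * (e / (4 * c))" using c by (intro mult_left_mono) auto
    then show ?thesis using c e by simp
  qed
  let ?m = "\<lambda>n. nat \<lfloor>real n * \<delta>\<rfloor>" and ?G = "\<lambda>n t. G (nat \<lfloor>real n * t\<rfloor>) * sqrt (s n) / scale n"
  have "(\<lambda>n. s (nat \<lfloor>real n * real K\<rfloor>) / s n - s (?m n) / s n) \<longlonglongrightarrow> 1 - 1"
    using K \<delta> by (intro tendsto_diff s_floor) auto
  then have "(\<lambda>n. ?G n \<delta> + ?G n (real (Suc K)) * sqrt (s (nat \<lfloor>real n * real K\<rfloor>) / s n - s (?m n) / s n))
      \<longlonglongrightarrow> 2 * sqrt slope * sqrt \<delta> + 2 * sqrt slope * sqrt (real (Suc K)) * sqrt (1 - 1)"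
    using \<delta> by (intro tendsto_add tendsto_mult[OF G_scaling] G_scaling tendsto_real_sqrt) auto
  then have "\<forall>\<^sub>F n in sequentially. ?G n \<delta> + ?G n (real (Suc K)) * sqrt (s (nat \<lfloor>real n * real K\<rfloor>) / s n - s (?m n) / s n) < e"
    by (rule order_tendstoD) (use sqd e in \<open>simp add: c_def\<close>)
  then have "\<forall>\<^sub>F n in sequentially. norm ((\<Sum>k=1..<Suc (n * K). g k * sqrt \<bar>s k - s n\<bar>) / scale n - 0) < e"
    using eventually_gt_at_top[of 1]
  proof eventually_elim
    case (elim n)
    have sn: "s n > 0" using elim by (intro s_pos) simp
    have scale: "scale n > 0" using elim by simp
    have KT: "nat \<lfloor>real n * real K\<rfloor> = n * K" by (simp flip: of_nat_mult)
    have mn: "?m n \<le> n"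
    proof -
      have "real n * \<delta> \<le> real n" using \<delta> by (simp add: mult_left_le)
      then show ?thesis by linarith
    qed
    \<comment> \<open>On \<open>?A\<close> the difference is at most \<open>s n\<close>; on
      \<open>?B\<close> monotonicity confines it to \<open>s (n * K) - s (?m n)\<close>, which is
      \<open>o(s n)\<close> by slow variation.\<close>
    let ?A = "{1..<?m n}" and ?B = "{max 1 (?m n)..<Suc (n * K)}"
    have nT: "n \<le> n * K" using K by simp
    have "{1..<Suc N} = {1..<b} \<union> {max 1 b..<Suc N}" "{1..<b} \<inter> {max 1 b..<Suc N} = {}"
      if "b \<le> n" "n \<le> N" for b N using that by auto
    note split = this[OF mn nT]
    have "(\<Sum>k=1..<Suc (n * K). g k * sqrt \<bar>s k - s n\<bar>) = (\<Sum>k\<in>?A. g k * sqrt \<bar>s k - s n\<bar>) + (\<Sum>k\<in>?B. g k * sqrt \<bar>s k - s n\<bar>)"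
      unfolding split(1) by (intro sum.union_disjoint split(2)) auto
    also have "(\<Sum>k\<in>?A. g k * sqrt \<bar>s k - s n\<bar>) \<le> (\<Sum>k\<in>?A. g k * sqrt (s n))"
    proof (intro sum_mono mult_left_mono g_nonneg real_sqrt_le_mono)
      fix k assume "k \<in> ?A"
      then have "s k \<le> s n" using mn by (intro monoD[OF s_mono]) auto
      then show "\<bar>s k - s n\<bar> \<le> s n" using s_nonneg[of k] by simp
    qed
    also have "\<dots> = G (?m n) * sqrt (s n)" by (simp add: G_def sum_distrib_right)
    also have "(\<Sum>k\<in>?B. g k * sqrt \<bar>s k - s n\<bar>) \<le> (\<Sum>k\<in>?B. g k * sqrt (s (n * K) - s (?m n)))"
    proof (intro sum_mono mult_left_mono g_nonneg real_sqrt_le_mono)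
      fix k assume "k \<in> ?B"
      then have "s (?m n) \<le> s k" "s k \<le> s (n * K)" "s (?m n) \<le> s n" "s n \<le> s (n * K)"
        using mn nT by (auto intro!: monoD[OF s_mono])
      then show "\<bar>s k - s n\<bar> \<le> s (n * K) - s (?m n)" by linarith
    qed
    also have "\<dots> \<le> G (Suc (n * K)) * sqrt (s (n * K) - s (?m n))"
    proof -
      have "s (?m n) \<le> s (n * K)" by (intro monoD[OF s_mono] order.trans[OF mn nT])
      then show ?thesis unfolding G_def sum_distrib_right
        by (intro sum_mono2) (auto simp: g_nonneg)
    qed
    also have "\<dots> \<le> G (nat \<lfloor>real n * real (Suc K)\<rfloor>) * sqrt (s (n * K) - s (?m n))"
    proof (intro mult_right_mono G_Suc_bound)
      have "s (?m n) \<le> s (n * K)" by (intro monoD[OF s_mono] order.trans[OF mn nT])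
      then show "0 \<le> sqrt (s (n * K) - s (?m n))" by simp
    qed (use elim in simp)
    also have "sqrt (s (n * K) - s (?m n)) = sqrt (s n) * sqrt (s (n * K) / s n - s (?m n) / s n)"
      using sn by (simp flip: diff_divide_distrib real_sqrt_mult)
    finally have "(\<Sum>k=1..<Suc (n * K). g k * sqrt \<bar>s k - s n\<bar>) / scale n
        \<le> (G (?m n) * sqrt (s n) + G (nat \<lfloor>real n * real (Suc K)\<rfloor>) * (sqrt (s n) * sqrt (s (n * K) / s n - s (?m n) / s n))) / scale n"
      using scale by (intro divide_right_mono) auto
    also have "\<dots> = ?G n \<delta> + ?G n (real (Suc K)) * sqrt (s (nat \<lfloor>real n * real K\<rfloor>) / s n - s (?m n) / s n)"
      unfolding KT by (simp add: add_divide_distrib)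
    also have "\<dots> < e" by (rule elim(1))
    finally have "(\<Sum>k=1..<Suc (n * K). g k * sqrt \<bar>s k - s n\<bar>) / scale n < e" .
    moreover have "0 \<le> (\<Sum>k=1..<Suc (n * K). g k * sqrt \<bar>s k - s n\<bar>) / scale n"
      using scale by (intro divide_nonneg_nonneg sum_nonneg mult_nonneg_nonneg g_nonneg) auto
    ultimately show ?case by simp
  qed
  then show "\<exists>no. \<forall>n\<ge>no. norm ((\<Sum>k=1..<Suc (n * K). g k * sqrt \<bar>s k - s n\<bar>) / scale n - 0) < e"
    by (simp add: eventually_sequentially)
qed

text \<open>Three sources of error: the martingale \<open>R\<close>, the freezing of
  \<open>MM\<close> at time \<open>n\<close>, and the distance of the deterministic factor from
  \<open>\<sigma> * sqrt t\<close>.\<close>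

lemma path_difference:
  assumes n: "n > 1" and t: "0 \<le> t" "t \<le> real K"
  shows "\<bar>S (nat \<lfloor>real n * t\<rfloor>) \<omega> / scale n - sqrt t * V n \<omega>\<bar>
    \<le> \<bar>R (nat \<lfloor>real n * t\<rfloor>) \<omega>\<bar> / scale n + err K n \<omega>
      + \<bar>MM n \<omega> / sqrt (s n)\<bar> * \<bar>p * G (nat \<lfloor>real n * t\<rfloor>) * sqrt (s n) / scale n - \<sigma> * sqrt t\<bar>"
proof -
  let ?m = "nat \<lfloor>real n * t\<rfloor>"
  have scale: "scale n > 0" using n by simp
  have sn: "s n > 0" using n by (intro s_pos) simp
  have m: "?m \<le> n * K"
  proof -
    have "real n * t \<le> real (n * K)" using t by (simp add: mult_left_mono)
    then show ?thesis by linarith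
  qed
  have S_eq: "S ?m \<omega> = R ?m \<omega> + p * (\<Sum>k=1..<?m. g k * (MM k \<omega> - MM n \<omega>)) + p * G ?m * MM n \<omega>"
  proof -
    have eq: "(\<Sum>k=1..<?m. g k * (MM k \<omega> - MM n \<omega>)) = (\<Sum>k=1..<?m. g k * MM k \<omega>) - G ?m * MM n \<omega>"
      by (simp add: G_def right_diff_distrib sum_subtractf sum_distrib_right)
    show ?thesis unfolding S_decomposition eq by (simp only: right_diff_distrib mult.assoc)
  qed
  have split: "(x + y + z * v) / c - b * (\<sigma> * (v / r)) = x / c + y / c + v / r * (z * r / c - \<sigma> * b)"
    if "r > 0" for x y z v c b r :: real
    using that by (cases "c = 0") (simp_all add: field_simps)
  have eq: "S ?m \<omega> / scale n - sqrt t * V n \<omega> = R ?m \<omega> / scale n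
      + p * (\<Sum>k=1..<?m. g k * (MM k \<omega> - MM n \<omega>)) / scale n
      + (MM n \<omega> / sqrt (s n)) * (p * G ?m * sqrt (s n) / scale n - \<sigma> * sqrt t)"
    unfolding S_eq V_def by (rule split) (use sn in simp)
  have "\<bar>S ?m \<omega> / scale n - sqrt t * V n \<omega>\<bar> \<le> \<bar>R ?m \<omega> / scale n\<bar> + \<bar>p * (\<Sum>k=1..<?m. g k * (MM k \<omega> - MM n \<omega>)) / scale n\<bar>
      + \<bar>(MM n \<omega> / sqrt (s n)) * (p * G ?m * sqrt (s n) / scale n - \<sigma> * sqrt t)\<bar>"
    unfolding eq by (rule order.trans[OF abs_triangle_ineq add_right_mono[OF abs_triangle_ineq]])
  moreover have "\<bar>R ?m \<omega> / scale n\<bar> = \<bar>R ?m \<omega>\<bar> / scale n" using scale by simp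
  moreover have "\<bar>(MM n \<omega> / sqrt (s n)) * (p * G ?m * sqrt (s n) / scale n - \<sigma> * sqrt t)\<bar>
      = \<bar>MM n \<omega> / sqrt (s n)\<bar> * \<bar>p * G ?m * sqrt (s n) / scale n - \<sigma> * sqrt t\<bar>" by (rule abs_mult)
  moreover have "\<bar>p * (\<Sum>k=1..<?m. g k * (MM k \<omega> - MM n \<omega>)) / scale n\<bar> \<le> err K n \<omega>"
  proof -
    have "\<bar>\<Sum>k=1..<?m. g k * (MM k \<omega> - MM n \<omega>)\<bar> \<le> (\<Sum>k=1..<?m. g k * \<bar>MM k \<omega> - MM n \<omega>\<bar>)"
      by (rule order.trans[OF sum_abs]) (simp add: abs_mult g_nonneg)
    also have "\<dots> \<le> (\<Sum>k=1..<Suc (n * K). g k * \<bar>MM k \<omega> - MM n \<omega>\<bar>)"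
      using m by (intro sum_mono2) (auto simp: g_nonneg)
    finally have "p * \<bar>\<Sum>k=1..<?m. g k * (MM k \<omega> - MM n \<omega>)\<bar> / scale n \<le> err K n \<omega>"
      unfolding err_def using p_nonneg scale by (intro divide_right_mono mult_left_mono) auto
    then show ?thesis using p_nonneg scale by (simp add: abs_mult)
  qed
  ultimately show ?thesis by linarith
qed

proposition path_approximation:
  assumes \<eta>: "\<eta> > 0" and \<delta>: "\<delta> > 0" and K: "1 \<le> K"
  shows "\<exists>E. (\<forall>n. E n \<in> events) \<and> (\<forall>\<^sub>F n in sequentially. prob (E n) \<le> \<eta>) \<and>
    (\<forall>\<^sub>F n in sequentially. \<forall>\<omega>\<in>space M - E n. \<forall>t\<in>{0..real K}.
      \<bar>S (nat \<lfloor>real n * t\<rfloor>) \<omega> / scale n - sqrt t * V n \<omega>\<bar> < \<delta>)"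
proof -
  \<comment> \<open>Chebyshev's inequality with second moment at most 1 then gives
    \<open>E3 n\<close> probability at most \<open>1 / L\<^sup>2 = \<eta> / 3\<close>.\<close>
  define L where "L = sqrt (3 / \<eta>)"
  have L: "L > 0" "1 / L\<^sup>2 = \<eta> / 3" using \<eta> by (auto simp: L_def)
  define E1 where "E1 n = {\<omega>\<in>space M. \<exists>k\<le>n * K. \<delta> / 3 * scale n \<le> \<bar>R k \<omega>\<bar>}" for n
  define E2 where "E2 n = {\<omega>\<in>space M. \<delta> / 3 \<le> err K n \<omega>}" for n
  define E3 where "E3 n = {\<omega>\<in>space M. L \<le> \<bar>MM n \<omega> / sqrt (s n)\<bar>}" for n
  have ev: "E1 n \<in> events" "E2 n \<in> events" "E3 n \<in> events" for n
  proof -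
    have "E1 n = (\<Union>k\<in>{..n * K}. {\<omega>\<in>space M. \<delta> / 3 * scale n \<le> \<bar>R k \<omega>\<bar>})" by (auto simp: E1_def)
    also have "\<dots> \<in> events" by (intro sets.finite_UN) auto
    finally show "E1 n \<in> events" .
  qed (simp_all add: E2_def E3_def)
  have p3: "prob (E3 n) \<le> \<eta> / 3" for n
  proof -
    have "prob (E3 n) \<le> expectation (\<lambda>\<omega>. (MM n \<omega> / sqrt (s n))\<^sup>2) / L\<^sup>2"
      unfolding E3_def by (rule markov_square) (use L MM_normalised in auto)
    also have "\<dots> \<le> 1 / L\<^sup>2" using MM_normalised by (intro divide_right_mono) auto
    finally show ?thesis using L by simp
  qed
  have "(\<lambda>n. p * ((\<Sum>k=1..<Suc (n * K). g k * sqrt \<bar>s k - s n\<bar>) / scale n) / (\<delta> / 3)) \<longlonglongrightarrow> p * 0 / (\<delta> / 3)"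
    using \<delta> by (intro tendsto_intros weighted_fluctuation[OF K]) auto
  then have "\<forall>\<^sub>F n in sequentially. p * ((\<Sum>k=1..<Suc (n * K). g k * sqrt \<bar>s k - s n\<bar>) / scale n) / (\<delta> / 3) < \<eta> / 3"
    by (rule order_tendstoD) (use \<eta> in simp)
  then have p2: "\<forall>\<^sub>F n in sequentially. prob (E2 n) \<le> \<eta> / 3"
  proof eventually_elim
    case (elim n)
    have "prob (E2 n) \<le> expectation (err K n) / (\<delta> / 3)"
      unfolding E2_def using integral_Markov_inequality_measure[OF err_integrable sets.top, of K n "\<delta> / 3"] \<delta>
      by (simp add: err_nonneg)
    also have "\<dots> \<le> p * (\<Sum>k=1..<Suc (n * K). g k * sqrt \<bar>s k - s n\<bar>) / scale n / (\<delta> / 3)"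
      using \<delta> by (intro divide_right_mono err_expectation) auto
    finally show ?case using elim by simp
  qed
  \<comment> \<open>Doob's bound for \<open>E1 n\<close>: the second moment \<open>n * K\<close>
    against a squared level of order \<open>n * ln n\<close> leaves a factor
    \<open>1 / ln n\<close>.\<close>
  have "(\<lambda>n. real K / ((\<delta> / 3)\<^sup>2 * ln (real n))) \<longlonglongrightarrow> 0" using \<delta> by real_asymp
  then have "\<forall>\<^sub>F n in sequentially. real K / ((\<delta> / 3)\<^sup>2 * ln (real n)) < \<eta> / 3"
    by (rule order_tendstoD) (use \<eta> in simp)
  then have p1: "\<forall>\<^sub>F n in sequentially. prob (E1 n) \<le> \<eta> / 3"
    using eventually_gt_at_top[of 1]
  proof eventually_elim
    case (elim n)
    have "prob (E1 n) \<le> expectation (\<lambda>\<omega>. (R (n * K) \<omega>)\<^sup>2) / (\<delta> / 3 * scale n)\<^sup>2"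
      unfolding E1_def by (rule RM.doob_maximal_inequality) (use \<delta> elim in simp)
    also have "\<dots> \<le> real (n * K) / (\<delta> / 3 * scale n)\<^sup>2"
      by (intro divide_right_mono R_second_moment) simp
    also have "\<dots> = real K / ((\<delta> / 3)\<^sup>2 * ln (real n))"
    proof -
      have "(scale n)\<^sup>2 = real n * ln (real n)" using elim by simp
      then show ?thesis unfolding power_mult_distrib using elim by simp
    qed
    finally show ?case using elim by linarith
  qed
  \<comment> \<open>Off \<open>E3 n\<close> this distance is multiplied by at most \<open>L\<close>,
    hence the division by \<open>L\<close>.\<close>
  have KK: "\<forall>\<^sub>F n in sequentially. \<forall>t\<in>{0..real K}. dist (p * G (nat \<lfloor>real n * t\<rfloor>) * sqrt (s n) / scale n) (\<sigma> * sqrt t) < \<delta> / 3 / L"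
    using G_uniform[of "real K"] K \<delta> L by (intro uniform_limitD) auto
  show ?thesis
  proof (intro exI[of _ "\<lambda>n. E1 n \<union> E2 n \<union> E3 n"] conjI)
    show "\<forall>n. E1 n \<union> E2 n \<union> E3 n \<in> events" using ev by auto
    show "\<forall>\<^sub>F n in sequentially. prob (E1 n \<union> E2 n \<union> E3 n) \<le> \<eta>"
      using p1 p2
    proof eventually_elim
      case (elim n)
      have "prob (E1 n \<union> E2 n \<union> E3 n) \<le> prob (E1 n \<union> E2 n) + prob (E3 n)"
        using ev by (intro measure_Un_le sets.Un)
      moreover have "prob (E1 n \<union> E2 n) \<le> prob (E1 n) + prob (E2 n)"
        using ev by (intro measure_Un_le)
      ultimately have "prob (E1 n \<union> E2 n \<union> E3 n) \<le> prob (E1 n) + prob (E2 n) + prob (E3 n)" by linarith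
      then show ?case using elim p3[of n] by linarith
    qed
    show "\<forall>\<^sub>F n in sequentially. \<forall>\<omega>\<in>space M - (E1 n \<union> E2 n \<union> E3 n). \<forall>t\<in>{0..real K}.
      \<bar>S (nat \<lfloor>real n * t\<rfloor>) \<omega> / scale n - sqrt t * V n \<omega>\<bar> < \<delta>"
      using KK eventually_gt_at_top[of 1]
    proof eventually_elim
      case (elim n)
      show ?case
      proof (intro ballI)
        fix \<omega> t assume w: "\<omega> \<in> space M - (E1 n \<union> E2 n \<union> E3 n)" and t: "t \<in> {0..real K}"
        let ?m = "nat \<lfloor>real n * t\<rfloor>"
        have wM: "\<omega> \<in> space M" and wE: "\<omega> \<notin> E1 n" "\<omega> \<notin> E2 n" "\<omega> \<notin> E3 n" using w by auto
        have scale: "scale n > 0" using elim(2) by simp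
        have "?m \<le> n * K"
        proof -
          have "real n * t \<le> real (n * K)" using t by (simp add: mult_left_mono)
          then show ?thesis by linarith
        qed
        then have "\<omega> \<in> E1 n" if "\<delta> / 3 * scale n \<le> \<bar>R ?m \<omega>\<bar>"
          unfolding E1_def using wM that by (intro CollectI conjI exI[of _ ?m])
        with wE(1) have "\<not> \<delta> / 3 * scale n \<le> \<bar>R ?m \<omega>\<bar>" by (rule contrapos_nn)
        then have "\<bar>R ?m \<omega>\<bar> < \<delta> / 3 * scale n" by (simp only: not_le)
        then have 1: "\<bar>R ?m \<omega>\<bar> / scale n < \<delta> / 3" using scale by (simp add: pos_divide_less_eq)
        have 2: "err K n \<omega> < \<delta> / 3" using wE(2) wM by (simp add: E2_def)
        have "\<bar>MM n \<omega> / sqrt (s n)\<bar> * \<bar>p * G ?m * sqrt (s n) / scale n - \<sigma> * sqrt t\<bar> \<le> L * (\<delta> / 3 / L)"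
        proof (intro mult_mono)
          show "\<bar>MM n \<omega> / sqrt (s n)\<bar> \<le> L" using wE(3) wM by (simp add: E3_def)
          show "\<bar>p * G ?m * sqrt (s n) / scale n - \<sigma> * sqrt t\<bar> \<le> \<delta> / 3 / L"
            using bspec[OF elim(1) t] by (simp add: dist_real_def)
        qed (use L in simp_all)
        then have 3: "\<bar>MM n \<omega> / sqrt (s n)\<bar> * \<bar>p * G ?m * sqrt (s n) / scale n - \<sigma> * sqrt t\<bar> \<le> \<delta> / 3"
          using L by simp
        show "\<bar>S ?m \<omega> / scale n - sqrt t * V n \<omega>\<bar> < \<delta>"
        proof -
          have "0 \<le> t" "t \<le> real K" using t by auto
          from path_difference[OF elim(2) this, of \<omega>] 1 2 3 show ?thesis by linarith
        qed
      qed
    qed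
  qed
qed

end

section \<open>Convergence in the Skorohod space\<close>

lemma skorohod_conv_uniform:
  assumes "\<And>T. uniform_limit {0..T} x y sequentially"
  shows "skorohod_conv x y"
  unfolding skorohod_conv_def
proof (intro exI[of _ "\<lambda>_ t. t"] conjI allI)
  show "time_change (\<lambda>t. t)"
    by (auto simp: time_change_def strict_mono_on_def bij_betw_def)
  show "uniform_limit {0..} (\<lambda>_ t. t) (\<lambda>t. t :: real) sequentially"
    by (rule uniform_limitI) simp
qed (rule assms)

lemma continuous_map_skorohod_sequentially:
  assumes \<Phi>: "continuous_map skorohod_topology euclideanreal \<Phi>"
    and x: "\<And>n. x n \<in> skorohod_space" and y: "y \<in> skorohod_space" and "skorohod_conv x y"
  shows "(\<lambda>n. \<Phi> (x n)) \<longlonglongrightarrow> \<Phi> y"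
proof (rule topological_tendstoI)
  fix W :: "real set" assume W: "open W" "\<Phi> y \<in> W"
  have "openin skorohod_topology {z \<in> topspace skorohod_topology. \<Phi> z \<in> W}"
    by (rule openin_continuous_map_preimage[OF \<Phi>]) (use W in simp)
  then have "\<forall>x y. y \<in> {z \<in> skorohod_space. \<Phi> z \<in> W} \<longrightarrow> (\<forall>n. x n \<in> skorohod_space) \<longrightarrow> skorohod_conv x y \<longrightarrow>
      (\<forall>\<^sub>F n in sequentially. x n \<in> {z \<in> skorohod_space. \<Phi> z \<in> W})"
    unfolding openin_skorohod_topology topspace_skorohod_topology by (rule conjunct2)
  then have "\<forall>\<^sub>F n in sequentially. x n \<in> {z \<in> skorohod_space. \<Phi> z \<in> W}"
    using assms W by blast
  then show "\<forall>\<^sub>F n in sequentially. \<Phi> (x n) \<in> W" by eventually_elim simp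
qed

lemma measurable_borel_of:
  assumes "f \<in> space M \<rightarrow> topspace T" "\<And>U. openin T U \<Longrightarrow> f -` U \<inter> space M \<in> sets M"
  shows "f \<in> M \<rightarrow>\<^sub>M borel_of T"
  unfolding borel_of_def using assms by (intro measurable_measure_of) (auto dest: openin_subset)

lemma continuous_map_borel_of:
  assumes "continuous_map T euclideanreal \<Phi>" shows "\<Phi> \<in> borel_measurable (borel_of T)"
proof (rule borel_measurableI)
  fix W :: "real set" assume "open W"
  then have "openin T {z \<in> topspace T. \<Phi> z \<in> W}"
    by (intro openin_continuous_map_preimage[OF assms]) simp
  moreover have "space (borel_of T) = topspace T"
    unfolding borel_of_def by (rule space_measure_of) (auto dest: openin_subset)
  moreover have "sets (borel_of T) = sigma_sets (topspace T) {U. openin T U}"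
    unfolding borel_of_def by (rule sets_measure_of) (auto dest: openin_subset)
  ultimately show "\<Phi> -` W \<inter> space (borel_of T) \<in> sets (borel_of T)"
    by (auto intro!: sigma_sets.Basic simp: vimage_def Int_def conj_commute)
qed

text \<open>The random path is a function \<open>\<psi>\<close> of a random point of a metric space,
  where closed sets are determined by sequences; sequential continuity of \<open>\<psi>\<close> thus
  makes preimages of open sets open.\<close>

lemma measurable_into_skorohod:
  fixes \<psi> :: "'c::metric_space \<Rightarrow> real \<Rightarrow> real"
  assumes D: "\<And>u. \<psi> u \<in> skorohod_space"
    and cont: "\<And>u v. u \<longlonglongrightarrow> v \<Longrightarrow> skorohod_conv (\<lambda>k. \<psi> (u k)) (\<psi> v)"
    and f: "f \<in> borel_measurable M"
  shows "(\<lambda>\<omega>. \<psi> (f \<omega>)) \<in> M \<rightarrow>\<^sub>M borel_of skorohod_topology"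
proof (rule measurable_borel_of)
  fix U assume U: "openin skorohod_topology U"
  then have U': "\<forall>x y. y \<in> U \<longrightarrow> (\<forall>n. x n \<in> skorohod_space) \<longrightarrow> skorohod_conv x y \<longrightarrow>
      (\<forall>\<^sub>F n in sequentially. x n \<in> U)"
    unfolding openin_skorohod_topology by (rule conjunct2)
  have "closed (- (\<psi> -` U))"
    unfolding closed_sequential_limits
  proof (intro allI impI, elim conjE)
    fix u v assume u: "\<forall>n. u n \<in> - (\<psi> -` U)" "u \<longlonglongrightarrow> v"
    show "v \<in> - (\<psi> -` U)"
    proof
      assume "v \<in> \<psi> -` U"
      then have "\<forall>\<^sub>F k in sequentially. \<psi> (u k) \<in> U"
        using U'[rule_format, of "\<psi> v" "\<lambda>k. \<psi> (u k)"] D cont[OF u(2)] by simp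
      then show False using u(1) by (auto simp: eventually_sequentially)
    qed
  qed
  then have "open (\<psi> -` U)" by (simp add: closed_def)
  then have "f -` (\<psi> -` U) \<inter> space M \<in> sets M" using f by (intro measurable_sets) auto
  then show "(\<lambda>\<omega>. \<psi> (f \<omega>)) -` U \<inter> space M \<in> sets M" by (simp add: vimage_def)
qed (use D in simp)

lemma floor_eventually_right:
  assumes "c \<ge> 0" shows "\<forall>\<^sub>F r in at_right t. \<lfloor>c * r\<rfloor> = \<lfloor>c * t :: real\<rfloor>"
proof (cases "c = 0")
  case False
  with assms have c: "c > 0" by simp
  have "t < (real_of_int \<lfloor>c * t\<rfloor> + 1) / c"
    using c by (simp add: pos_less_divide_eq mult.commute)
  moreover have "\<lfloor>c * r\<rfloor> = \<lfloor>c * t\<rfloor>" if "t < r" "r < (real_of_int \<lfloor>c * t\<rfloor> + 1) / c" for r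
  proof (rule floor_unique)
    have "c * t \<le> c * r" using c that by simp
    then show "real_of_int \<lfloor>c * t\<rfloor> \<le> c * r" by (rule order.trans[OF of_int_floor_le])
    show "c * r < real_of_int \<lfloor>c * t\<rfloor> + 1" using c that by (simp add: pos_less_divide_eq mult.commute)
  qed
  ultimately show ?thesis unfolding eventually_at_right_field by blast
qed simp

lemma floor_eventually_left:
  assumes "c > 0" shows "\<forall>\<^sub>F r in at_left t. \<lfloor>c * r\<rfloor> = \<lceil>c * t :: real\<rceil> - 1"
proof -
  have "(real_of_int \<lceil>c * t\<rceil> - 1) / c < t"
    using assms ceiling_correct[of "c * t"] by (simp add: pos_divide_less_eq mult.commute)
  moreover have "\<lfloor>c * r\<rfloor> = \<lceil>c * t\<rceil> - 1" if "(real_of_int \<lceil>c * t\<rceil> - 1) / c < r" "r < t" for r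
  proof (rule floor_unique)
    show "real_of_int (\<lceil>c * t\<rceil> - 1) \<le> c * r" using assms that by (simp add: pos_divide_less_eq mult.commute)
    have "c * r < c * t" using assms that by simp
    then have "c * r < real_of_int \<lceil>c * t\<rceil>" using le_of_int_ceiling[of "c * t"] by linarith
    then show "c * r < real_of_int (\<lceil>c * t\<rceil> - 1) + 1" by simp
  qed
  ultimately show ?thesis unfolding eventually_at_left_field by blast
qed

text \<open>Taken as a function of the whole sequence \<open>u\<close>, so that measurability
  follows from continuity in the product topology.\<close>

definition scaled_path :: "nat \<Rightarrow> real \<Rightarrow> (nat \<Rightarrow> real) \<Rightarrow> real \<Rightarrow> real" where
  "scaled_path n c u = (\<lambda>t\<in>{0..}. u (nat \<lfloor>real n * t\<rfloor>) / c)"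

lemma scaled_path_skorohod: "scaled_path n c u \<in> skorohod_space"
  unfolding skorohod_space_def
proof (intro CollectI conjI allI impI)
  show "scaled_path n c u \<in> extensional {0..}" by (simp add: scaled_path_def)
  fix t :: real
  assume t: "0 \<le> t"
  have "\<forall>\<^sub>F r in at_right t. scaled_path n c u r = scaled_path n c u t"
    using floor_eventually_right[OF of_nat_0_le_iff[of n]] eventually_at_right_less[of t]
    by eventually_elim (use t in \<open>auto simp: scaled_path_def\<close>)
  then show "(scaled_path n c u \<longlongrightarrow> scaled_path n c u t) (at_right t)" by (rule tendsto_eventually)
next
  fix t :: real
  assume t: "0 < t"
  show "\<exists>l. (scaled_path n c u \<longlongrightarrow> l) (at_left t)"
  proof (cases "n = 0")
    case True
    have "\<forall>\<^sub>F r in at_left t. scaled_path n c u r = u 0 / c"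
      using eventually_at_left_field[of _ t] t True by (auto simp: scaled_path_def intro!: exI[of _ 0])
    then show ?thesis by (intro exI tendsto_eventually)
  next
    case False
    have "\<forall>\<^sub>F r in at_left t. 0 < r" unfolding eventually_at_left_field using t by blast
    moreover have "\<forall>\<^sub>F r in at_left t. \<lfloor>real n * r\<rfloor> = \<lceil>real n * t\<rceil> - 1"
      using False by (intro floor_eventually_left) simp
    ultimately have "\<forall>\<^sub>F r in at_left t. scaled_path n c u r = u (nat (\<lceil>real n * t\<rceil> - 1)) / c"
      by eventually_elim (simp add: scaled_path_def)
    then show ?thesis by (intro exI tendsto_eventually)
  qed
qed

text \<open>Up to time \<open>T\<close> the path involves finitely many coordinates of the sequence,
  so their convergence is uniform there.\<close>

lemma scaled_path_continuous:
  fixes u :: "nat \<Rightarrow> nat \<Rightarrow> real"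
  assumes "u \<longlonglongrightarrow> v" shows "skorohod_conv (\<lambda>k. scaled_path n c (u k)) (scaled_path n c v)"
proof (rule skorohod_conv_uniform, rule uniform_limitI)
  fix T e :: real assume e: "e > 0"
  have "(\<lambda>k. u k m / c) \<longlonglongrightarrow> v m / c" for m
  proof -
    have "(\<lambda>k. u k m) \<longlonglongrightarrow> v m"
      using continuous_on_tendsto_compose[OF continuous_on_product_coordinates assms] by simp
    then show ?thesis unfolding divide_inverse by (intro tendsto_intros)
  qed
  then have "\<forall>\<^sub>F k in sequentially. \<forall>m\<in>{..nat \<lfloor>real n * T\<rfloor>}. dist (u k m / c) (v m / c) < e"
    by (intro eventually_ball_finite ballI tendstoD e) auto
  then show "\<forall>\<^sub>F k in sequentially. \<forall>t\<in>{0..T}. dist (scaled_path n c (u k) t) (scaled_path n c v t) < e"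
  proof eventually_elim
    case (elim k)
    show ?case
    proof
      fix t assume t: "t \<in> {0..T}"
      then have "nat \<lfloor>real n * t\<rfloor> \<le> nat \<lfloor>real n * T\<rfloor>" by (intro nat_mono floor_mono mult_left_mono) auto
      then show "dist (scaled_path n c (u k) t) (scaled_path n c v t) < e"
        using elim t by (simp add: scaled_path_def)
    qed
  qed
qed

definition sqrt_path :: "real \<Rightarrow> real \<Rightarrow> real" where
  "sqrt_path v = (\<lambda>t\<in>{0..}. sqrt t * v)"

lemma sqrt_path_skorohod: "sqrt_path v \<in> skorohod_space"
  unfolding skorohod_space_def
proof (intro CollectI conjI allI impI)
  show "sqrt_path v \<in> extensional {0..}" by (simp add: sqrt_path_def)
  have lim: "((\<lambda>r. sqrt r * v) \<longlongrightarrow> sqrt t * v) (at t within A)" for t A by (intro tendsto_intros)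
  fix t :: real
  assume t: "0 \<le> t"
  have "\<forall>\<^sub>F r in at_right t. sqrt r * v = sqrt_path v r"
    using eventually_at_right_less[of t] by eventually_elim (use t in \<open>auto simp: sqrt_path_def\<close>)
  moreover have "sqrt_path v t = sqrt t * v" using t by (simp add: sqrt_path_def)
  ultimately show "(sqrt_path v \<longlongrightarrow> sqrt_path v t) (at_right t)"
    using Lim_transform_eventually[OF lim] by metis
next
  have lim: "((\<lambda>r. sqrt r * v) \<longlongrightarrow> sqrt t * v) (at t within A)" for t A by (intro tendsto_intros)
  fix t :: real
  assume t: "0 < t"
  have "\<forall>\<^sub>F r in at_left t. 0 < r" unfolding eventually_at_left_field using t by blast
  then have "\<forall>\<^sub>F r in at_left t. sqrt r * v = sqrt_path v r"
    by eventually_elim (auto simp: sqrt_path_def)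
  from Lim_transform_eventually[OF lim this] show "\<exists>l. (sqrt_path v \<longlongrightarrow> l) (at_left t)" by blast
qed

lemma sqrt_path_uniform:
  fixes u :: "nat \<Rightarrow> real"
  assumes "u \<longlonglongrightarrow> v" shows "uniform_limit {0..T} (\<lambda>k. sqrt_path (u k)) (sqrt_path v) sequentially"
proof (rule uniform_limitI)
  fix e :: real assume e: "e > 0"
  have "(\<lambda>k. sqrt \<bar>T\<bar> * \<bar>u k - v\<bar>) \<longlonglongrightarrow> sqrt \<bar>T\<bar> * \<bar>v - v\<bar>"
    by (intro tendsto_intros assms)
  then have "\<forall>\<^sub>F k in sequentially. sqrt \<bar>T\<bar> * \<bar>u k - v\<bar> < e"
    by (rule order_tendstoD) (use e in simp)
  then show "\<forall>\<^sub>F k in sequentially. \<forall>t\<in>{0..T}. dist (sqrt_path (u k) t) (sqrt_path v t) < e"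
  proof eventually_elim
    case (elim k)
    show ?case
    proof
      fix t assume t: "t \<in> {0..T}"
      then have "dist (sqrt_path (u k) t) (sqrt_path v t) = sqrt t * \<bar>u k - v\<bar>"
        by (simp add: sqrt_path_def dist_real_def abs_mult flip: right_diff_distrib)
      also have "\<dots> \<le> sqrt \<bar>T\<bar> * \<bar>u k - v\<bar>" using t by (intro mult_right_mono) auto
      finally show "dist (sqrt_path (u k) t) (sqrt_path v t) < e" using elim by simp
    qed
  qed
qed

lemma sqrt_path_continuous:
  fixes u :: "nat \<Rightarrow> real"
  assumes "u \<longlonglongrightarrow> v" shows "skorohod_conv (\<lambda>k. sqrt_path (u k)) (sqrt_path v)"
  by (rule skorohod_conv_uniform) (rule sqrt_path_uniform[OF assms])

text \<open>The paths \<open>sqrt_path v\<close> with \<open>v\<close> bounded form a compact set, near which a continuous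
  functional is uniformly continuous.\<close>

lemma uniform_near_sqrt_paths:
  assumes \<Phi>: "continuous_map skorohod_topology euclideanreal \<Phi>" and e: "e > 0"
  shows "\<exists>K::nat. \<exists>\<delta>>0. 1 \<le> K \<and> (\<forall>v x. \<bar>v\<bar> \<le> L \<longrightarrow> x \<in> skorohod_space \<longrightarrow>
    (\<forall>t\<in>{0..real K}. \<bar>x t - sqrt t * v\<bar> < \<delta>) \<longrightarrow> \<bar>\<Phi> x - \<Phi> (sqrt_path v)\<bar> < e)"
proof (rule ccontr)
  assume neg: "\<not> ?thesis"
  \<comment> \<open>Counterexamples to the choices \<open>K = Suc k\<close> and
    \<open>\<delta> = 1 / Suc k\<close>.\<close>
  have "\<exists>v x. \<bar>v\<bar> \<le> L \<and> x \<in> skorohod_space \<and> (\<forall>t\<in>{0..real (Suc k)}. \<bar>x t - sqrt t * v\<bar> < 1 / real (Suc k))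
      \<and> e \<le> \<bar>\<Phi> x - \<Phi> (sqrt_path v)\<bar>" for k :: nat
  proof (rule ccontr)
    assume c: "\<not> ?thesis"
    have c': "\<bar>\<Phi> x - \<Phi> (sqrt_path v)\<bar> < e"
      if "\<bar>v\<bar> \<le> L" "x \<in> skorohod_space" "\<forall>t\<in>{0..real (Suc k)}. \<bar>x t - sqrt t * v\<bar> < 1 / real (Suc k)" for v x
      using c that not_le by blast
    have "0 < 1 / real (Suc k)" "1 \<le> Suc k" by simp_all
    with c' have "\<exists>K::nat. \<exists>\<delta>>0. 1 \<le> K \<and> (\<forall>v x. \<bar>v\<bar> \<le> L \<longrightarrow> x \<in> skorohod_space \<longrightarrow>
      (\<forall>t\<in>{0..real K}. \<bar>x t - sqrt t * v\<bar> < \<delta>) \<longrightarrow> \<bar>\<Phi> x - \<Phi> (sqrt_path v)\<bar> < e)" by blast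
    with neg show False by (rule notE)
  qed
  then obtain v x where vx: "\<And>k. \<bar>v k\<bar> \<le> L" "\<And>k. x k \<in> skorohod_space"
      "\<And>k t. t \<in> {0..real (Suc k)} \<Longrightarrow> \<bar>x k t - sqrt t * v k\<bar> < 1 / real (Suc k)"
      "\<And>k. e \<le> \<bar>\<Phi> (x k) - \<Phi> (sqrt_path (v k))\<bar>"
    by metis
  \<comment> \<open>Along a subsequence the bounded \<open>v\<close> converge to some
    \<open>l\<close>. Then \<open>x\<close> and the paths \<open>sqrt_path v\<close> both tend to
    \<open>sqrt_path l\<close>, where \<open>\<Phi>\<close> cannot separate them by
    \<open>e\<close>.\<close>
  have "compact {-L..L}" by simp
  moreover have "\<forall>k. v k \<in> {-L..L}" using vx(1) by (auto simp: abs_le_iff minus_le_iff)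
  ultimately obtain l r where r: "strict_mono r" "(v \<circ> r) \<longlonglongrightarrow> l"
    unfolding compact_def by blast
  then have vr: "(\<lambda>k. v (r k)) \<longlonglongrightarrow> l" by (simp add: comp_def)
  have "uniform_limit {0..T} (\<lambda>k. x (r k)) (sqrt_path l) sequentially" for T
  proof (rule uniform_limitI)
    fix d :: real assume d: "d > 0"
    have "\<forall>\<^sub>F k in sequentially. \<forall>t\<in>{0..T}. dist (sqrt_path (v (r k)) t) (sqrt_path l t) < d / 2"
      using d by (intro uniform_limitD[OF sqrt_path_uniform[OF vr]]) simp
    moreover have "\<forall>\<^sub>F k in sequentially. real (Suc k) \<ge> T" by real_asymp
    moreover have "(\<lambda>k. 1 / real (Suc k)) \<longlonglongrightarrow> 0" by real_asymp
    then have "\<forall>\<^sub>F k in sequentially. 1 / real (Suc k) < d / 2" by (rule order_tendstoD) (use d in simp)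
    ultimately show "\<forall>\<^sub>F k in sequentially. \<forall>t\<in>{0..T}. dist (x (r k) t) (sqrt_path l t) < d"
    proof eventually_elim
      case (elim k)
      have rk: "real (Suc k) \<le> real (Suc (r k))" using seq_suble[OF r(1), of k] by simp
      show ?case
      proof
        fix t assume t: "t \<in> {0..T}"
        have "\<bar>x (r k) t - sqrt t * v (r k)\<bar> < 1 / real (Suc (r k))"
          by (rule vx(3)) (use t elim(2) rk in auto)
        also have "\<dots> \<le> 1 / real (Suc k)" using rk by (intro divide_left_mono) auto
        finally have "\<bar>x (r k) t - sqrt_path (v (r k)) t\<bar> < d / 2" using elim(3) t by (simp add: sqrt_path_def)
        moreover have "\<bar>sqrt_path (v (r k)) t - sqrt_path l t\<bar> < d / 2" using bspec[OF elim(1) t] by (simp add: dist_real_def)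
        ultimately show "dist (x (r k) t) (sqrt_path l t) < d" unfolding dist_real_def by linarith
      qed
    qed
  qed
  then have "skorohod_conv (\<lambda>k. x (r k)) (sqrt_path l)" by (rule skorohod_conv_uniform)
  from continuous_map_skorohod_sequentially[OF \<Phi> vx(2) sqrt_path_skorohod this]
    continuous_map_skorohod_sequentially[OF \<Phi> sqrt_path_skorohod sqrt_path_skorohod sqrt_path_continuous[OF vr]]
  have "(\<lambda>k. \<bar>\<Phi> (x (r k)) - \<Phi> (sqrt_path (v (r k)))\<bar>) \<longlonglongrightarrow> \<bar>\<Phi> (sqrt_path l) - \<Phi> (sqrt_path l)\<bar>"
    by (intro tendsto_intros)
  then have "(\<lambda>k. \<bar>\<Phi> (x (r k)) - \<Phi> (sqrt_path (v (r k)))\<bar>) \<longlonglongrightarrow> 0" by simp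
  then have "e \<le> 0" by (rule LIMSEQ_le_const) (use vx(4) in blast)
  then show False using e by simp
qed

text \<open>The substitution \<open>y = \<sigma> * z\<close>; the point mass at 0, which is the
  limit law when \<open>p = 0\<close>, is a case of its own.\<close>

lemma integral_centered_gaussian:
  fixes f :: "real \<Rightarrow> real"
  assumes [measurable]: "f \<in> borel_measurable borel" and "\<sigma> \<ge> 0"
  shows "integral\<^sup>L (centered_gaussian (\<sigma>\<^sup>2)) f = integral\<^sup>L std_normal_distribution (\<lambda>z. f (\<sigma> * z))"
proof (cases "\<sigma> = 0")
  case True
  interpret prob_space std_normal_distribution by (rule prob_space_normal_density) simp
  show ?thesis using True prob_space by (simp add: centered_gaussian_def integral_return)
next
  case False
  with assms(2) have \<sigma>: "\<sigma> > 0" by simp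
  have "integral\<^sup>L (centered_gaussian (\<sigma>\<^sup>2)) f = integral\<^sup>L lborel (\<lambda>y. normal_density 0 \<sigma> y * f y)"
    using \<sigma> by (simp add: centered_gaussian_def integral_density)
  also have "\<dots> = \<sigma> * integral\<^sup>L lborel (\<lambda>z. normal_density 0 \<sigma> (\<sigma> * z) * f (\<sigma> * z))"
    using lborel_integral_real_affine[of \<sigma> "\<lambda>y. normal_density 0 \<sigma> y * f y" 0] \<sigma> by simp
  also have "\<dots> = integral\<^sup>L lborel (\<lambda>z. \<sigma> * (normal_density 0 \<sigma> (\<sigma> * z) * f (\<sigma> * z)))" by simp
  also have "\<dots> = integral\<^sup>L lborel (\<lambda>z. std_normal_density z * f (\<sigma> * z))"
  proof (intro Bochner_Integration.integral_cong refl)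
    fix z
    have "\<sigma> * normal_density 0 \<sigma> (\<sigma> * z) = std_normal_density z"
      using \<sigma> by (simp add: normal_density_def power_mult_distrib real_sqrt_mult)
    then show "\<sigma> * (normal_density 0 \<sigma> (\<sigma> * z) * f (\<sigma> * z)) = std_normal_density z * f (\<sigma> * z)"
      by (simp add: mult.assoc[symmetric])
  qed
  also have "\<dots> = integral\<^sup>L std_normal_distribution (\<lambda>z. f (\<sigma> * z))"
    by (simp add: integral_density)
  finally show ?thesis .
qed

context srrw_rvm
begin

lemma srrw_step_measurable:
  assumes "1 \<le> n"
  shows "(\<lambda>\<omega>. srrw_step (\<lambda>i. \<xi> i \<omega>) (\<lambda>i. \<alpha> i \<omega>) (\<lambda>i. \<beta> i \<omega>) n) \<in> borel_measurable M"
  using assms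
proof (induction n rule: less_induct)
  case (less n)
  let ?X = "\<lambda>k \<omega>. srrw_step (\<lambda>i. \<xi> i \<omega>) (\<lambda>i. \<alpha> i \<omega>) (\<lambda>i. \<beta> i \<omega>) k"
  have xi [measurable]: "\<xi> k \<in> borel_measurable M" if "1 \<le> k" for k
    using innov_indep that by (simp add: indep_vars_def2)
  show ?case
  proof (cases "n \<le> 1")
    case True
    then have "?X n = \<xi> 1" by (subst srrw_step.simps[abs_def]) simp
    then show ?thesis using xi[of 1] by simp
  next
    case False
    then have [measurable]: "\<alpha> n \<in> measurable M (count_space UNIV)" "\<beta> n \<in> measurable M (count_space UNIV)"
      using recoll_indep recall_indep by (simp_all add: indep_vars_def2)
    have [measurable]: "\<xi> n \<in> borel_measurable M" using xi less.prems by simp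
    have "(\<lambda>\<omega>. if 1 \<le> k \<and> k < n then ?X k \<omega> else 0) \<in> borel_measurable M" for k
    proof (cases "1 \<le> k \<and> k < n")
      case True
      then show ?thesis using less.IH[of k] by simp
    next
      case False
      then have "(\<lambda>\<omega>. if 1 \<le> k \<and> k < n then ?X k \<omega> else 0) = (\<lambda>_. 0)" by auto
      then show ?thesis by (simp only: borel_measurable_const)
    qed
    then have [measurable]: "(\<lambda>\<omega>. if 1 \<le> \<beta> n \<omega> \<and> \<beta> n \<omega> < n then ?X (\<beta> n \<omega>) \<omega> else 0) \<in> borel_measurable M"
      by (rule measurable_compose_countable) measurable
    have "?X n = (\<lambda>\<omega>. of_bool (\<alpha> n \<omega>) * (if 1 \<le> \<beta> n \<omega> \<and> \<beta> n \<omega> < n then ?X (\<beta> n \<omega>) \<omega> else 0)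
        + (1 - of_bool (\<alpha> n \<omega>)) * \<xi> n \<omega>)"
      using False by (subst srrw_step.simps[abs_def]) simp
    also have "\<dots> \<in> borel_measurable M" by measurable
    finally show ?thesis .
  qed
qed

lemma srrw_measurable: "(\<lambda>\<omega> n. srrw \<xi> \<alpha> \<beta> n \<omega>) \<in> borel_measurable M"
proof (rule measurable_coordinatewise_then_product)
  show "(\<lambda>\<omega>. srrw \<xi> \<alpha> \<beta> n \<omega>) \<in> borel_measurable M" for n
    unfolding srrw_def by (intro borel_measurable_sum srrw_step_measurable) auto
qed

end

section \<open>Identification of the limit\<close>

context critical_srrw
begin

text \<open>By definition \<open>\<sigma>\<^sup>2 = 4 * p\<^sup>2 * \<kappa> ^ 3 / (a +
  \<kappa>)\<close>, and the criticality relation \<open>p * \<kappa> = \<gamma> + 1 / 2\<close>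
  absorbs \<open>p\<close>.\<close>

lemma sigma_square: "\<sigma>\<^sup>2 = (2 * \<gamma> + 1)\<^sup>2 * (\<gamma> + 1) / (a + \<gamma> + 1)"
proof -
  have "\<sigma>\<^sup>2 = (2 * (p * \<kappa>))\<^sup>2 * \<kappa> / (a + \<kappa>)"
  proof -
    have "(sqrt slope)\<^sup>2 = slope" using slope_pos by simp
    then show ?thesis unfolding \<sigma>_def power_mult_distrib
      by (simp add: slope_def power2_eq_square power3_eq_cube)
  qed
  also have "2 * (p * \<kappa>) = 2 * \<gamma> + 1" unfolding p_kappa by simp
  finally show ?thesis by (simp add: add.assoc)
qed

lemma V_tail:
  assumes "L > 0" shows "prob {\<omega>\<in>space M. L \<le> \<bar>V n \<omega>\<bar>} \<le> \<sigma>\<^sup>2 / L\<^sup>2"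
proof -
  have V2: "(V n \<omega>)\<^sup>2 = \<sigma>\<^sup>2 * (MM n \<omega> / sqrt (s n))\<^sup>2" for \<omega> by (simp only: V_def power_mult_distrib)
  have "prob {\<omega>\<in>space M. L \<le> \<bar>V n \<omega>\<bar>} \<le> expectation (\<lambda>\<omega>. (V n \<omega>)\<^sup>2) / L\<^sup>2"
    by (rule markov_square) (use assms MM_normalised V2 in simp_all)
  also have "expectation (\<lambda>\<omega>. (V n \<omega>)\<^sup>2) \<le> \<sigma>\<^sup>2"
    unfolding V2 using MM_normalised(2)[of n] by (simp add: mult_left_le)
  finally show ?thesis by (simp add: divide_right_mono)
qed

text \<open>Off an event of small probability the path is close to
  \<open>sqrt_path (V n \<omega>)\<close> on a long interval and \<open>V n \<omega>\<close> is
  bounded by \<open>L\<close>, so \<open>uniform_near_sqrt_paths\<close> applies; on that event the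
  bound on \<open>\<Phi>\<close> suffices.\<close>

lemma functional_comparison:
  assumes \<Phi>: "continuous_map skorohod_topology euclideanreal \<Phi>" and C: "\<And>x. x \<in> skorohod_space \<Longrightarrow> \<bar>\<Phi> x\<bar> \<le> C"
  defines "W n \<omega> \<equiv> scaled_path n (scale n) (\<lambda>m. srrw \<xi> \<alpha> \<beta> m \<omega>)"
  shows "(\<lambda>n. expectation (\<lambda>\<omega>. \<Phi> (W n \<omega>)) - expectation (\<lambda>\<omega>. \<Phi> (sqrt_path (V n \<omega>)))) \<longlonglongrightarrow> 0"
proof (rule LIMSEQ_I)
  fix e :: real assume e: "e > 0"
  have C0: "C \<ge> 0" using C[OF sqrt_path_skorohod[of 0]] by linarith
  \<comment> \<open>Each of the two exceptional events gets probability at most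
    \<open>\<eta>\<close>, and \<open>2 * C * (2 * \<eta>) \<le> e / 2\<close>; the summand 1 covers
    \<open>C = 0\<close>.\<close>
  define \<eta> where "\<eta> = e / (8 * (C + 1))"
  have \<eta>: "\<eta> > 0" using e C0 by (simp add: \<eta>_def)
  \<comment> \<open>Makes the Chebyshev bound \<open>\<sigma>\<^sup>2 / L\<^sup>2\<close> at most
    \<open>\<eta>\<close>; the summand 1 keeps \<open>L\<close> positive when
    \<open>\<sigma> = 0\<close>.\<close>
  define L where "L = sqrt ((\<sigma>\<^sup>2 + 1) / \<eta>)"
  have L: "L > 0" using \<eta> by (simp add: L_def add_nonneg_pos)
  have "L\<^sup>2 = (\<sigma>\<^sup>2 + 1) / \<eta>" using \<eta> by (simp add: L_def)
  then have "\<sigma>\<^sup>2 / L\<^sup>2 = \<eta> * (\<sigma>\<^sup>2 / (\<sigma>\<^sup>2 + 1))" by simp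
  also have "\<dots> \<le> \<eta>" using \<eta> by (intro mult_left_le) (auto simp: divide_le_eq_1 add_nonneg_pos)
  finally have sL: "\<sigma>\<^sup>2 / L\<^sup>2 \<le> \<eta>" .
  obtain K :: nat and \<delta> where K: "1 \<le> K" "\<delta> > 0"
    and near: "\<And>v x. \<bar>v\<bar> \<le> L \<Longrightarrow> x \<in> skorohod_space \<Longrightarrow> (\<forall>t\<in>{0..real K}. \<bar>x t - sqrt t * v\<bar> < \<delta>) \<Longrightarrow>
      \<bar>\<Phi> x - \<Phi> (sqrt_path v)\<bar> < e / 4"
    using uniform_near_sqrt_paths[OF \<Phi>, of "e / 4" L] e by auto
  obtain E where E: "\<And>n. E n \<in> events" "\<forall>\<^sub>F n in sequentially. prob (E n) \<le> \<eta>"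
    "\<forall>\<^sub>F n in sequentially. \<forall>\<omega>\<in>space M - E n. \<forall>t\<in>{0..real K}.
      \<bar>S (nat \<lfloor>real n * t\<rfloor>) \<omega> / scale n - sqrt t * V n \<omega>\<bar> < \<delta>"
    using path_approximation[OF \<eta> K(2,1)] by blast
  have [measurable]: "\<Phi> \<in> borel_measurable (borel_of skorohod_topology)" by (rule continuous_map_borel_of[OF \<Phi>])
  have [measurable]: "W n \<in> M \<rightarrow>\<^sub>M borel_of skorohod_topology" for n
    unfolding W_def by (rule measurable_into_skorohod[OF scaled_path_skorohod scaled_path_continuous srrw_measurable])
  have [measurable]: "(\<lambda>\<omega>. sqrt_path (V n \<omega>)) \<in> M \<rightarrow>\<^sub>M borel_of skorohod_topology" for n
    by (rule measurable_into_skorohod[OF sqrt_path_skorohod sqrt_path_continuous V_measurable])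
  have i1: "integrable M (\<lambda>\<omega>. \<Phi> (W n \<omega>))" for n
  proof (rule integrable_const_bound[of _ C])
    show "AE \<omega> in M. norm (\<Phi> (W n \<omega>)) \<le> C" by (simp add: W_def C scaled_path_skorohod)
  qed measurable
  have i2: "integrable M (\<lambda>\<omega>. \<Phi> (sqrt_path (V n \<omega>)))" for n
    by (rule integrable_const_bound[of _ C]) (auto intro!: C sqrt_path_skorohod)
  from E(2,3) have "\<forall>\<^sub>F n in sequentially. norm (expectation (\<lambda>\<omega>. \<Phi> (W n \<omega>)) - expectation (\<lambda>\<omega>. \<Phi> (sqrt_path (V n \<omega>))) - 0) < e"
  proof eventually_elim
    case (elim n)
    define B where "B = {\<omega>\<in>space M. L \<le> \<bar>V n \<omega>\<bar>}"
    have B [measurable]: "B \<in> events" unfolding B_def by measurable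
    have EB: "E n \<union> B \<in> events" using E(1) B by (rule sets.Un)
    have "prob (E n \<union> B) \<le> prob (E n) + prob B" by (rule measure_Un_le[OF E(1) B])
    moreover have "prob B \<le> \<eta>" using V_tail[OF L, of n] sL by (simp add: B_def)
    ultimately have pEB: "prob (E n \<union> B) \<le> 2 * \<eta>" using elim(1) by simp
    have "AE \<omega> in M. \<bar>\<Phi> (W n \<omega>) - \<Phi> (sqrt_path (V n \<omega>))\<bar> \<le> e / 4 + 2 * C * indicator (E n \<union> B) \<omega>"
      using srrw_eq_AE AE_space
    proof eventually_elim
      case w: (elim \<omega>)
      show ?case
      proof (cases "\<omega> \<in> E n \<union> B")
        case True
        have "\<bar>\<Phi> (W n \<omega>)\<bar> \<le> C" "\<bar>\<Phi> (sqrt_path (V n \<omega>))\<bar> \<le> C"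
          unfolding W_def by (intro C scaled_path_skorohod sqrt_path_skorohod)+
        then have "\<bar>\<Phi> (W n \<omega>) - \<Phi> (sqrt_path (V n \<omega>))\<bar> \<le> 2 * C" by linarith
        then show ?thesis using True e by simp
      next
        case False
        have eq: "srrw \<xi> \<alpha> \<beta> m \<omega> = S m \<omega>" for m using w(1) by (simp add: S_def)
        have "\<bar>\<Phi> (W n \<omega>) - \<Phi> (sqrt_path (V n \<omega>))\<bar> < e / 4"
        proof (rule near)
          show "\<bar>V n \<omega>\<bar> \<le> L" using False w(2) by (auto simp: B_def)
          show "W n \<omega> \<in> skorohod_space" unfolding W_def by (rule scaled_path_skorohod)
          show "\<forall>t\<in>{0..real K}. \<bar>W n \<omega> t - sqrt t * V n \<omega>\<bar> < \<delta>"
          proof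
            fix t assume t: "t \<in> {0..real K}"
            have "\<omega> \<in> space M - E n" using w(2) False by simp
            from bspec[OF bspec[OF elim(2) this] t] t
            show "\<bar>W n \<omega> t - sqrt t * V n \<omega>\<bar> < \<delta>" by (simp add: W_def scaled_path_def eq)
          qed
        qed
        then show ?thesis using False by simp
      qed
    qed
    then have "expectation (\<lambda>\<omega>. \<bar>\<Phi> (W n \<omega>) - \<Phi> (sqrt_path (V n \<omega>))\<bar>) \<le> expectation (\<lambda>\<omega>. e / 4 + 2 * C * indicator (E n \<union> B) \<omega>)"
      using i1 i2 EB by (intro integral_mono_AE) (auto intro!: integrable_real_indicator simp: less_top[symmetric])
    also have "\<dots> = e / 4 + 2 * C * prob (E n \<union> B)"
      using EB prob_space by (subst Bochner_Integration.integral_add)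
        (auto intro!: integrable_real_indicator simp: less_top[symmetric])
    also have "2 * C * prob (E n \<union> B) \<le> 2 * C * (2 * \<eta>)" using pEB C0 by (intro mult_left_mono) auto
    also have "2 * C * (2 * \<eta>) \<le> e / 2"
      using C0 e by (simp add: \<eta>_def field_simps)
    finally have "expectation (\<lambda>\<omega>. \<bar>\<Phi> (W n \<omega>) - \<Phi> (sqrt_path (V n \<omega>))\<bar>) < e" using e by simp
    moreover have "\<bar>expectation (\<lambda>\<omega>. \<Phi> (W n \<omega>) - \<Phi> (sqrt_path (V n \<omega>)))\<bar> \<le> expectation (\<lambda>\<omega>. \<bar>\<Phi> (W n \<omega>) - \<Phi> (sqrt_path (V n \<omega>))\<bar>)"
      using integral_norm_bound[of M "\<lambda>\<omega>. \<Phi> (W n \<omega>) - \<Phi> (sqrt_path (V n \<omega>))"] by simp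
    ultimately show ?case using i1 i2 by simp
  qed
  then show "\<exists>no. \<forall>n\<ge>no. norm (expectation (\<lambda>\<omega>. \<Phi> (W n \<omega>)) - expectation (\<lambda>\<omega>. \<Phi> (sqrt_path (V n \<omega>))) - 0) < e"
    by (simp add: eventually_sequentially)
qed

end

theorem corollary4p9:
  fixes M :: "'a measure" and M' :: "'b measure"
    and p \<gamma> a :: real
    and \<mu> :: "nat \<Rightarrow> real"
    and \<xi> :: "nat \<Rightarrow> 'a \<Rightarrow> real"
    and \<alpha> :: "nat \<Rightarrow> 'a \<Rightarrow> bool"
    and \<beta> :: "nat \<Rightarrow> 'a \<Rightarrow> nat"
    and N :: "'b \<Rightarrow> real"
  assumes model: "srrw_rvm M p \<gamma> \<mu> \<xi> \<alpha> \<beta>"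
    and sq_integrable: "integrable M (\<lambda>\<omega>. (\<xi> 1 \<omega>)\<^sup>2)"
    and unit_variance: "prob_space.variance M (\<xi> 1) = 1"
    and critical: "p = critical_prob \<gamma>"
    and assumption_A: "memory_assumption \<mu> \<gamma> a"
    and index: "a + \<gamma> + 1 > 0"
    and M': "prob_space M'"
    and N_meas: "N \<in> borel_measurable M'"
    and N_law: "distr M' borel N
                  = centered_gaussian ((2 * \<gamma> + 1)\<^sup>2 * (\<gamma> + 1) / (a + \<gamma> + 1))"
  shows "converges_weakly_in skorohod_topology
           M (\<lambda>n \<omega>. \<lambda>t\<in>{0..}.
                srrw \<xi> \<alpha> \<beta> (nat \<lfloor>real n * t\<rfloor>) \<omega> / sqrt (real n * ln (real n)))
           M' (\<lambda>\<omega>. \<lambda>t\<in>{0..}. sqrt t * N \<omega>)"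
proof -
  interpret srrw_rvm M p \<gamma> \<mu> \<xi> \<alpha> \<beta> by (rule model)
  interpret critical_srrw M p \<gamma> \<mu> \<xi> \<alpha> \<beta> a
  proof unfold_locales
    show "(\<lambda>n. real n * ln (real n) * (\<mu> (Suc (Suc n)) / \<mu> (Suc n) - 1 - \<gamma> / real n)) \<longlonglongrightarrow> a"
      by (rule memory_assumption_rate[OF assumption_A])
  qed (use memory_pos gamma_gt p_range critical index sq_integrable unit_variance in auto)
  have paths: "(\<lambda>t\<in>{0..}. srrw \<xi> \<alpha> \<beta> (nat \<lfloor>real n * t\<rfloor>) \<omega> / sqrt (real n * ln (real n)))
      = scaled_path n (scale n) (\<lambda>m. srrw \<xi> \<alpha> \<beta> m \<omega>)" for n \<omega>
    by (simp add: scaled_path_def)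
  have limit: "(\<lambda>t\<in>{0..}. sqrt t * N \<omega>) = sqrt_path (N \<omega>)" for \<omega>
    by (simp add: sqrt_path_def)
  show ?thesis
    unfolding converges_weakly_in_def paths limit
  proof (intro conjI allI impI)
    show "(\<lambda>\<omega>. scaled_path n (scale n) (\<lambda>m. srrw \<xi> \<alpha> \<beta> m \<omega>)) \<in> M \<rightarrow>\<^sub>M borel_of skorohod_topology" for n
      by (rule measurable_into_skorohod[OF scaled_path_skorohod scaled_path_continuous srrw_measurable])
    show "(\<lambda>\<omega>. sqrt_path (N \<omega>)) \<in> M' \<rightarrow>\<^sub>M borel_of skorohod_topology"
      by (rule measurable_into_skorohod[OF sqrt_path_skorohod sqrt_path_continuous N_meas])
    fix \<Phi> assume \<Phi>: "continuous_map skorohod_topology euclideanreal \<Phi>" and bd: "bounded (\<Phi> ` topspace skorohod_topology)"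
    from bd obtain C where C: "\<And>x. x \<in> skorohod_space \<Longrightarrow> \<bar>\<Phi> x\<bar> \<le> C"
      by (auto simp: bounded_iff)
    \<comment> \<open>Restricted to the limit paths, the functional is a bounded continuous function
      of one real variable, to which \<open>clt\<close> applies.\<close>
    define \<psi> where "\<psi> v = \<Phi> (sqrt_path v)" for v
    have cont: "isCont \<psi> v" for v
      unfolding continuous_at_sequentially comp_def \<psi>_def
      by (intro allI impI continuous_map_skorohod_sequentially[OF \<Phi>] sqrt_path_skorohod sqrt_path_continuous)
    have \<psi>_meas: "\<psi> \<in> borel_measurable borel"
      by (intro borel_measurable_continuous_onI continuous_at_imp_continuous_on) (use cont in auto)
    have "(\<lambda>n. expectation (\<lambda>\<omega>. \<psi> (\<sigma> * (MM n \<omega> / sqrt (s n))))) \<longlonglongrightarrow> integral\<^sup>L std_normal_distribution (\<lambda>z. \<psi> (\<sigma> * z))"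
    proof (rule clt)
      show "isCont (\<lambda>z. \<psi> (\<sigma> * z)) z" for z
        by (rule isCont_o2[OF _ cont]) (intro continuous_intros)
      show "\<bar>\<psi> (\<sigma> * z)\<bar> \<le> C" for z unfolding \<psi>_def by (rule C[OF sqrt_path_skorohod])
    qed
    then have "(\<lambda>n. expectation (\<lambda>\<omega>. \<Phi> (sqrt_path (V n \<omega>)))) \<longlonglongrightarrow> integral\<^sup>L std_normal_distribution (\<lambda>z. \<psi> (\<sigma> * z))"
      by (simp add: V_def \<psi>_def)
    from tendsto_add[OF functional_comparison[OF \<Phi> C] this]
    have "(\<lambda>n. expectation (\<lambda>\<omega>. \<Phi> (scaled_path n (scale n) (\<lambda>m. srrw \<xi> \<alpha> \<beta> m \<omega>))))
        \<longlonglongrightarrow> integral\<^sup>L std_normal_distribution (\<lambda>z. \<psi> (\<sigma> * z))" by simp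
    also have "integral\<^sup>L std_normal_distribution (\<lambda>z. \<psi> (\<sigma> * z)) = integral\<^sup>L (distr M' borel N) \<psi>"
      unfolding N_law sigma_square[symmetric] by (rule integral_centered_gaussian[OF \<psi>_meas sigma_nonneg, symmetric])
    also have "\<dots> = integral\<^sup>L M' (\<lambda>\<omega>. \<Phi> (sqrt_path (N \<omega>)))"
      using N_meas \<psi>_meas by (simp add: integral_distr \<psi>_def)
    finally show "(\<lambda>n. expectation (\<lambda>\<omega>. \<Phi> (scaled_path n (scale n) (\<lambda>m. srrw \<xi> \<alpha> \<beta> m \<omega>))))
        \<longlonglongrightarrow> integral\<^sup>L M' (\<lambda>\<omega>. \<Phi> (sqrt_path (N \<omega>)))" .
  qed
qed

end
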